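(* Let $\mathbf{u}=(u_1,\dots,u_k)\in H^1_0(\Omega,\Sigma_k)$ be a minimizer of problem (P) and let $i\in\{1,\dots,k\}$. Then $$-\Delta u_i\le \lambda_{2,1}(\omega_i)\mathbf{1}_{\{u_i>0\}}\quad\text{in }\Omega,$$ $$-\Delta\Big(u_i-\sum_{j\ne i}u_j\Big)\ge \lambda_{2,1}(\omega_i)\mathbf{1}_{\{u_i>0\}\cup\{\mathbf{u}=0\}}-\sum_{j\neq i}\lambda_{2,1}(\omega_j)\mathbf{1}_{\{u_j>0\}}\quad\text{in }\Omega,$$ where the inequalities are understood in the weak sense.
   Context: $N\ge 2$, $\Omega\subset\mathbb{R}^N$ is a bounded smooth domain, $k\in\mathbb{N}$, $k\ge1$. For an open non-empty set $\omega\subset\Omega$, $\lambda_{2,1}(\omega):=\inf\{\int_\omega|\nabla u|^2\,dx \mid u\in H^1_0(\omega),\ \|u\|_{L^1(\omega)}=1\}$. $\Sigma_k:=\{\xi\in\mathbb{R}^k\mid\sum_{i\ne j}\xi_i^2\xi_j^2=0\}$, and $H^1_0(\Omega,\Sigma_k)$ is the set of $\mathbf{u}\in H^1_0(\Omega,\mathbb{R}^k)$ with $\mathbf{u}(x)\in\Sigma_k$ for a.e. $x$. Problem (P) is $$\inf\Big\{\int_\Omega|\nabla\mathbf{u}|^2\,dx\ \Big|\ \mathbf{u}\in H^1_0(\Omega,\Sigma_k),\ \mathbf{u}\ge0,\ \|u_i\|_{L^1(\Omega)}=1\text{ for every }i=1,\dots,k\Big\},$$ where $|\nabla\mathbf{u}|^2=\sum_i|\nabla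 u_i|^2$ and $\mathbf{u}\ge0$ is meant componentwise. For a minimizer $\mathbf{u}$, $\omega_i:=\{u_i>0\}$ (for the continuous representative, so that $\omega_i$ is open; one has $\lambda_{2,1}(\omega_i)=\int_\Omega|\nabla u_i|^2\,dx$). $\mathbf{1}_A$ is the characteristic function of $A$. *)

theory Defs
  imports "HOL-Analysis.Analysis"
begin

section \<open>Smooth functions and smooth domains\<close>

text \<open>Intended for open \<open>S\<close>.\<close>

primrec C_k_on :: "nat \<Rightarrow> (real^'n \<Rightarrow> real) \<Rightarrow> (real^'n) set \<Rightarrow> bool" where
  "C_k_on 0 f S \<longleftrightarrow> continuous_on S f"
| "C_k_on (Suc m) f S \<longleftrightarrow>
     (\<forall>x\<in>S. f differentiable (at x)) \<and>
     (\<forall>b. C_k_on m (\<lambda>x. frechet_derivative f (at x) b) S)"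

definition C_infinity_on :: "(real^'n \<Rightarrow> real) \<Rightarrow> (real^'n) set \<Rightarrow> bool" where
  "C_infinity_on f S \<longleftrightarrow> (\<forall>m. C_k_on m f S)"

text \<open>Near every boundary point, \<open>\<Omega>\<close> is the region above the graph of a smooth function in some
  rotated coordinate system: \<open>\<nu>\<close> is the vertical direction, and \<open>\<gamma>\<close> is evaluated only at the
  projection of \<open>x\<close> to the hyperplane orthogonal to \<open>\<nu>\<close>.\<close>

definition smooth_boundary :: "(real^'n) set \<Rightarrow> bool" where
  "smooth_boundary \<Omega> \<longleftrightarrow>
     (\<forall>p\<in>frontier \<Omega>. \<exists>r>0. \<exists>\<nu> \<gamma>. norm \<nu> = 1 \<and> C_infinity_on \<gamma> UNIV \<and>
        \<Omega> \<inter> ball p r = {x \<in> ball p r. \<gamma> (x - (x \<bullet> \<nu>) *\<^sub>R \<nu>) < x \<bullet> \<nu>})"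

definition bounded_smooth_domain :: "(real^'n) set \<Rightarrow> bool" where
  "bounded_smooth_domain \<Omega> \<longleftrightarrow>
     open \<Omega> \<and> connected \<Omega> \<and> \<Omega> \<noteq> {} \<and> bounded \<Omega> \<and> smooth_boundary \<Omega>"


section \<open>Sobolev spaces\<close>

text \<open>Elements of the function spaces are represented by functions on the whole of \<open>real^'n\<close> of which
  only the values almost everywhere on \<open>\<Omega>\<close> matter.\<close>

definition L2 :: "(real^'n) set \<Rightarrow> (real^'n \<Rightarrow> 'b::euclidean_space) set" where
  "L2 \<Omega> = {f. f \<in> borel_measurable (lebesgue_on \<Omega>) \<and>
              integrable (lebesgue_on \<Omega>) (\<lambda>x. (norm (f x))\<^sup>2)}"

definition test_functions :: "(real^'n) set \<Rightarrow> (real^'n \<Rightarrow> real) set" where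
  "test_functions \<Omega> = {\<phi>. C_infinity_on \<phi> UNIV \<and>
     compact (closure {x. \<phi> x \<noteq> 0}) \<and> closure {x. \<phi> x \<noteq> 0} \<subseteq> \<Omega>}"

definition gradient :: "(real^'n \<Rightarrow> real) \<Rightarrow> real^'n \<Rightarrow> real^'n" where
  "gradient \<phi> x = (\<chi> j. frechet_derivative \<phi> (at x) (axis j 1))"

definition has_weak_gradient ::
    "(real^'n) set \<Rightarrow> (real^'n \<Rightarrow> real) \<Rightarrow> (real^'n \<Rightarrow> real^'n) \<Rightarrow> bool" where
  "has_weak_gradient \<Omega> u g \<longleftrightarrow>
     (\<forall>\<phi>\<in>test_functions \<Omega>. \<forall>j.
        (LINT x|lebesgue_on \<Omega>. u x * gradient \<phi> x $ j) = - (LINT x|lebesgue_on \<Omega>. g x $ j * \<phi> x))"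

definition H1 :: "(real^'n) set \<Rightarrow> (real^'n \<Rightarrow> real) set" where
  "H1 \<Omega> = {u \<in> L2 \<Omega>. \<exists>g\<in>L2 \<Omega>. has_weak_gradient \<Omega> u g}"

text \<open>Determined almost everywhere on \<open>\<Omega>\<close> for \<open>u \<in> H1 \<Omega>\<close>, and arbitrary for other \<open>u\<close>.\<close>

definition weak_gradient :: "(real^'n) set \<Rightarrow> (real^'n \<Rightarrow> real) \<Rightarrow> real^'n \<Rightarrow> real^'n" where
  "weak_gradient \<Omega> u = (SOME g. g \<in> L2 \<Omega> \<and> has_weak_gradient \<Omega> u g)"

definition H1_norm :: "(real^'n) set \<Rightarrow> (real^'n \<Rightarrow> real) \<Rightarrow> real" where
  "H1_norm \<Omega> u = sqrt ((LINT x|lebesgue_on \<Omega>. (u x)\<^sup>2) +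
                       (LINT x|lebesgue_on \<Omega>. (norm (weak_gradient \<Omega> u x))\<^sup>2))"

definition H10 :: "(real^'n) set \<Rightarrow> (real^'n \<Rightarrow> real) set" where
  "H10 \<Omega> = {u \<in> H1 \<Omega>. \<forall>e>0. \<exists>\<phi>\<in>test_functions \<Omega>. H1_norm \<Omega> (\<lambda>x. u x - \<phi> x) < e}"

definition dirichlet_energy :: "(real^'n) set \<Rightarrow> (real^'n \<Rightarrow> real) \<Rightarrow> real" where
  "dirichlet_energy \<Omega> u = (LINT x|lebesgue_on \<Omega>. (norm (weak_gradient \<Omega> u x))\<^sup>2)"

definition L1_norm :: "(real^'n) set \<Rightarrow> (real^'n \<Rightarrow> real) \<Rightarrow> real" where
  "L1_norm \<Omega> u = (LINT x|lebesgue_on \<Omega>. \<bar>u x\<bar>)"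

definition lambda21 :: "(real^'n) set \<Rightarrow> real" where
  "lambda21 \<omega> = Inf {dirichlet_energy \<omega> u |u. u \<in> H10 \<omega> \<and> L1_norm \<omega> u = 1}"


section \<open>The segregated minimization problem\<close>

definition Sigma_k :: "(real^'k) set" where
  "Sigma_k = {\<xi>. (\<Sum>(i, j)\<in>{(i, j). i \<noteq> j}. (\<xi> $ i)\<^sup>2 * (\<xi> $ j)\<^sup>2) = 0}"

definition H10_Sigma :: "(real^'n) set \<Rightarrow> (real^'n \<Rightarrow> real^'k) set" where
  "H10_Sigma \<Omega> = {u. (\<forall>i. (\<lambda>x. u x $ i) \<in> H10 \<Omega>) \<and> (AE x in lebesgue_on \<Omega>. u x \<in> Sigma_k)}"

definition admissible :: "(real^'n) set \<Rightarrow> (real^'n \<Rightarrow> real^'k) \<Rightarrow> bool" where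
  "admissible \<Omega> u \<longleftrightarrow> u \<in> H10_Sigma \<Omega> \<and>
     (AE x in lebesgue_on \<Omega>. \<forall>i. 0 \<le> u x $ i) \<and>
     (\<forall>i. L1_norm \<Omega> (\<lambda>x. u x $ i) = 1)"

definition vector_energy :: "(real^'n) set \<Rightarrow> (real^'n \<Rightarrow> real^'k) \<Rightarrow> real" where
  "vector_energy \<Omega> u =
     (LINT x|lebesgue_on \<Omega>. (\<Sum>i\<in>UNIV. (norm (weak_gradient \<Omega> (\<lambda>y. u y $ i) x))\<^sup>2))"

definition minimizer_P :: "(real^'n) set \<Rightarrow> (real^'n \<Rightarrow> real^'k) \<Rightarrow> bool" where
  "minimizer_P \<Omega> u \<longleftrightarrow>
     admissible \<Omega> u \<and> (\<forall>v::real^'n \<Rightarrow> real^'k. admissible \<Omega> v \<longrightarrow> vector_energy \<Omega> u \<le> vector_energy \<Omega> v)"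

text \<open>The class of a minimizer has a continuous representative; the sets \<open>{u\<^sub>i > 0}\<close> and \<open>{u = 0}\<close>
  are those of this representative, which makes the former open.\<close>

definition continuous_representative ::
    "(real^'n) set \<Rightarrow> (real^'n \<Rightarrow> real^'k) \<Rightarrow> (real^'n \<Rightarrow> real^'k) \<Rightarrow> bool" where
  "continuous_representative \<Omega> u w \<longleftrightarrow>
     continuous_on \<Omega> w \<and> (AE x in lebesgue_on \<Omega>. w x = u x)"

definition positivity_set :: "(real^'n) set \<Rightarrow> (real^'n \<Rightarrow> real^'k) \<Rightarrow> 'k \<Rightarrow> (real^'n) set" where
  "positivity_set \<Omega> w i = {x \<in> \<Omega>. 0 < w x $ i}"

definition zero_set :: "(real^'n) set \<Rightarrow> (real^'n \<Rightarrow> real^'k) \<Rightarrow> (real^'n) set" where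
  "zero_set \<Omega> w = {x \<in> \<Omega>. w x = 0}"


section \<open>Weak differential inequalities\<close>

text \<open>\<open>-\<Delta>v \<le> f\<close> and \<open>-\<Delta>v \<ge> f\<close> in \<open>\<Omega>\<close>, tested with nonnegative test functions.\<close>

definition weak_neg_laplacian_le ::
    "(real^'n) set \<Rightarrow> (real^'n \<Rightarrow> real) \<Rightarrow> (real^'n \<Rightarrow> real) \<Rightarrow> bool" where
  "weak_neg_laplacian_le \<Omega> v f \<longleftrightarrow> v \<in> H1 \<Omega> \<and>
     (\<forall>\<phi>\<in>test_functions \<Omega>. (\<forall>x. 0 \<le> \<phi> x) \<longrightarrow>
        (LINT x|lebesgue_on \<Omega>. weak_gradient \<Omega> v x \<bullet> gradient \<phi> x) \<le> (LINT x|lebesgue_on \<Omega>. f x * \<phi> x))"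

definition weak_neg_laplacian_ge ::
    "(real^'n) set \<Rightarrow> (real^'n \<Rightarrow> real) \<Rightarrow> (real^'n \<Rightarrow> real) \<Rightarrow> bool" where
  "weak_neg_laplacian_ge \<Omega> v f \<longleftrightarrow> v \<in> H1 \<Omega> \<and>
     (\<forall>\<phi>\<in>test_functions \<Omega>. (\<forall>x. 0 \<le> \<phi> x) \<longrightarrow>
        (LINT x|lebesgue_on \<Omega>. weak_gradient \<Omega> v x \<bullet> gradient \<phi> x) \<ge> (LINT x|lebesgue_on \<Omega>. f x * \<phi> x))"

end

theory Submission
  imports Defs "HOL-Computational_Algebra.Polynomial"
begin

text \<open>Each inequality compares \<open>u\<close> with a competitor depending on a small parameter \<open>t > 0\<close>.
  Replacing \<open>u\<^sub>i\<close> by \<open>(u\<^sub>i - t \<phi>)\<^sup>+\<close> gives the first one. For the second, \<open>u\<^sub>i\<close> is replaced by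
  \<open>(u\<^sub>i - \<Sum>\<^sub>j u\<^sub>j + t \<phi>)\<^sup>+\<close> and \<open>u\<^sub>j\<close> by \<open>(u\<^sub>j - t \<phi>)\<^sup>+\<close> for \<open>j \<noteq> i\<close>: the energies of these
  functions add up to at most that of \<open>u\<^sub>i - \<Sum>\<^sub>j u\<^sub>j + t \<phi>\<close>, and their masses are bounded below to first order
  by integrals of \<open>\<phi>\<close> over the sets in the statement. After normalization the total energy is
  bounded by an explicit function of \<open>t\<close> with equality at \<open>t = 0\<close>, whose derivative there must
  be nonnegative.

  Only functions in \<open>H\<^sup>1\<^sub>0\<close> occur, so the chain rule for the positive part is obtained directly from
  approximating test functions, without mollification. The equality of \<open>\<lambda>\<^sub>2\<^sub>,\<^sub>1(\<omega>\<^sub>i)\<close> with the energy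
  of \<open>u\<^sub>i\<close> rests on approximating \<open>u\<^sub>i\<close> by functions with compact support in \<open>\<omega>\<^sub>i\<close>.\<close>

section \<open>Calculus of smooth functions\<close>

text \<open>Segregation is what makes the second competitor work: at almost every point at most one
  component of \<open>u\<close> is nonzero, so the new components have disjoint supports and each of
  their gradients, where it is nonzero, is up to sign that of
  \<open>u\<^sub>i - \<Sum>\<^sub>j u\<^sub>j + t \<phi>\<close>. Where \<open>u\<close> vanishes,
  the new i-th component is \<open>t \<phi>\<close> while the others stay zero; this gain of mass
  produces the set {u = 0} in the second inequality. The obstacle is that only the sum of the new
  energies is bounded in this way, whereas each energy is divided by its own squared mass. All
  quotients are therefore given the weight of the i-th one. The differences of weights that remain
  are nonnegative and vanish at \<open>t = 0\<close>, so a separate, cruder bound for the energies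
  with j different from i suffices, and only its value at \<open>t = 0\<close> enters the
  derivative. These corrections cancel all of the total energy in the derivative except the energy
  of \<open>u\<^sub>i\<close>.\<close>

lemma frechet_derivative_eqI:
  "(f has_derivative f') (at x) \<Longrightarrow> frechet_derivative f (at x) = f'"
  using frechet_derivative_at by metis

lemma has_derivative_frechet:
  "f differentiable (at x) \<Longrightarrow> (f has_derivative frechet_derivative f (at x)) (at x)"
  by (simp add: frechet_derivative_works)

lemma C_k_on_SucI:
  assumes "\<And>x. (f has_derivative f' x) (at x)" "\<And>b. C_k_on m (\<lambda>x. f' x b) UNIV"
  shows "C_k_on (Suc m) f UNIV"
proof -
  have "frechet_derivative f (at x) = f' x" for x
    using assms(1) by (rule frechet_derivative_eqI)
  then show ?thesis
    using assms by (auto simp: differentiable_def)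
qed

text \<open>The product and chain rules keep undifferentiated factors, and the inductions below need
  these in the lower class.\<close>

lemma C_k_on_SucD: "C_k_on (Suc m) f S \<Longrightarrow> C_k_on m f S"
proof (induction m arbitrary: f)
  case 0
  then show ?case
    by (auto intro!: continuous_at_imp_continuous_on differentiable_imp_continuous_within)
next
  case (Suc m)
  from Suc.prems have "\<forall>x\<in>S. f differentiable (at x)"
    "\<And>b. C_k_on (Suc m) (\<lambda>x. frechet_derivative f (at x) b) S"
    by (auto simp only: C_k_on.simps)
  with Suc.IH show ?case by auto
qed

lemma C_k_on_const: "C_k_on m (\<lambda>x. c) UNIV"
proof (induction m arbitrary: c)
  case (Suc m)
  show ?case by (rule C_k_on_SucI[where f'="\<lambda>x h. 0"]) (use Suc in auto)
qed auto

lemma C_k_on_inner: "C_k_on m (\<lambda>x. x \<bullet> a) UNIV"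
proof (cases m)
  case (Suc k)
  show ?thesis unfolding Suc
    by (rule C_k_on_SucI[where f'="\<lambda>x h. h \<bullet> a"])
       (auto intro!: derivative_eq_intros C_k_on_const)
qed (auto intro!: continuous_intros)

lemma C_k_on_add:
  "C_k_on m f UNIV \<Longrightarrow> C_k_on m g UNIV \<Longrightarrow> C_k_on m (\<lambda>x. f x + g x) UNIV"
proof (induction m arbitrary: f g)
  case 0 then show ?case by (auto intro!: continuous_intros)
next
  case (Suc m)
  show ?case
  proof (rule C_k_on_SucI)
    show "((\<lambda>x. f x + g x) has_derivative
        (\<lambda>h. frechet_derivative f (at x) h + frechet_derivative g (at x) h)) (at x)" for x
      using Suc.prems by (intro has_derivative_add has_derivative_frechet) auto
  qed (use Suc in auto)
qed

lemma C_k_on_mult: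
  "C_k_on m f UNIV \<Longrightarrow> C_k_on m g UNIV \<Longrightarrow> C_k_on m (\<lambda>x. f x * g x) UNIV"
proof (induction m arbitrary: f g)
  case 0 then show ?case by (auto intro!: continuous_intros)
next
  case (Suc m)
  show ?case
  proof (rule C_k_on_SucI)
    show "((\<lambda>x. f x * g x) has_derivative
        (\<lambda>h. f x * frechet_derivative g (at x) h + frechet_derivative f (at x) h * g x)) (at x)" for x
      using Suc.prems by (intro has_derivative_mult has_derivative_frechet) auto
    show "C_k_on m (\<lambda>x. f x * frechet_derivative g (at x) b + frechet_derivative f (at x) b * g x) UNIV" for b
      using C_k_on_SucD[OF Suc.prems(1)] C_k_on_SucD[OF Suc.prems(2)] Suc.prems
      by (intro C_k_on_add Suc.IH) auto
  qed
qed

text \<open>The outer function comes with the sequence of all its derivatives, and the induction is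
  over all \<open>k\<close> at once, because the chain rule replaces \<open>F k\<close> by
  \<open>F (Suc k)\<close>.\<close>

lemma C_k_on_compose:
  fixes F :: "nat \<Rightarrow> real \<Rightarrow> real"
  assumes "\<And>k t. (F k has_real_derivative F (Suc k) t) (at t)"
  shows "C_k_on m f UNIV \<Longrightarrow> C_k_on m (\<lambda>x. F k (f x)) UNIV"
proof (induction m arbitrary: f k)
  case 0
  have "continuous_on UNIV (F k)"
    using assms by (meson DERIV_continuous continuous_at_imp_continuous_on)
  with 0 show ?case
    by (auto intro: continuous_on_compose2)
next
  case (Suc m)
  show ?case
  proof (rule C_k_on_SucI)
    show "((\<lambda>x. F k (f x)) has_derivative
        (\<lambda>h. F (Suc k) (f x) * frechet_derivative f (at x) h)) (at x)" for x
      using Suc.prems has_derivative_compose[OF has_derivative_frechet[of f x]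
        assms[of k "f x", unfolded has_field_derivative_def]] by auto
    show "C_k_on m (\<lambda>x. F (Suc k) (f x) * frechet_derivative f (at x) b) UNIV" for b
      using C_k_on_SucD[OF Suc.prems] Suc.prems by (intro C_k_on_mult Suc.IH) auto
  qed
qed

definition smooth :: "(real^'n \<Rightarrow> real) \<Rightarrow> bool" where
  "smooth f \<longleftrightarrow> C_infinity_on f UNIV"

text \<open>\<open>C_k_on\<close> speaks of functions on \<open>real^'n\<close>. On the real line,
  smoothness is given by a sequence of successive derivatives, the form in which
  \<open>C_k_on_compose\<close> takes the outer function.\<close>

definition smooth_real :: "(real \<Rightarrow> real) \<Rightarrow> bool" where
  "smooth_real f \<longleftrightarrow> (\<exists>F. F 0 = f \<and> (\<forall>k t. (F k has_real_derivative F (Suc k) t) (at t)))"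

lemma smooth_const: "smooth (\<lambda>x. c)"
  and smooth_inner: "smooth (\<lambda>x. x \<bullet> a)"
  and smooth_add: "smooth f \<Longrightarrow> smooth g \<Longrightarrow> smooth (\<lambda>x. f x + g x)"
  and smooth_mult: "smooth f \<Longrightarrow> smooth g \<Longrightarrow> smooth (\<lambda>x. f x * g x)"
  by (simp_all add: smooth_def C_infinity_on_def C_k_on_const C_k_on_inner C_k_on_add C_k_on_mult)

lemma smooth_compose: "smooth_real f \<Longrightarrow> smooth g \<Longrightarrow> smooth (\<lambda>x. f (g x))"
  unfolding smooth_real_def smooth_def C_infinity_on_def
  by (metis C_k_on_compose)

lemma smooth_diff: "smooth f \<Longrightarrow> smooth g \<Longrightarrow> smooth (\<lambda>x. f x - g x)"
  using smooth_add[of f "\<lambda>x. (-1) * g x"] smooth_mult[of "\<lambda>x. -1" g] smooth_const by fastforce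

lemma smooth_sum: "(\<And>i. i \<in> I \<Longrightarrow> smooth (f i)) \<Longrightarrow> smooth (\<lambda>x. \<Sum>i\<in>I. f i x)"
  by (induction I rule: infinite_finite_induct) (auto intro: smooth_const smooth_add)

lemma smooth_differentiable: "smooth f \<Longrightarrow> f differentiable (at x)"
  by (auto simp: smooth_def C_infinity_on_def dest!: spec[where x="Suc 0"])

lemma smooth_frechet_derivative: "smooth f \<Longrightarrow> smooth (\<lambda>x. frechet_derivative f (at x) b)"
  unfolding smooth_def C_infinity_on_def by (metis C_k_on.simps(2))

lemma smooth_continuous: "smooth f \<Longrightarrow> continuous_on S f"
  by (auto simp: smooth_def C_infinity_on_def intro: continuous_on_subset dest!: spec[where x=0])

section \<open>Gradients of smooth functions\<close>

lemma gradient_works: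
  assumes "f differentiable (at x)"
  shows "(f has_derivative (\<lambda>h. gradient f x \<bullet> h)) (at x)"
proof -
  have lin: "linear (frechet_derivative f (at x))"
    using assms by (simp add: frechet_derivative_works has_derivative_linear)
  have "frechet_derivative f (at x) = (\<lambda>h. gradient f x \<bullet> h)"
  proof
    fix h
    have "frechet_derivative f (at x) h = frechet_derivative f (at x) (\<Sum>j\<in>UNIV. h $ j *\<^sub>R axis j 1)"
      using basis_expansion[of h] by (simp add: scalar_mult_eq_scaleR)
    also have "\<dots> = (\<Sum>j\<in>UNIV. h $ j * frechet_derivative f (at x) (axis j 1))"
      by (simp add: linear_sum[OF lin] linear_scale[OF lin])
    finally show "frechet_derivative f (at x) h = gradient f x \<bullet> h"
      by (simp add: gradient_def inner_vec_def mult.commute)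
  qed
  with assms show ?thesis by (simp add: frechet_derivative_works)
qed

lemma gradient_eqI: "(f has_derivative (\<lambda>h. G \<bullet> h)) (at x) \<Longrightarrow> gradient f x = G"
  by (auto simp: gradient_def frechet_derivative_eqI[of f] vec_eq_iff inner_axis)

lemma gradient_add:
  "smooth f \<Longrightarrow> smooth g \<Longrightarrow> gradient (\<lambda>x. f x + g x) x = gradient f x + gradient g x"
  by (rule gradient_eqI) (auto simp: inner_add_left intro!: has_derivative_add gradient_works smooth_differentiable)

lemma gradient_mult:
  "smooth f \<Longrightarrow> smooth g \<Longrightarrow> gradient (\<lambda>x. f x * g x) x = f x *\<^sub>R gradient g x + g x *\<^sub>R gradient f x"
  by (rule gradient_eqI)
    (auto simp: inner_add_left mult.commute intro!: derivative_eq_intros gradient_works smooth_differentiable)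

lemma gradient_compose:
  assumes "(f has_real_derivative d) (at (g x))" "smooth g"
  shows "gradient (\<lambda>x. f (g x)) x = d *\<^sub>R gradient g x"
  using has_derivative_compose[OF gradient_works[OF smooth_differentiable[OF assms(2)]]
        assms(1)[unfolded has_field_derivative_def]]
  by (intro gradient_eqI) simp

lemma gradient_scale: "smooth f \<Longrightarrow> gradient (\<lambda>x. c * f x) x = c *\<^sub>R gradient f x"
  by (rule gradient_compose) (auto intro!: derivative_eq_intros)

lemma smooth_gradient: "smooth f \<Longrightarrow> smooth (\<lambda>x. gradient f x $ j)"
  by (simp add: gradient_def smooth_frechet_derivative)

lemma continuous_on_gradient: "smooth f \<Longrightarrow> continuous_on S (gradient f)"
  using continuous_on_vec_lambda[of S "\<lambda>j x. gradient f x $ j"]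
  by (simp add: smooth_continuous smooth_gradient)

section \<open>Test functions\<close>

lemma test_functionsD:
  assumes "f \<in> test_functions \<Omega>"
  shows "smooth f" "compact (closure {x. f x \<noteq> 0})" "closure {x. f x \<noteq> 0} \<subseteq> \<Omega>"
  using assms by (auto simp: test_functions_def smooth_def)

lemma test_functionsI:
  assumes "smooth f" "compact K" "K \<subseteq> \<Omega>" "\<And>x. x \<notin> K \<Longrightarrow> f x = 0"
  shows "f \<in> test_functions \<Omega>"
proof -
  have "closure {x. f x \<noteq> 0} \<subseteq> K"
    using assms by (intro closure_minimal) (auto intro: compact_imp_closed)
  then show ?thesis
    using assms compact_Int_closed[of K "closure {x. f x \<noteq> 0}"]
    by (auto simp: test_functions_def smooth_def inf_absorb2)
qed

lemma test_functionsE: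
  assumes "f \<in> test_functions \<Omega>"
  obtains K where "compact K" "K \<subseteq> \<Omega>" "\<And>x. x \<notin> K \<Longrightarrow> f x = 0"
  using test_functionsD[OF assms] closure_subset[of "{x. f x \<noteq> 0}"] that by blast

lemma test_functions_add:
  assumes "f \<in> test_functions \<Omega>" "g \<in> test_functions \<Omega>"
  shows "(\<lambda>x. f x + g x) \<in> test_functions \<Omega>"
proof -
  obtain K where "compact K" "K \<subseteq> \<Omega>" "\<And>x. x \<notin> K \<Longrightarrow> f x = 0"
    using assms(1) by (rule test_functionsE) blast
  moreover obtain L where "compact L" "L \<subseteq> \<Omega>" "\<And>x. x \<notin> L \<Longrightarrow> g x = 0"
    using assms(2) by (rule test_functionsE) blast
  ultimately show ?thesis
    using assms[THEN test_functionsD(1)]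
    by (intro test_functionsI[where K="K \<union> L"] smooth_add) auto
qed

lemma test_functions_mult_smooth:
  assumes "smooth f" "g \<in> test_functions \<Omega>"
  shows "(\<lambda>x. f x * g x) \<in> test_functions \<Omega>"
proof -
  obtain L where "compact L" "L \<subseteq> \<Omega>" "\<And>x. x \<notin> L \<Longrightarrow> g x = 0"
    using assms(2) by (rule test_functionsE) blast
  then show ?thesis
    using assms(1) test_functionsD(1)[OF assms(2)]
    by (intro test_functionsI[where K="L"] smooth_mult) auto
qed

lemma test_functions_scale:
  "f \<in> test_functions \<Omega> \<Longrightarrow> (\<lambda>x. c * f x) \<in> test_functions \<Omega>"
  using test_functions_mult_smooth[of "\<lambda>x. c"] smooth_const by auto

lemma test_functions_compose:
  assumes "smooth_real f" "f 0 = 0" "g \<in> test_functions \<Omega>"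
  shows "(\<lambda>x. f (g x)) \<in> test_functions \<Omega>"
proof -
  obtain L where "compact L" "L \<subseteq> \<Omega>" "\<And>x. x \<notin> L \<Longrightarrow> g x = 0"
    using assms(3) by (rule test_functionsE) blast
  then show ?thesis
    using assms(2) smooth_compose[OF assms(1) test_functionsD(1)[OF assms(3)]]
    by (intro test_functionsI[where K="L"]) auto
qed

lemma test_functions_zero: "(\<lambda>x. 0) \<in> test_functions \<Omega>"
  by (rule test_functionsI[where K="{}"]) (auto intro: smooth_const)

lemma test_functions_mono: "\<omega> \<subseteq> \<Omega> \<Longrightarrow> f \<in> test_functions \<omega> \<Longrightarrow> f \<in> test_functions \<Omega>"
  by (auto simp: test_functions_def)

lemma gradient_eq_0:
  assumes "open S" "x \<in> S" "\<And>y. y \<in> S \<Longrightarrow> f y = 0"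
  shows "gradient f x = 0"
proof (rule gradient_eqI)
  have "((\<lambda>x. 0) has_derivative (\<lambda>h. 0 \<bullet> h)) (at x)" by simp
  then show "(f has_derivative (\<lambda>h. 0 \<bullet> h)) (at x)"
    by (rule has_derivative_transform_within_open[OF _ assms(1,2)]) (simp add: assms(3))
qed

lemma gradient_outside:
  assumes "compact K" "\<And>x. x \<notin> K \<Longrightarrow> f x = 0" "x \<notin> K"
  shows "gradient f x = 0"
  using assms by (intro gradient_eq_0[of "- K"]) (auto intro: compact_imp_closed simp: open_Compl)

lemma test_functions_gradient:
  assumes "f \<in> test_functions \<Omega>"
  shows "(\<lambda>x. gradient f x $ j) \<in> test_functions \<Omega>"
proof -
  obtain L where "compact L" "L \<subseteq> \<Omega>" "\<And>x. x \<notin> L \<Longrightarrow> f x = 0"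
    using assms by (rule test_functionsE) blast
  then show ?thesis
    using gradient_outside[of L f] test_functionsD(1)[OF assms]
    by (intro test_functionsI[where K="L"] smooth_gradient) auto
qed

lemma test_functions_bounded:
  assumes "f \<in> test_functions \<Omega>"
  obtains B where "\<And>x. \<bar>f x\<bar> \<le> B"
proof -
  obtain L where L: "compact L" "\<And>x. x \<notin> L \<Longrightarrow> f x = 0"
    using assms by (rule test_functionsE) blast
  have "compact (f ` L)"
    using L smooth_continuous test_functionsD(1)[OF assms] by (intro compact_continuous_image) auto
  then obtain B where "\<forall>y\<in>f ` L. norm y \<le> B"
    using compact_imp_bounded bounded_iff by metis
  then have "\<bar>f x\<bar> \<le> max B 0" for x
    using L(2)[of x] \<open>\<forall>y\<in>f ` L. norm y \<le> B\<close> by (cases "x \<in> L") (auto simp: le_max_iff_disj)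
  then show ?thesis by (rule that)
qed

text \<open>All derivatives of \<open>exp (- 1/t)\<close> have the form \<open>p (1/t) * exp (- 1/t)\<close> with \<open>p\<close> a polynomial.\<close>

definition exp_cutoff :: "real poly \<Rightarrow> real \<Rightarrow> real" where
  "exp_cutoff p t = (if t \<le> 0 then 0 else poly p (1 / t) * exp (- 1 / t))"

lemma poly_times_exp_minus_tendsto_0: "((\<lambda>y::real. poly p y * exp (- y)) \<longlongrightarrow> 0) at_top"
proof -
  have "((\<lambda>y::real. \<Sum>i\<le>degree p. coeff p i * (y ^ i / exp y)) \<longlongrightarrow> (\<Sum>i\<le>degree p. coeff p i * 0)) at_top"
    by (intro tendsto_intros tendsto_power_div_exp_0)
  then show ?thesis
    by (simp add: poly_altdef sum_distrib_right sum_divide_distrib exp_minus field_simps)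
qed

text \<open>In the variable y = 1/t one has d/dt = -y^2 d/dy, and d/dy sends p(y) exp(-y) to (p' -
  p)(y) exp(-y). This gives the new polynomial (p - p') y^2.\<close>

lemma exp_cutoff_derivative:
  "(exp_cutoff p has_real_derivative exp_cutoff ((p - pderiv p) * [:0, 0, 1:]) t) (at t)"
proof -
  consider "t < 0" | "t > 0" | "t = 0" by linarith
  then show ?thesis
  proof cases
    case 1
    have "((\<lambda>x. 0) has_real_derivative 0) (at t)" by simp
    then have "(exp_cutoff p has_real_derivative 0) (at t)"
      by (rule has_field_derivative_transform_within_open[where S="{..<0}"])
         (use 1 in \<open>auto simp: exp_cutoff_def\<close>)
    then show ?thesis using 1 by (simp add: exp_cutoff_def)
  next
    case 2
    have "((\<lambda>x. poly p (1 / x) * exp (- 1 / x)) has_real_derivative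
       poly p (1/t) * (exp (- 1 / t) * (1 / t^2)) + (poly (pderiv p) (1/t) * (- 1 / t^2)) * exp (- 1 / t)) (at t)"
      using 2 by (auto intro!: derivative_eq_intros DERIV_chain2[OF poly_DERIV] simp: power2_eq_square)
    then have "(exp_cutoff p has_real_derivative
       poly p (1/t) * (exp (- 1 / t) * (1 / t^2)) + (poly (pderiv p) (1/t) * (- 1 / t^2)) * exp (- 1 / t)) (at t)"
      by (rule has_field_derivative_transform_within_open[where S="{0<..}"])
         (use 2 in \<open>auto simp: exp_cutoff_def\<close>)
    then show ?thesis using 2 by (simp add: exp_cutoff_def algebra_simps power2_eq_square)
  next
    case 3
    \<comment> \<open>The division by \<open>h\<close> in the difference quotient at 0 is the extra
      factor y = 1/h, hence the polynomial \<open>p * [:0,1:]\<close>.\<close>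
    have "((\<lambda>y::real. poly (p * [:0,1:]) y * exp (- y)) \<longlongrightarrow> 0) at_top"
      by (rule poly_times_exp_minus_tendsto_0)
    then have "((\<lambda>h::real. poly (p * [:0,1:]) (inverse h) * exp (- inverse h)) \<longlongrightarrow> 0) (at_right 0)"
      by (rule filterlim_compose) (rule filterlim_inverse_at_top_right)
    moreover have "\<forall>\<^sub>F h in at_right 0. poly (p * [:0,1:]) (inverse h) * exp (- inverse h) = (exp_cutoff p (0 + h) - exp_cutoff p 0) / h"
      by (auto simp: eventually_at_filter exp_cutoff_def field_simps)
    ultimately have "((\<lambda>h. (exp_cutoff p (0 + h) - exp_cutoff p 0) / h) \<longlongrightarrow> 0) (at_right 0)"
      using tendsto_cong by force
    moreover have "((\<lambda>h. (exp_cutoff p (0 + h) - exp_cutoff p 0) / h) \<longlongrightarrow> 0) (at_left 0)"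
      by (rule tendsto_eventually) (auto simp: eventually_at_filter exp_cutoff_def)
    ultimately have "((\<lambda>h. (exp_cutoff p (0 + h) - exp_cutoff p 0) / h) \<longlongrightarrow> 0) (at 0)"
      by (simp add: filterlim_at_split)
    then show ?thesis using 3 by (simp add: DERIV_def exp_cutoff_def)
  qed
qed

lemma smooth_real_exp_cutoff: "smooth_real (exp_cutoff p)"
  unfolding smooth_real_def
  by (rule exI[where x="\<lambda>k. exp_cutoff (((\<lambda>p. (p - pderiv p) * [:0, 0, 1:]) ^^ k) p)"])
     (auto simp del: mult_pCons_right intro: exp_cutoff_derivative)

section \<open>Square-integrable functions\<close>

abbreviation sq_integral :: "(real^'n) set \<Rightarrow> (real^'n \<Rightarrow> 'b::euclidean_space) \<Rightarrow> real" where
  "sq_integral \<Omega> f \<equiv> (LINT x|lebesgue_on \<Omega>. (norm (f x))\<^sup>2)"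

lemma norm_add_power2_le:
  fixes a b :: "'a::real_inner"
  shows "(norm (a + b))\<^sup>2 \<le> 2 * (norm a)\<^sup>2 + 2 * (norm b)\<^sup>2"
proof -
  have "0 \<le> (norm (a - b))\<^sup>2" by simp
  then show ?thesis
    by (simp add: power2_norm_eq_inner inner_add_left inner_add_right inner_diff_left inner_diff_right inner_commute)
qed

lemma L2D:
  assumes "f \<in> L2 \<Omega>"
  shows L2_measurable: "f \<in> borel_measurable (lebesgue_on \<Omega>)"
    and L2_sq_integrable: "integrable (lebesgue_on \<Omega>) (\<lambda>x. (norm (f x))\<^sup>2)"
  using assms by (auto simp: L2_def)

lemma L2I_bound:
  fixes f :: "real^'n \<Rightarrow> 'b::euclidean_space" and g :: "real^'n \<Rightarrow> 'c::euclidean_space"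
  assumes "f \<in> borel_measurable (lebesgue_on \<Omega>)" "g \<in> L2 \<Omega>"
    and "AE x in lebesgue_on \<Omega>. norm (f x) \<le> norm (g x)"
  shows "f \<in> L2 \<Omega>"
  unfolding L2_def mem_Collect_eq
proof
  show "integrable (lebesgue_on \<Omega>) (\<lambda>x. (norm (f x))\<^sup>2)"
    by (rule Bochner_Integration.integrable_bound[OF L2_sq_integrable[OF assms(2)]])
       (use assms in \<open>auto intro: power_mono elim!: eventually_mono\<close>)
qed fact

lemma L2_add:
  assumes "f \<in> L2 \<Omega>" "g \<in> L2 \<Omega>"
  shows "(\<lambda>x. f x + g x) \<in> L2 \<Omega>"
  unfolding L2_def mem_Collect_eq
proof
  show m: "(\<lambda>x. f x + g x) \<in> borel_measurable (lebesgue_on \<Omega>)"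
    using assms[THEN L2_measurable] by measurable
  show "integrable (lebesgue_on \<Omega>) (\<lambda>x. (norm (f x + g x))\<^sup>2)"
  proof (rule Bochner_Integration.integrable_bound)
    show "integrable (lebesgue_on \<Omega>) (\<lambda>x. 2 * (norm (f x))\<^sup>2 + 2 * (norm (g x))\<^sup>2)"
      using assms[THEN L2_sq_integrable] by auto
  qed (use m in \<open>auto intro!: norm_add_power2_le\<close>)
qed

lemma L2_scaleR: "f \<in> L2 \<Omega> \<Longrightarrow> (\<lambda>x. c *\<^sub>R f x) \<in> L2 \<Omega>"
  by (auto simp: L2_def power_mult_distrib)

lemma L2_mult: "f \<in> L2 \<Omega> \<Longrightarrow> (\<lambda>x. c * f x) \<in> L2 \<Omega>" for c :: real
  using L2_scaleR[of f \<Omega> c] by simp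

lemma L2_diff: "f \<in> L2 \<Omega> \<Longrightarrow> g \<in> L2 \<Omega> \<Longrightarrow> (\<lambda>x. f x - g x) \<in> L2 \<Omega>"
  using L2_add[of f \<Omega> "\<lambda>x. (-1) *\<^sub>R g x"] L2_scaleR[of g \<Omega> "-1"] by simp

lemma L2_component: "g \<in> L2 \<Omega> \<Longrightarrow> (\<lambda>x. g x $ j) \<in> L2 \<Omega>"
proof (rule L2I_bound[where g=g])
  assume "g \<in> L2 \<Omega>"
  from L2_measurable[OF this] show "(\<lambda>x. g x $ j) \<in> borel_measurable (lebesgue_on \<Omega>)"
    by (rule measurable_compose) (intro borel_measurable_continuous_onI continuous_intros)
qed (auto simp: Finite_Cartesian_Product.norm_nth_le)

lemma L2_indicator_scaleR:
  assumes "g \<in> L2 \<Omega>" "Measurable.pred (lebesgue_on \<Omega>) P"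
  shows "(\<lambda>x. if P x then g x else 0) \<in> L2 \<Omega>"
  using assms L2_measurable[OF assms(1)] by (intro L2I_bound[OF _ assms(1)]) auto

lemma L2_inner_integrable:
  assumes "f \<in> L2 \<Omega>" "g \<in> L2 \<Omega>"
  shows "integrable (lebesgue_on \<Omega>) (\<lambda>x. f x \<bullet> g x)"
proof (rule Bochner_Integration.integrable_bound)
  show "integrable (lebesgue_on \<Omega>) (\<lambda>x. (norm (f x))\<^sup>2 + (norm (g x))\<^sup>2)"
    using assms[THEN L2_sq_integrable] by auto
  show "(\<lambda>x. f x \<bullet> g x) \<in> borel_measurable (lebesgue_on \<Omega>)"
    using assms[THEN L2_measurable] by measurable
  have "\<bar>f x \<bullet> g x\<bar> \<le> (norm (f x))\<^sup>2 + (norm (g x))\<^sup>2" for x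
  proof -
    have "\<bar>f x \<bullet> g x\<bar> \<le> norm (f x) * norm (g x)" by (rule Cauchy_Schwarz_ineq2)
    moreover have "2 * (norm (f x) * norm (g x)) \<le> (norm (f x))\<^sup>2 + (norm (g x))\<^sup>2"
      using sum_squares_bound[of "norm (f x)" "norm (g x)"] by simp
    moreover have "0 \<le> norm (f x) * norm (g x)" by simp
    ultimately show ?thesis by linarith
  qed
  then show "AE x in lebesgue_on \<Omega>. norm (f x \<bullet> g x) \<le> norm ((norm (f x))\<^sup>2 + (norm (g x))\<^sup>2)"
    by auto
qed

lemma L2_mult_integrable:
  fixes f g :: "real^'n \<Rightarrow> real"
  shows "f \<in> L2 \<Omega> \<Longrightarrow> g \<in> L2 \<Omega> \<Longrightarrow> integrable (lebesgue_on \<Omega>) (\<lambda>x. f x * g x)"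
  using L2_inner_integrable[of f \<Omega> g] by simp

lemma sq_integral_add_scaleR:
  assumes "f \<in> L2 \<Omega>" "g \<in> L2 \<Omega>"
  shows "sq_integral \<Omega> (\<lambda>x. f x + t *\<^sub>R g x) =
    sq_integral \<Omega> f + 2 * t * (LINT x|lebesgue_on \<Omega>. f x \<bullet> g x) + t\<^sup>2 * sq_integral \<Omega> g"
proof -
  have "(norm (f x + t *\<^sub>R g x))\<^sup>2 = (norm (f x))\<^sup>2 + (2 * t) * (f x \<bullet> g x) + t\<^sup>2 * (norm (g x))\<^sup>2" for x
    unfolding power2_norm_eq_inner
    by (simp add: inner_add_left inner_add_right inner_commute algebra_simps power2_eq_square)
  then show ?thesis
    using L2_inner_integrable[OF assms] assms[THEN L2_sq_integrable] by simp
qed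

text \<open>The square integral of f + t g is a nonnegative polynomial A + 2 t B + t^2 C in t. If C
  > 0, its minimum, at t = -B/C, gives the claim; if C = 0, it is affine, and B must vanish.\<close>

lemma L2_Cauchy_Schwarz:
  assumes "f \<in> L2 \<Omega>" "g \<in> L2 \<Omega>"
  shows "(LINT x|lebesgue_on \<Omega>. f x \<bullet> g x)\<^sup>2 \<le> sq_integral \<Omega> f * sq_integral \<Omega> g"
proof -
  define A B C where "A = sq_integral \<Omega> f" and "B = (LINT x|lebesgue_on \<Omega>. f x \<bullet> g x)" and "C = sq_integral \<Omega> g"
  have pos: "0 \<le> A + 2 * t * B + t\<^sup>2 * C" for t
    unfolding A_def B_def C_def sq_integral_add_scaleR[OF assms, symmetric] by simp
  have "0 \<le> C" by (simp add: C_def)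
  have "B\<^sup>2 \<le> A * C"
  proof (cases "C = 0")
    case True
    have "B = 0"
    proof (rule ccontr)
      assume "B \<noteq> 0"
      \<comment> \<open>At this point the affine function A + 2 t B has the value -1.\<close>
      with pos[of "- (A + 1) / (2 * B)"] True show False by (simp add: field_simps)
    qed
    then show ?thesis using True by simp
  next
    case False
    with \<open>0 \<le> C\<close> have "0 < C" by simp
    have "0 \<le> A - B\<^sup>2 / C"
      using pos[of "- B / C"] \<open>0 < C\<close> by (simp add: field_simps power2_eq_square)
    then show ?thesis using \<open>0 < C\<close> by (simp add: field_simps)
  qed
  then show ?thesis by (simp add: A_def B_def C_def)
qed

lemma sq_integral_add_le:
  assumes "f \<in> L2 \<Omega>" "g \<in> L2 \<Omega>"
  shows "sq_integral \<Omega> (\<lambda>x. f x + g x) \<le> 2 * sq_integral \<Omega> f + 2 * sq_integral \<Omega> g"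
proof -
  have "sq_integral \<Omega> (\<lambda>x. f x + g x) \<le> (LINT x|lebesgue_on \<Omega>. 2 * (norm (f x))\<^sup>2 + 2 * (norm (g x))\<^sup>2)"
    using L2_sq_integrable[OF L2_add[OF assms]] assms[THEN L2_sq_integrable]
    by (intro integral_mono norm_add_power2_le) auto
  then show ?thesis using assms[THEN L2_sq_integrable] by simp
qed

lemma sq_integral_mono:
  assumes "f \<in> L2 \<Omega>" "g \<in> L2 \<Omega>" "AE x in lebesgue_on \<Omega>. norm (f x) \<le> norm (g x)"
  shows "sq_integral \<Omega> f \<le> sq_integral \<Omega> g"
  using assms by (intro integral_mono_AE L2_sq_integrable) (auto intro: power_mono)

text \<open>Approximation is measured by squared norms throughout, so the triangle inequality costs
  a factor 4. This is where the tolerances \<open>e / 4\<close> below come from.\<close>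

lemma sq_integral_triangle:
  assumes "f \<in> L2 \<Omega>" "g \<in> L2 \<Omega>" "h \<in> L2 \<Omega>"
    "sq_integral \<Omega> (\<lambda>x. f x - g x) < e" "sq_integral \<Omega> (\<lambda>x. g x - h x) < e"
  shows "sq_integral \<Omega> (\<lambda>x. f x - h x) < 4 * e"
  using sq_integral_add_le[OF L2_diff[OF assms(1,2)] L2_diff[OF assms(2,3)]] assms(4,5) by simp

lemma sq_integral_cong_AE:
  assumes "f \<in> borel_measurable (lebesgue_on \<Omega>)" "g \<in> borel_measurable (lebesgue_on \<Omega>)"
    and "AE x in lebesgue_on \<Omega>. f x = g x"
  shows "sq_integral \<Omega> f = sq_integral \<Omega> g"
  using assms by (intro integral_cong_AE) auto

lemma sq_integral_eq_0_iff:
  assumes "f \<in> L2 \<Omega>"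
  shows "sq_integral \<Omega> f = 0 \<longleftrightarrow> (AE x in lebesgue_on \<Omega>. f x = 0)"
  using integral_nonneg_eq_0_iff_AE[OF L2_sq_integrable[OF assms]] by simp

lemma L2_dominated_convergence:
  fixes f :: "real^'n \<Rightarrow> 'b::euclidean_space" and w :: "real^'n \<Rightarrow> 'c::euclidean_space"
  assumes "f \<in> borel_measurable (lebesgue_on \<Omega>)" "\<And>n::nat. s n \<in> borel_measurable (lebesgue_on \<Omega>)"
    and lim: "AE x in lebesgue_on \<Omega>. (\<lambda>n. s n x) \<longlonglongrightarrow> f x"
    and bound: "\<And>n. AE x in lebesgue_on \<Omega>. norm (s n x) \<le> norm (w x)" and w: "w \<in> L2 \<Omega>"
  shows "f \<in> L2 \<Omega>" "(\<lambda>n. sq_integral \<Omega> (\<lambda>x. f x - s n x)) \<longlonglongrightarrow> 0"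
proof -
  have bd: "AE x in lebesgue_on \<Omega>. \<forall>n. norm (s n x) \<le> norm (w x)"
    using bound by (simp add: AE_all_countable)
  have fw: "AE x in lebesgue_on \<Omega>. norm (f x) \<le> norm (w x)"
    using bd lim
  proof eventually_elim
    case (elim x)
    show ?case by (rule LIMSEQ_le_const2[OF tendsto_norm[OF elim(2)]]) (use elim in auto)
  qed
  show "f \<in> L2 \<Omega>" by (rule L2I_bound[OF assms(1) w fw])
  have "(\<lambda>n. sq_integral \<Omega> (\<lambda>x. f x - s n x)) \<longlonglongrightarrow> (LINT x|lebesgue_on \<Omega>. 0)"
  proof (rule integral_dominated_convergence)
    \<comment> \<open>The limit inherits the bound by \<open>w\<close>, so the difference is at most
      2 |w| and its square at most 4 |w|^2.\<close>
    show "integrable (lebesgue_on \<Omega>) (\<lambda>x. 4 * (norm (w x))\<^sup>2)"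
      using L2_sq_integrable[OF w] by simp
    show "AE x in lebesgue_on \<Omega>. (\<lambda>n. (norm (f x - s n x))\<^sup>2) \<longlonglongrightarrow> 0"
      using lim
    proof eventually_elim
      case (elim x)
      have "(\<lambda>n. (norm (f x - s n x))\<^sup>2) \<longlonglongrightarrow> (norm (f x - f x))\<^sup>2"
        by (intro tendsto_intros elim)
      then show ?case by simp
    qed
    show "AE x in lebesgue_on \<Omega>. norm ((norm (f x - s n x))\<^sup>2) \<le> 4 * (norm (w x))\<^sup>2" for n
      using fw bd
    proof eventually_elim
      case (elim x)
      have "(norm (f x - s n x)) \<le> norm (f x) + norm (s n x)" by (rule norm_triangle_ineq4)
      also have "\<dots> \<le> 2 * norm (w x)" using elim by (smt (verit))
      finally have "(norm (f x - s n x))\<^sup>2 \<le> (2 * norm (w x))\<^sup>2" by (intro power_mono) auto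
      then show ?case by (simp add: power_mult_distrib)
    qed
  qed (use assms in auto)
  then show "(\<lambda>n. sq_integral \<Omega> (\<lambda>x. f x - s n x)) \<longlonglongrightarrow> 0" by simp
qed

section \<open>Integrability on bounded open sets\<close>

lemma measurable_lebesgue_onI:
  fixes f :: "real^'n \<Rightarrow> 'b::euclidean_space"
  assumes "f \<in> borel_measurable borel"
  shows "f \<in> borel_measurable (lebesgue_on \<Omega>)"
proof -
  from assms have "f \<in> borel_measurable lborel" by simp
  then show ?thesis by (rule measurable_restrict_space1[OF measurable_completion])
qed

lemma continuous_measurable_lebesgue_on:
  fixes f :: "real^'n \<Rightarrow> 'b::euclidean_space"
  shows "continuous_on UNIV f \<Longrightarrow> f \<in> borel_measurable (lebesgue_on \<Omega>)"
  by (intro measurable_lebesgue_onI borel_measurable_continuous_onI)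

lemma finite_measure_bounded_open:
  fixes \<Omega> :: "(real^'n) set"
  shows "open \<Omega> \<Longrightarrow> bounded \<Omega> \<Longrightarrow> finite_measure (lebesgue_on \<Omega>)"
  by (intro finite_measure_lebesgue_on lmeasurable_open) auto

lemma integrable_bounded:
  fixes f :: "real^'n \<Rightarrow> real"
  assumes "open \<Omega>" "bounded \<Omega>" "f \<in> borel_measurable (lebesgue_on \<Omega>)" "\<And>x. norm (f x) \<le> B"
  shows "integrable (lebesgue_on \<Omega>) f"
proof -
  interpret finite_measure "lebesgue_on \<Omega>" using assms by (intro finite_measure_bounded_open)
  show ?thesis using assms by (intro integrable_const_bound[where B=B]) auto
qed

lemma L2_bounded:
  fixes f :: "real^'n \<Rightarrow> 'b::euclidean_space"
  assumes "open \<Omega>" "bounded \<Omega>" "f \<in> borel_measurable (lebesgue_on \<Omega>)" "\<And>x. norm (f x) \<le> B"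
  shows "f \<in> L2 \<Omega>"
proof -
  have "integrable (lebesgue_on \<Omega>) (\<lambda>x. (norm (f x))\<^sup>2)"
    using assms by (intro integrable_bounded[where B="B\<^sup>2"]) (auto intro: power_mono)
  with assms show ?thesis by (auto simp: L2_def)
qed

lemma L2_integrable:
  fixes f :: "real^'n \<Rightarrow> real"
  assumes "open \<Omega>" "bounded \<Omega>" "f \<in> L2 \<Omega>"
  shows "integrable (lebesgue_on \<Omega>) f"
  using L2_mult_integrable[OF assms(3) L2_bounded[of \<Omega> "\<lambda>x. 1" 1]] assms by simp

lemma test_functions_L2:
  assumes "open \<Omega>" "bounded \<Omega>" "\<phi> \<in> test_functions \<Omega>'"
  shows "\<phi> \<in> L2 \<Omega>"
proof -
  obtain B where "\<And>x. \<bar>\<phi> x\<bar> \<le> B" using test_functions_bounded[OF assms(3)] by blast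
  then show ?thesis
    using assms test_functionsD(1)[OF assms(3)]
    by (intro L2_bounded[where B=B] continuous_measurable_lebesgue_on smooth_continuous) auto
qed

lemma test_functions_gradient_bounded:
  assumes "\<phi> \<in> test_functions \<Omega>"
  obtains B where "\<And>x. norm (gradient \<phi> x) \<le> B"
proof -
  have "\<exists>B. \<forall>x. \<bar>gradient \<phi> x $ j\<bar> \<le> B" for j
    using test_functions_bounded[OF test_functions_gradient[OF assms, of j]] by metis
  then obtain B where "\<And>j x. \<bar>gradient \<phi> x $ j\<bar> \<le> B j" by metis
  then have "norm (gradient \<phi> x) \<le> (\<Sum>j\<in>UNIV. B j)" for x
    using norm_le_l1_cart[of "gradient \<phi> x"] by (meson order_trans sum_mono)
  then show ?thesis by (rule that)
qed

lemma gradient_L2: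
  assumes "open \<Omega>" "bounded \<Omega>" "\<phi> \<in> test_functions \<Omega>'"
  shows "gradient \<phi> \<in> L2 \<Omega>"
proof -
  obtain B where "\<And>x. norm (gradient \<phi> x) \<le> B" using test_functions_gradient_bounded[OF assms(3)] by blast
  then show ?thesis
    using assms test_functionsD(1)[OF assms(3)]
    by (intro L2_bounded[where B=B] continuous_measurable_lebesgue_on continuous_on_gradient) auto
qed

text \<open>Moves the integral to the whole space, where translation invariance applies.\<close>

lemma test_functions_integral_UNIV:
  assumes "open \<Omega>" "\<phi> \<in> test_functions \<Omega>"
  shows "(LINT x|lebesgue_on \<Omega>. \<phi> x) = (LINT x|lborel. \<phi> x)"
proof -
  have "(LINT x|lebesgue_on \<Omega>. \<phi> x) = (LINT x|lebesgue. indicat_real \<Omega> x *\<^sub>R \<phi> x)"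
    using assms by (subst integral_restrict_space) auto
  also have "(\<lambda>x. indicat_real \<Omega> x *\<^sub>R \<phi> x) = \<phi>"
  proof
    fix x
    obtain K where "compact K" "K \<subseteq> \<Omega>" "\<And>x. x \<notin> K \<Longrightarrow> \<phi> x = 0"
      using assms(2) by (rule test_functionsE) blast
    then show "indicat_real \<Omega> x *\<^sub>R \<phi> x = \<phi> x"
      by (cases "x \<in> K") auto
  qed
  also have "(LINT x|lebesgue. \<phi> x) = (LINT x|lborel. \<phi> x)"
    using test_functionsD(1)[OF assms(2)] smooth_continuous[of \<phi> UNIV]
    by (intro integral_completion) (auto intro: borel_measurable_continuous_onI)
  finally show ?thesis .
qed

lemma lborel_integral_translation:
  fixes f :: "'a::euclidean_space \<Rightarrow> real"
  assumes "f \<in> borel_measurable borel"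
  shows "(LINT x|lborel. f (a + x)) = (LINT x|lborel. f x)"
proof -
  have "(LINT x|lborel. f x) = (LINT x|distr lborel borel ((+) a). f x)"
    by (simp add: lborel_distr_plus)
  also have "\<dots> = (LINT x|lborel. f (a + x))"
    using assms by (subst integral_distr) auto
  finally show ?thesis ..
qed

text \<open>The derivative is the limit of difference quotients, whose integrals vanish by translation
  invariance.\<close>

lemma integral_gradient_test_function:
  fixes \<Omega> :: "(real^'n) set"
  assumes "open \<Omega>" "\<phi> \<in> test_functions \<Omega>"
  shows "(LINT x|lebesgue_on \<Omega>. gradient \<phi> x $ j) = 0"
proof -
  define e :: "real^'n" where "e = axis j 1"
  have norm_e: "norm e = 1" by (simp add: e_def)
  have sm: "smooth \<phi>" using test_functionsD(1)[OF assms(2)] .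
  have cont: "continuous_on UNIV \<phi>" by (rule smooth_continuous[OF sm])
  have meas: "\<phi> \<in> borel_measurable borel" by (intro borel_measurable_continuous_onI cont)
  have der: "((\<lambda>t. \<phi> (x + t *\<^sub>R e)) has_real_derivative gradient \<phi> (x + t *\<^sub>R e) $ j) (at t)" for x t
  proof -
    have "((\<lambda>t. x + t *\<^sub>R e) has_derivative (\<lambda>h. h *\<^sub>R e)) (at t)"
      by (auto intro!: derivative_eq_intros)
    from has_derivative_compose[OF this gradient_works[OF smooth_differentiable[OF sm]]]
    show ?thesis by (simp add: has_field_derivative_def e_def inner_axis mult_commute_abs)
  qed
  obtain B where B: "\<And>x. \<bar>gradient \<phi> x $ j\<bar> \<le> B"
    using test_functions_bounded[OF test_functions_gradient[OF assms(2)]] by blast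
  obtain K where K: "compact K" "K \<subseteq> \<Omega>" "\<And>x. x \<notin> K \<Longrightarrow> \<phi> x = 0"
    using assms(2) by (rule test_functionsE) blast
  obtain R where R: "\<And>x. x \<in> K \<Longrightarrow> norm x \<le> R"
    using compact_imp_bounded[OF K(1)] by (auto simp: bounded_iff)
  have int: "integrable lborel \<phi>"
  proof -
    have "(\<lambda>x. indicat_real K x *\<^sub>R \<phi> x) = \<phi>"
      using K(3) by (force simp: indicator_def)
    then show ?thesis
      using borel_integrable_compact[OF K(1) continuous_on_subset[OF cont]] by simp
  qed
  define h where "h n = 1 / real (Suc n)" for n
  have h: "0 < h n" "h n \<le> 1" for n by (auto simp: h_def)
  have h0: "h \<longlonglongrightarrow> 0" unfolding h_def by (rule LIMSEQ_Suc[OF lim_1_over_n])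
  define q where "q n x = (\<phi> (x + h n *\<^sub>R e) - \<phi> x) / h n" for n x
  have q_int: "(LINT x|lborel. q n x) = 0" for n
  proof -
    have "integrable lborel (\<lambda>x. \<phi> (h n *\<^sub>R e + x))"
      using int meas integrable_distr_eq[of "(+) (h n *\<^sub>R e)" lborel borel \<phi>]
      by (simp add: lborel_distr_plus)
    then show ?thesis
      using int lborel_integral_translation[OF meas, of "h n *\<^sub>R e"]
      by (simp add: q_def add.commute)
  qed
  have "(\<lambda>n. LINT x|lborel. q n x) \<longlonglongrightarrow> (LINT x|lborel. gradient \<phi> x $ j)"
  proof (rule integral_dominated_convergence)
    show "(\<lambda>x. gradient \<phi> x $ j) \<in> borel_measurable lborel"
      using smooth_continuous[OF smooth_gradient[OF sm]] borel_measurable_continuous_onI by auto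
    have "(\<lambda>x. \<phi> (x + h n *\<^sub>R e)) \<in> borel_measurable borel" for n
      by (intro borel_measurable_continuous_onI continuous_on_compose2[OF cont] continuous_intros) auto
    then show "q n \<in> borel_measurable lborel" for n
      using meas unfolding q_def by auto
    \<comment> \<open>The mean value theorem bounds the quotients by \<open>B\<close>. Since
      \<open>h n\<close> is at most 1 and \<open>e\<close> is a unit vector, both points of a
      quotient miss \<open>K\<close> as soon as \<open>x\<close> has norm above
      \<open>R + 1\<close>.\<close>
    show "integrable lborel (\<lambda>x. indicat_real (cball 0 (R + 1)) x * B)"
      by (intro integrable_mult_left) (auto intro!: integrable_real_indicator emeasure_bounded_finite)
    show "AE x in lborel. (\<lambda>n. q n x) \<longlonglongrightarrow> gradient \<phi> x $ j"
    proof (rule AE_I2)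
      fix x
      have "((\<lambda>t. (\<phi> (x + t *\<^sub>R e) - \<phi> x) / t) \<longlongrightarrow> gradient \<phi> x $ j) (at 0)"
        using der[of x 0] by (simp add: DERIV_def)
      then show "(\<lambda>n. q n x) \<longlonglongrightarrow> gradient \<phi> x $ j"
        unfolding q_def
        by (rule filterlim_compose) (use h h0 in \<open>auto simp: filterlim_at less_imp_neq[THEN not_sym]\<close>)
    qed
    show "AE x in lborel. norm (q n x) \<le> indicat_real (cball 0 (R + 1)) x * B" for n
    proof (rule AE_I2)
      fix x
      show "norm (q n x) \<le> indicat_real (cball 0 (R + 1)) x * B"
      proof (cases "x \<in> cball 0 (R + 1)")
        case True
        obtain z where "\<phi> (x + h n *\<^sub>R e) - \<phi> (x + 0 *\<^sub>R e) = (h n - 0) * (gradient \<phi> (x + z *\<^sub>R e) $ j)"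
          using MVT2[OF h(1)[of n], of "\<lambda>t. \<phi> (x + t *\<^sub>R e)" "\<lambda>t. gradient \<phi> (x + t *\<^sub>R e) $ j"] der by blast
        then have "q n x = gradient \<phi> (x + z *\<^sub>R e) $ j"
          using h(1)[of n] by (simp add: q_def)
        then show ?thesis using B True by simp
      next
        case False
        then have "norm x > R + 1" by simp
        moreover have "norm x \<le> norm (x + h n *\<^sub>R e) + norm (h n *\<^sub>R e)"
          using norm_triangle_ineq4[of "x + h n *\<^sub>R e" "h n *\<^sub>R e"] by simp
        ultimately have "x + h n *\<^sub>R e \<notin> K" "x \<notin> K"
          using h[of n] norm_e R[of x] R[of "x + h n *\<^sub>R e"] by auto
        then show ?thesis using K(3) False by (simp add: q_def)
      qed
    qed
  qed
  then have "(LINT x|lborel. gradient \<phi> x $ j) = 0"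
    by (simp add: q_int LIMSEQ_const_iff)
  then show ?thesis
    using test_functions_integral_UNIV[OF assms(1) test_functions_gradient[OF assms(2)]] by simp
qed

section \<open>The closure of the gradient\<close>

lemma nonpos_if_le_mult_epsilon:
  fixes x c :: real
  assumes "\<And>e. e > 0 \<Longrightarrow> x \<le> e * c"
  shows "x \<le> 0"
proof (rule ccontr)
  assume "\<not> x \<le> 0"
  then have "x \<le> x / (2 * (\<bar>c\<bar> + 1)) * c" by (intro assms) auto
  also have "\<dots> \<le> x / (2 * (\<bar>c\<bar> + 1)) * (\<bar>c\<bar> + 1)"
    using \<open>\<not> x \<le> 0\<close> by (intro mult_left_mono) auto
  also have "\<dots> = x / 2" by (simp add: field_simps)
  finally show False using \<open>\<not> x \<le> 0\<close> by simp
qed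

lemma exp_cutoff_1:
  "0 \<le> exp_cutoff 1 t" "exp_cutoff 1 t \<le> 1" "exp_cutoff 1 t \<noteq> 0 \<longleftrightarrow> t > 0" "exp_cutoff 1 t > 0 \<longleftrightarrow> t > 0"
  "t > 0 \<Longrightarrow> exp_cutoff 1 t = exp (- 1 / t)"
  by (auto simp: exp_cutoff_def)

text \<open>Finitely many balls whose closures lie in \<open>U\<close> cover \<open>K\<close>; the
  sum of the radial bumps of these balls is positive on \<open>K\<close> and supported in the union
  of the closed balls.\<close>

lemma ex_positive_bump:
  fixes U K :: "(real^'n) set"
  assumes "compact K" "open U" "K \<subseteq> U"
  obtains b where "b \<in> test_functions U" "\<And>x. 0 \<le> b x" "\<And>x. x \<in> K \<Longrightarrow> 0 < b x"
proof -
  define bump :: "real^'n \<Rightarrow> real \<Rightarrow> real^'n \<Rightarrow> real"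
    \<comment> \<open>The squared distance is written out in coordinates so that the closure rules
      for \<open>smooth\<close> apply; \<open>bump_alt\<close> recovers the radial form.\<close>
    where "bump p r x = exp_cutoff 1 (r\<^sup>2 - (\<Sum>j\<in>UNIV. (x \<bullet> axis j 1 - p $ j) * (x \<bullet> axis j 1 - p $ j)))" for p r x
  have bump_smooth: "smooth (bump p r)" for p r
    unfolding bump_def
    by (rule smooth_compose[OF smooth_real_exp_cutoff])
       (intro smooth_diff smooth_const smooth_sum smooth_mult smooth_inner)
  have bump_alt: "bump p r x = exp_cutoff 1 (r\<^sup>2 - (dist p x)\<^sup>2)" for p r x
    unfolding bump_def inner_axis dist_norm norm_minus_commute[of p] power2_norm_eq_inner
    by (simp add: inner_vec_def)
  have bump_pos: "0 < bump p r x \<longleftrightarrow> x \<in> ball p r" if "r > 0" for p r x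
  proof -
    have "(dist p x)\<^sup>2 < r\<^sup>2 \<longleftrightarrow> dist p x < r"
      using that by (meson less_eq_real_def power2_less_imp_less power_strict_mono zero_le_dist zero_less_numeral)
    then show ?thesis by (simp add: bump_alt exp_cutoff_1)
  qed
  have bump_nonneg: "0 \<le> bump p r x" for p r x by (simp add: bump_alt exp_cutoff_1)
  have "\<exists>r>0. cball p r \<subseteq> U" if "p \<in> K" for p
    using assms that by (meson open_contains_cball subsetD)
  then obtain r where r: "\<And>p. p \<in> K \<Longrightarrow> r p > 0" "\<And>p. p \<in> K \<Longrightarrow> cball p (r p) \<subseteq> U" by metis
  obtain D where D: "D \<subseteq> K" "finite D" "K \<subseteq> (\<Union>p\<in>D. ball p (r p))"
    by (rule compactE_image[OF assms(1), of K "\<lambda>p. ball p (r p)"]) (use r(1) in force)+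
  show ?thesis
  proof
    show "(\<lambda>x. \<Sum>p\<in>D. bump p (r p) x) \<in> test_functions U"
    proof (rule test_functionsI[where K="\<Union>p\<in>D. cball p (r p)"])
      fix x assume x: "x \<notin> (\<Union>p\<in>D. cball p (r p))"
      show "(\<Sum>p\<in>D. bump p (r p) x) = 0"
      proof (rule sum.neutral, rule ballI)
        fix p assume "p \<in> D"
        then have "\<not> 0 < bump p (r p) x" using x D r(1) bump_pos[of "r p" p x] by force
        then show "bump p (r p) x = 0" using bump_nonneg[of p "r p" x] by simp
      qed
    next
      show "(\<Union>p\<in>D. cball p (r p)) \<subseteq> U" using D(1) r(2) by blast
    qed (use D(2) bump_smooth in \<open>auto intro!: smooth_sum\<close>)
    show "0 \<le> (\<Sum>p\<in>D. bump p (r p) x)" for x by (intro sum_nonneg bump_nonneg)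
    show "0 < (\<Sum>p\<in>D. bump p (r p) x)" if "x \<in> K" for x
    proof -
      obtain p where p: "p \<in> D" "x \<in> ball p (r p)" using D(3) \<open>x \<in> K\<close> by blast
      have "0 < bump p (r p) x" using bump_pos[of "r p" p x] p D r by auto
      then show ?thesis using p D by (intro sum_pos2[of D p] bump_nonneg) auto
    qed
  qed
qed

text \<open>Apply exp(-1/s) to a multiple of a positive bump. The result never reaches the value 1,
  so the bound on \<open>K\<close> is \<open>1 - e\<close>: with \<open>m\<close> the minimum of the
  bump \<open>b\<close> on \<open>K\<close>, the factor 1/(e m) gives exp(-e m/b) >= 1 - e m/b >= 1
  - e.\<close>

lemma ex_cutoff:
  fixes U K :: "(real^'n) set"
  assumes "compact K" "open U" "K \<subseteq> U" "e > 0"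
  obtains \<eta> where "\<eta> \<in> test_functions U" "\<And>x. 0 \<le> \<eta> x" "\<And>x. \<eta> x \<le> 1" "\<And>x. x \<in> K \<Longrightarrow> 1 - e \<le> \<eta> x"
proof -
  obtain b where b: "b \<in> test_functions U" "\<And>x. 0 \<le> b x" "\<And>x. x \<in> K \<Longrightarrow> 0 < b x"
    using ex_positive_bump[OF assms(1-3)] by blast
  obtain m where m: "m > 0" "\<And>x. x \<in> K \<Longrightarrow> m \<le> b x"
  proof (cases "K = {}")
    case False
    then obtain y where "y \<in> K" "\<And>x. x \<in> K \<Longrightarrow> b y \<le> b x"
      using continuous_attains_inf[OF assms(1) _ smooth_continuous[OF test_functionsD(1)[OF b(1)]]] by blast
    with b(3) that show ?thesis by blast
  qed (use that[of 1] in auto)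
  show ?thesis
  proof
    show "(\<lambda>x. exp_cutoff 1 (1 / (e * m) * b x)) \<in> test_functions U"
      by (intro test_functions_compose[OF smooth_real_exp_cutoff] test_functions_scale b)
         (simp add: exp_cutoff_def)
    show "1 - e \<le> exp_cutoff 1 (1 / (e * m) * b x)" if "x \<in> K" for x
    proof -
      have "1 - e \<le> 1 + (- (e * m) / b x)"
        using m(2)[OF that] m(1) assms(4) by (simp add: field_simps)
      also have "\<dots> \<le> exp (- (e * m) / b x)" by (rule exp_ge_add_one_self)
      finally show ?thesis
        using b(3)[OF that] m(1) assms(4) by (simp add: exp_cutoff_1)
    qed
  qed (auto simp: exp_cutoff_1)
qed

text \<open>The indicator of \<open>K\<close> is the pointwise limit of test functions between 0 and
  1, at least 1 - 1/(n+1) on \<open>K\<close> and supported in the neighbourhoods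
  \<open>U n\<close>, which shrink to \<open>K\<close>; dominated convergence with majorant |g| does
  the rest. The distance \<open>infdist\<close> to the empty set is 0 by convention, so
  \<open>K\<close> is taken nonempty.\<close>

lemma integral_compact_eq_0:
  fixes g :: "real^'n \<Rightarrow> real"
  assumes \<Omega>: "open \<Omega>" and g: "integrable (lebesgue_on \<Omega>) g"
    and zero: "\<And>\<phi>. \<phi> \<in> test_functions \<Omega> \<Longrightarrow> (LINT x|lebesgue_on \<Omega>. g x * \<phi> x) = 0"
    and K: "compact K" "K \<subseteq> \<Omega>" "K \<noteq> {}"
  shows "(LINT x|lebesgue_on \<Omega>. g x * indicat_real K x) = 0"
proof -
  define U where "U n = \<Omega> \<inter> {x. infdist x K < 1 / real (Suc n)}" for n
  have "open (U n)" for n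
    unfolding U_def using \<Omega> by (intro open_Int open_Collect_less continuous_intros) auto
  moreover have "K \<subseteq> U n" for n using K by (auto simp: U_def)
  ultimately have "\<exists>\<phi>. \<phi> \<in> test_functions (U n) \<and> (\<forall>x. 0 \<le> \<phi> x) \<and> (\<forall>x. \<phi> x \<le> 1) \<and> (\<forall>x\<in>K. 1 - 1 / real (Suc n) \<le> \<phi> x)" for n
    using ex_cutoff[OF K(1), of "U n" "1 / real (Suc n)"] by (metis of_nat_0_less_iff zero_less_Suc zero_less_divide_1_iff)
  then obtain \<phi> where \<phi>: "\<And>n. \<phi> n \<in> test_functions (U n)" "\<And>n x. 0 \<le> \<phi> n x" "\<And>n x. \<phi> n x \<le> 1"
      "\<And>n x. x \<in> K \<Longrightarrow> 1 - 1 / real (Suc n) \<le> \<phi> n x"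
    by metis
  have \<phi>\<Omega>: "\<phi> n \<in> test_functions \<Omega>" for n
    using \<phi>(1)[of n] by (rule test_functions_mono[rotated]) (auto simp: U_def)
  have lim: "(\<lambda>n. \<phi> n x) \<longlonglongrightarrow> indicat_real K x" for x
  proof (cases "x \<in> K")
    case True
    have "(\<lambda>n. 1 - 1 / real (Suc n)) \<longlonglongrightarrow> 1 - 0"
      by (intro tendsto_intros LIMSEQ_Suc[OF lim_1_over_n])
    then have "(\<lambda>n. \<phi> n x) \<longlonglongrightarrow> 1"
      by (intro tendsto_sandwich[of "\<lambda>n. 1 - 1 / real (Suc n)" "\<lambda>n. \<phi> n x" _ "\<lambda>n. 1"]) (use \<phi> True in auto)
    with True show ?thesis by simp
  next
    case False
    then have pos: "0 < infdist x K"
      using K infdist_pos_not_in_closed compact_imp_closed by metis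
    have "\<forall>\<^sub>F n in sequentially. 1 / real (Suc n) < infdist x K"
      using order_tendstoD(2)[OF LIMSEQ_Suc[OF lim_1_over_n] pos] .
    then have "\<forall>\<^sub>F n in sequentially. \<phi> n x = 0"
    proof eventually_elim
      case (elim n)
      then have "x \<notin> U n" by (simp add: U_def)
      then show ?case using test_functionsE[OF \<phi>(1)[of n]] by (metis subsetD)
    qed
    then show ?thesis using False by (simp add: tendsto_eventually)
  qed
  have "(\<lambda>n. LINT x|lebesgue_on \<Omega>. g x * \<phi> n x) \<longlonglongrightarrow> (LINT x|lebesgue_on \<Omega>. g x * indicat_real K x)"
  proof (rule integral_dominated_convergence[where w="\<lambda>x. \<bar>g x\<bar>"])
    show "(\<lambda>x. g x * indicat_real K x) \<in> borel_measurable (lebesgue_on \<Omega>)"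
      using K(1) by (intro borel_measurable_times[OF borel_measurable_integrable[OF g]]
        measurable_lebesgue_onI borel_measurable_indicator) (rule borel_compact)
    show "(\<lambda>x. g x * \<phi> n x) \<in> borel_measurable (lebesgue_on \<Omega>)" for n
      by (intro borel_measurable_times[OF borel_measurable_integrable[OF g]] continuous_measurable_lebesgue_on
          smooth_continuous test_functionsD(1)[OF \<phi>(1)])
    show "AE x in lebesgue_on \<Omega>. (\<lambda>n. g x * \<phi> n x) \<longlonglongrightarrow> g x * indicat_real K x"
      by (intro AE_I2 tendsto_intros lim)
    show "AE x in lebesgue_on \<Omega>. norm (g x * \<phi> n x) \<le> \<bar>g x\<bar>" for n
      using \<phi>(2,3)[of n] by (auto simp: abs_mult intro!: AE_I2 mult_left_le)
  qed (use g in auto)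
  moreover have "(LINT x|lebesgue_on \<Omega>. g x * \<phi> n x) = 0" for n
    by (rule zero[OF \<phi>\<Omega>])
  ultimately show ?thesis by (simp add: LIMSEQ_const_iff)
qed

text \<open>A compact subset of {g > 0} is a null set, because the positive function
  \<open>g\<close> has integral zero over it. By inner regularity {g > 0} is then null as well;
  boundedness of \<open>\<Omega>\<close> makes the closed inner approximations compact.\<close>

lemma AE_nonpos_if_integral_compact_eq_0:
  fixes g :: "real^'n \<Rightarrow> real"
  assumes \<Omega>: "open \<Omega>" "bounded \<Omega>" and g: "integrable (lebesgue_on \<Omega>) g"
    and zero: "\<And>K. compact K \<Longrightarrow> K \<subseteq> \<Omega> \<Longrightarrow> K \<noteq> {} \<Longrightarrow> (LINT x|lebesgue_on \<Omega>. g x * indicat_real K x) = 0"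
  shows "AE x in lebesgue_on \<Omega>. g x \<le> 0"
proof -
  have \<Omega>s: "\<Omega> \<in> sets lebesgue" using \<Omega> by auto
  define A where "A = {x \<in> \<Omega>. g x > 0}"
  have "{x \<in> space (lebesgue_on \<Omega>). g x > 0} \<in> sets (lebesgue_on \<Omega>)"
    using g by measurable
  then have A: "A \<in> sets lebesgue"
    using \<Omega>s by (simp add: A_def sets_restrict_space_iff)
  have null: "emeasure lebesgue T = 0" if "compact T" "T \<subseteq> A" for T
  proof (cases "T = {}")
    case False
    have T\<Omega>: "T \<subseteq> \<Omega>" using that by (auto simp: A_def)
    have Ts: "T \<in> sets lebesgue" using that(1) by (simp add: borel_compact)
    have int: "integrable (lebesgue_on \<Omega>) (\<lambda>x. g x * indicat_real T x)"
      using g Ts T\<Omega> \<Omega>s by (intro integrable_real_mult_indicator) (auto simp: sets_restrict_space_iff)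
    have "(LINT x|lebesgue_on \<Omega>. g x * indicat_real T x) = 0"
      using zero that(1) T\<Omega> False by blast
    moreover have "AE x in lebesgue_on \<Omega>. 0 \<le> g x * indicat_real T x"
      using that(2) by (intro AE_I2) (auto simp: A_def indicator_def)
    ultimately have "AE x in lebesgue_on \<Omega>. g x * indicat_real T x = 0"
      using integral_nonneg_eq_0_iff_AE[OF int] by blast
    then have "AE x in lebesgue_on \<Omega>. x \<notin> T"
      using that(2) by (elim eventually_mono) (auto simp: A_def indicator_def split: if_splits)
    then have "AE x in lebesgue. x \<in> \<Omega> \<longrightarrow> x \<notin> T"
      using \<Omega>s by (simp add: AE_restrict_space_iff)
    then have "AE x in lebesgue. x \<notin> T" using T\<Omega> by (auto elim: eventually_mono)
    then have "T \<in> null_sets lebesgue" using Ts AE_iff_null_sets by blast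
    then show ?thesis by auto
  qed simp
  have "emeasure lebesgue A \<le> ennreal e" if "e > 0" for e
  proof -
    obtain T where T: "closed T" "T \<subseteq> A" "A - T \<in> lmeasurable" "emeasure lebesgue (A - T) < ennreal e"
      using sets_lebesgue_inner_closed[OF A \<open>e > 0\<close>] .
    have "bounded T" using T(2) \<Omega>(2) by (rule_tac bounded_subset[of \<Omega>]) (auto simp: A_def)
    then have "emeasure lebesgue T = 0" using null T by (simp add: compact_eq_bounded_closed)
    moreover have "emeasure lebesgue A \<le> emeasure lebesgue T + emeasure lebesgue (A - T)"
      using emeasure_subadditive[of T lebesgue "A - T"] T A
      by (simp add: Un_absorb1 borel_closed fmeasurableD)
    ultimately show ?thesis using T(4) by (simp add: order.strict_implies_order order_le_less_trans)
  qed
  then have "emeasure lebesgue A \<le> 0"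
    by (metis ennreal_le_epsilon add.left_neutral)
  then have "A \<in> null_sets lebesgue" using A by (simp add: null_sets_def)
  then have "AE x in lebesgue. x \<notin> A" by (rule AE_not_in)
  then have "AE x in lebesgue. x \<in> \<Omega> \<longrightarrow> g x \<le> 0"
    by (rule eventually_mono) (auto simp: A_def)
  then show ?thesis using \<Omega>s by (simp add: AE_restrict_space_iff)
qed

lemma fundamental_lemma:
  fixes g :: "real^'n \<Rightarrow> real"
  assumes \<Omega>: "open \<Omega>" "bounded \<Omega>" and g: "integrable (lebesgue_on \<Omega>) g"
    and zero: "\<And>\<phi>. \<phi> \<in> test_functions \<Omega> \<Longrightarrow> (LINT x|lebesgue_on \<Omega>. g x * \<phi> x) = 0"
  shows "AE x in lebesgue_on \<Omega>. g x = 0"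
proof -
  have "AE x in lebesgue_on \<Omega>. g x \<le> 0"
    by (rule AE_nonpos_if_integral_compact_eq_0[OF \<Omega> g integral_compact_eq_0[OF \<Omega>(1) g zero]])
  moreover have "AE x in lebesgue_on \<Omega>. - g x \<le> 0"
    using integral_compact_eq_0[OF \<Omega>(1) g zero]
    by (intro AE_nonpos_if_integral_compact_eq_0[OF \<Omega>]) (use g in auto)
  ultimately show ?thesis by eventually_elim auto
qed

lemma integration_by_parts_test_functions:
  fixes \<Omega> :: "(real^'n) set"
  assumes \<Omega>: "open \<Omega>" "bounded \<Omega>" and "\<psi> \<in> test_functions \<Omega>" "\<phi> \<in> test_functions \<Omega>"
  shows "(LINT x|lebesgue_on \<Omega>. \<psi> x * gradient \<phi> x $ j) + (LINT x|lebesgue_on \<Omega>. gradient \<psi> x $ j * \<phi> x) = 0"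
proof -
  have sm: "smooth \<psi>" "smooth \<phi>" using assms(3,4)[THEN test_functionsD(1)] by auto
  have "0 = (LINT x|lebesgue_on \<Omega>. gradient (\<lambda>x. \<psi> x * \<phi> x) x $ j)"
    by (rule integral_gradient_test_function[symmetric, OF \<Omega>(1) test_functions_mult_smooth[OF sm(1) assms(4)]])
  also have "\<dots> = (LINT x|lebesgue_on \<Omega>. \<psi> x * gradient \<phi> x $ j + gradient \<psi> x $ j * \<phi> x)"
    unfolding gradient_mult[OF sm] by (simp add: mult.commute)
  also have "\<dots> = (LINT x|lebesgue_on \<Omega>. \<psi> x * gradient \<phi> x $ j) + (LINT x|lebesgue_on \<Omega>. gradient \<psi> x $ j * \<phi> x)"
    using assms(3,4)
    by (intro Bochner_Integration.integral_add L2_mult_integrable test_functions_L2[OF \<Omega>] L2_component gradient_L2[OF \<Omega>])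
  finally show ?thesis by simp
qed

text \<open>The closure in L2 x L2 of the graph of the gradient on test functions. Working with
  pairs allows computing with explicit gradients instead of the function selected by
  \<open>weak_gradient\<close>; \<open>H10_iff\<close> ties the relation to
  \<open>H10\<close>.\<close>

definition H10_gradient :: "(real^'n) set \<Rightarrow> (real^'n \<Rightarrow> real) \<Rightarrow> (real^'n \<Rightarrow> real^'n) \<Rightarrow> bool" where
  "H10_gradient \<Omega> u g \<longleftrightarrow> u \<in> L2 \<Omega> \<and> g \<in> L2 \<Omega> \<and>
     (\<forall>e>0. \<exists>\<phi>\<in>test_functions \<Omega>. sq_integral \<Omega> (\<lambda>x. u x - \<phi> x) < e \<and> sq_integral \<Omega> (\<lambda>x. g x - gradient \<phi> x) < e)"

lemma H10_gradientD:
  assumes "H10_gradient \<Omega> u g"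
  shows "u \<in> L2 \<Omega>" "g \<in> L2 \<Omega>"
  using assms by (auto simp: H10_gradient_def)

lemma H10_gradientE:
  assumes "H10_gradient \<Omega> u g" "e > 0"
  obtains \<phi> where "\<phi> \<in> test_functions \<Omega>" "sq_integral \<Omega> (\<lambda>x. u x - \<phi> x) < e"
    "sq_integral \<Omega> (\<lambda>x. g x - gradient \<phi> x) < e"
  using assms by (auto simp: H10_gradient_def)

lemma H10_gradient_closure:
  assumes \<Omega>: "open \<Omega>" "bounded \<Omega>" and "u \<in> L2 \<Omega>" "g \<in> L2 \<Omega>"
    and approx: "\<And>e. e > 0 \<Longrightarrow> \<exists>v k. H10_gradient \<Omega> v k \<and> sq_integral \<Omega> (\<lambda>x. u x - v x) < e \<and> sq_integral \<Omega> (\<lambda>x. g x - k x) < e"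
  shows "H10_gradient \<Omega> u g"
  unfolding H10_gradient_def
proof (intro conjI allI impI assms(3,4))
  fix e :: real assume "e > 0"
  then have e: "e / 4 > 0" by simp
  obtain v k where v: "H10_gradient \<Omega> v k" "sq_integral \<Omega> (\<lambda>x. u x - v x) < e / 4" "sq_integral \<Omega> (\<lambda>x. g x - k x) < e / 4"
    using approx[OF e] by blast
  obtain \<phi> where \<phi>: "\<phi> \<in> test_functions \<Omega>" "sq_integral \<Omega> (\<lambda>x. v x - \<phi> x) < e / 4"
    "sq_integral \<Omega> (\<lambda>x. k x - gradient \<phi> x) < e / 4"
    using H10_gradientE[OF v(1) e] by blast
  show "\<exists>\<phi>\<in>test_functions \<Omega>. sq_integral \<Omega> (\<lambda>x. u x - \<phi> x) < e \<and> sq_integral \<Omega> (\<lambda>x. g x - gradient \<phi> x) < e"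
    using sq_integral_triangle[OF assms(3) H10_gradientD(1)[OF v(1)] test_functions_L2[OF \<Omega> \<phi>(1)] v(2) \<phi>(2)]
      sq_integral_triangle[OF assms(4) H10_gradientD(2)[OF v(1)] gradient_L2[OF \<Omega> \<phi>(1)] v(3) \<phi>(3)] \<phi>(1)
    by auto
qed

lemma H10_gradient_limit:
  assumes \<Omega>: "open \<Omega>" "bounded \<Omega>" and "u \<in> L2 \<Omega>" "g \<in> L2 \<Omega>"
    and s: "\<And>n. H10_gradient \<Omega> (v n) (k n)"
    and lim: "(\<lambda>n. sq_integral \<Omega> (\<lambda>x. u x - v n x)) \<longlonglongrightarrow> 0" "(\<lambda>n. sq_integral \<Omega> (\<lambda>x. g x - k n x)) \<longlonglongrightarrow> 0"
  shows "H10_gradient \<Omega> u g"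
proof (rule H10_gradient_closure[OF assms(1-4)])
  fix e :: real assume "e > 0"
  have "\<forall>\<^sub>F n in sequentially. sq_integral \<Omega> (\<lambda>x. u x - v n x) < e \<and> sq_integral \<Omega> (\<lambda>x. g x - k n x) < e"
    using order_tendstoD(2)[OF lim(1) \<open>e > 0\<close>] order_tendstoD(2)[OF lim(2) \<open>e > 0\<close>] by (rule eventually_conj)
  from eventually_happens'[OF sequentially_bot this] obtain n where
    "sq_integral \<Omega> (\<lambda>x. u x - v n x) < e \<and> sq_integral \<Omega> (\<lambda>x. g x - k n x) < e" ..
  with s[of n] show "\<exists>v k. H10_gradient \<Omega> v k \<and> sq_integral \<Omega> (\<lambda>x. u x - v x) < e \<and> sq_integral \<Omega> (\<lambda>x. g x - k x) < e"
    by blast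
qed

lemma H10_gradient_test_function:
  assumes "open \<Omega>" "bounded \<Omega>" "\<phi> \<in> test_functions \<Omega>"
  shows "H10_gradient \<Omega> \<phi> (gradient \<phi>)"
  unfolding H10_gradient_def
  using assms by (auto intro!: test_functions_L2 gradient_L2 bexI[of _ \<phi>])

lemma H10_gradient_cong_AE:
  assumes "H10_gradient \<Omega> u g"
    and "u' \<in> borel_measurable (lebesgue_on \<Omega>)" "AE x in lebesgue_on \<Omega>. u' x = u x"
    and "g' \<in> borel_measurable (lebesgue_on \<Omega>)" "AE x in lebesgue_on \<Omega>. g' x = g x"
    and \<Omega>: "open \<Omega>" "bounded \<Omega>"
  shows "H10_gradient \<Omega> u' g'"
proof (rule H10_gradient_closure[OF \<Omega>])
  show u': "u' \<in> L2 \<Omega>" by (rule L2I_bound[OF assms(2) H10_gradientD(1)[OF assms(1)]]) (use assms(3) in auto)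
  show g': "g' \<in> L2 \<Omega>" by (rule L2I_bound[OF assms(4) H10_gradientD(2)[OF assms(1)]]) (use assms(5) in auto)
  have "sq_integral \<Omega> (\<lambda>x. u' x - u x) = 0" "sq_integral \<Omega> (\<lambda>x. g' x - g x) = 0"
    using assms(3,5) sq_integral_eq_0_iff[OF L2_diff[OF u' H10_gradientD(1)[OF assms(1)]]]
      sq_integral_eq_0_iff[OF L2_diff[OF g' H10_gradientD(2)[OF assms(1)]]] by simp_all
  then show "\<exists>v k. H10_gradient \<Omega> v k \<and> sq_integral \<Omega> (\<lambda>x. u' x - v x) < e \<and> sq_integral \<Omega> (\<lambda>x. g' x - k x) < e" if "e > 0" for e
    using assms(1) that by (intro exI[of _ u] exI[of _ g]) simp
qed

lemma H10_gradient_add: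
  assumes \<Omega>: "open \<Omega>" "bounded \<Omega>" and "H10_gradient \<Omega> u g" "H10_gradient \<Omega> v k"
  shows "H10_gradient \<Omega> (\<lambda>x. u x + v x) (\<lambda>x. g x + k x)"
  unfolding H10_gradient_def
proof (intro conjI allI impI L2_add H10_gradientD[OF assms(3)] H10_gradientD[OF assms(4)])
  fix e :: real assume "e > 0"
  then have e: "e / 4 > 0" by simp
  obtain \<phi> where \<phi>: "\<phi> \<in> test_functions \<Omega>" "sq_integral \<Omega> (\<lambda>x. u x - \<phi> x) < e / 4"
    "sq_integral \<Omega> (\<lambda>x. g x - gradient \<phi> x) < e / 4"
    using H10_gradientE[OF assms(3) e] by blast
  obtain \<psi> where \<psi>: "\<psi> \<in> test_functions \<Omega>" "sq_integral \<Omega> (\<lambda>x. v x - \<psi> x) < e / 4"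
    "sq_integral \<Omega> (\<lambda>x. k x - gradient \<psi> x) < e / 4"
    using H10_gradientE[OF assms(4) e] by blast
  have "sq_integral \<Omega> (\<lambda>x. (u x - \<phi> x) + (v x - \<psi> x)) < e"
    using sq_integral_add_le[OF L2_diff[OF H10_gradientD(1)[OF assms(3)] test_functions_L2[OF \<Omega> \<phi>(1)]]
        L2_diff[OF H10_gradientD(1)[OF assms(4)] test_functions_L2[OF \<Omega> \<psi>(1)]]] \<phi>(2) \<psi>(2) by simp
  moreover have "sq_integral \<Omega> (\<lambda>x. (g x - gradient \<phi> x) + (k x - gradient \<psi> x)) < e"
    using sq_integral_add_le[OF L2_diff[OF H10_gradientD(2)[OF assms(3)] gradient_L2[OF \<Omega> \<phi>(1)]]
        L2_diff[OF H10_gradientD(2)[OF assms(4)] gradient_L2[OF \<Omega> \<psi>(1)]]] \<phi>(3) \<psi>(3) by simp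
  ultimately show "\<exists>\<phi>\<in>test_functions \<Omega>. sq_integral \<Omega> (\<lambda>x. u x + v x - \<phi> x) < e \<and> sq_integral \<Omega> (\<lambda>x. g x + k x - gradient \<phi> x) < e"
    using \<phi>(1) \<psi>(1)
    by (intro bexI[of _ "\<lambda>x. \<phi> x + \<psi> x"] test_functions_add)
       (auto simp: gradient_add test_functionsD(1) algebra_simps)
qed

lemma H10_gradient_scale:
  assumes \<Omega>: "open \<Omega>" "bounded \<Omega>" and "H10_gradient \<Omega> u g"
  shows "H10_gradient \<Omega> (\<lambda>x. c * u x) (\<lambda>x. c *\<^sub>R g x)"
  unfolding H10_gradient_def
proof (intro conjI allI impI L2_mult L2_scaleR H10_gradientD[OF assms(3)])
  fix e :: real assume "e > 0"
  then have e: "e / (c\<^sup>2 + 1) > 0" by (simp add: add_nonneg_pos)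
  obtain \<phi> where \<phi>: "\<phi> \<in> test_functions \<Omega>" "sq_integral \<Omega> (\<lambda>x. u x - \<phi> x) < e / (c\<^sup>2 + 1)"
    "sq_integral \<Omega> (\<lambda>x. g x - gradient \<phi> x) < e / (c\<^sup>2 + 1)"
    using H10_gradientE[OF assms(3) e] by blast
  have le: "c\<^sup>2 * y < e" if "y < e / (c\<^sup>2 + 1)" "0 \<le> y" for y
  proof -
    have "c\<^sup>2 * y \<le> (c\<^sup>2 + 1) * y" using that(2) by (intro mult_right_mono) auto
    also have "\<dots> < e" using that(1) by (simp add: pos_less_divide_eq add_nonneg_pos mult.commute)
    finally show ?thesis .
  qed
  have "sq_integral \<Omega> (\<lambda>x. c *\<^sub>R (u x - \<phi> x)) < e"
    using le[OF \<phi>(2)] by (simp add: power_mult_distrib)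
  moreover have "sq_integral \<Omega> (\<lambda>x. c *\<^sub>R (g x - gradient \<phi> x)) < e"
    using le[OF \<phi>(3)] by (simp add: power_mult_distrib)
  ultimately show "\<exists>\<phi>\<in>test_functions \<Omega>. sq_integral \<Omega> (\<lambda>x. c * u x - \<phi> x) < e \<and> sq_integral \<Omega> (\<lambda>x. c *\<^sub>R g x - gradient \<phi> x) < e"
    using \<phi>(1)
    by (intro bexI[of _ "\<lambda>x. c * \<phi> x"] test_functions_scale)
       (auto simp: gradient_scale test_functionsD(1) algebra_simps)
qed

lemma H10_gradient_diff:
  assumes \<Omega>: "open \<Omega>" "bounded \<Omega>" and "H10_gradient \<Omega> u g" "H10_gradient \<Omega> v k"
  shows "H10_gradient \<Omega> (\<lambda>x. u x - v x) (\<lambda>x. g x - k x)"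
  using H10_gradient_add[OF assms(1-3) H10_gradient_scale[OF \<Omega> assms(4), of "-1"]] by simp

lemma H10_gradient_zero: "open \<Omega> \<Longrightarrow> bounded \<Omega> \<Longrightarrow> H10_gradient \<Omega> (\<lambda>x. 0) (\<lambda>x. 0)"
  using H10_gradient_test_function[OF _ _ test_functions_zero, of \<Omega>]
  by (simp add: gradient_def[abs_def] zero_vec_def)

lemma H10_gradient_sum:
  assumes "open \<Omega>" "bounded \<Omega>" "\<And>i. i \<in> I \<Longrightarrow> H10_gradient \<Omega> (u i) (g i)"
  shows "H10_gradient \<Omega> (\<lambda>x. \<Sum>i\<in>I. u i x) (\<lambda>x. \<Sum>i\<in>I. g i x)"
  using assms by (induction I rule: infinite_finite_induct) (auto intro: H10_gradient_add H10_gradient_zero)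

text \<open>For test functions the integration by parts formula is exact, and both of its sides are
  continuous in L2. Hence the defect \<open>X\<close> is controlled by the approximation error
  alone.\<close>

lemma H10_gradient_has_weak_gradient:
  assumes \<Omega>: "open \<Omega>" "bounded \<Omega>" and "H10_gradient \<Omega> u g"
  shows "has_weak_gradient \<Omega> u g"
  unfolding has_weak_gradient_def
proof (intro ballI allI)
  fix \<phi> j assume \<phi>: "\<phi> \<in> test_functions \<Omega>"
  let ?I = "\<lambda>f. LINT x|lebesgue_on \<Omega>. f x :: real"
  \<comment> \<open>Cauchy-Schwarz for the two error terms \<open>Y\<close> and \<open>Z\<close>,
    combined with (Y + Z)^2 <= 2 Y^2 + 2 Z^2, produces this constant.\<close>
  define C where "C = 2 * sq_integral \<Omega> (\<lambda>x. gradient \<phi> x $ j) + 2 * sq_integral \<Omega> \<phi>"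
  define X where "X = ?I (\<lambda>x. u x * gradient \<phi> x $ j) + ?I (\<lambda>x. g x $ j * \<phi> x)"
  note L2 = H10_gradientD[OF assms(3)] L2_component test_functions_L2[OF \<Omega>] gradient_L2[OF \<Omega>] L2_diff
  have "X\<^sup>2 \<le> e * C" if e: "e > 0" for e
  proof -
    obtain \<psi> where \<psi>: "\<psi> \<in> test_functions \<Omega>" "sq_integral \<Omega> (\<lambda>x. u x - \<psi> x) < e"
      "sq_integral \<Omega> (\<lambda>x. g x - gradient \<psi> x) < e"
      using H10_gradientE[OF assms(3) e] by blast
    define Y where "Y = ?I (\<lambda>x. (u x - \<psi> x) * gradient \<phi> x $ j)"
    define Z where "Z = ?I (\<lambda>x. (g x - gradient \<psi> x) $ j * \<phi> x)"
    have "X = Y + Z"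
      using integration_by_parts_test_functions[OF \<Omega> \<psi>(1) \<phi>, of j] \<phi> \<psi>(1)
      by (simp add: X_def Y_def Z_def left_diff_distrib L2_mult_integrable L2)
    moreover have "Y\<^sup>2 \<le> e * sq_integral \<Omega> (\<lambda>x. gradient \<phi> x $ j)"
    proof -
      have "Y\<^sup>2 \<le> sq_integral \<Omega> (\<lambda>x. u x - \<psi> x) * sq_integral \<Omega> (\<lambda>x. gradient \<phi> x $ j)"
        using L2_Cauchy_Schwarz[of "\<lambda>x. u x - \<psi> x" \<Omega> "\<lambda>x. gradient \<phi> x $ j"] \<phi> \<psi>(1) by (simp add: Y_def L2)
      also have "\<dots> \<le> e * sq_integral \<Omega> (\<lambda>x. gradient \<phi> x $ j)"
        using \<psi>(2) by (intro mult_right_mono) auto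
      finally show ?thesis .
    qed
    moreover have "Z\<^sup>2 \<le> e * sq_integral \<Omega> \<phi>"
    proof -
      have "Z\<^sup>2 \<le> sq_integral \<Omega> (\<lambda>x. (g x - gradient \<psi> x) $ j) * sq_integral \<Omega> \<phi>"
        using L2_Cauchy_Schwarz[of "\<lambda>x. (g x - gradient \<psi> x) $ j" \<Omega> \<phi>] \<phi> \<psi>(1) by (simp add: Z_def L2)
      also have "\<dots> \<le> e * sq_integral \<Omega> \<phi>"
      proof (intro mult_right_mono)
        have "sq_integral \<Omega> (\<lambda>x. (g x - gradient \<psi> x) $ j) \<le> sq_integral \<Omega> (\<lambda>x. g x - gradient \<psi> x)"
        proof (rule sq_integral_mono)
          show d: "(\<lambda>x. g x - gradient \<psi> x) \<in> L2 \<Omega>" using \<psi>(1) by (intro L2)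
          show "(\<lambda>x. (g x - gradient \<psi> x) $ j) \<in> L2 \<Omega>" by (rule L2_component[OF d])
        qed (simp only: Finite_Cartesian_Product.norm_nth_le, simp)
        then show "sq_integral \<Omega> (\<lambda>x. (g x - gradient \<psi> x) $ j) \<le> e" using \<psi>(3) by linarith
      qed auto
      finally show ?thesis .
    qed
    moreover have "(Y + Z)\<^sup>2 \<le> 2 * Y\<^sup>2 + 2 * Z\<^sup>2"
      using norm_add_power2_le[of Y Z] by simp
    ultimately show ?thesis by (simp add: C_def algebra_simps)
  qed
  then have "X\<^sup>2 \<le> 0" by (rule nonpos_if_le_mult_epsilon)
  then show "?I (\<lambda>x. u x * gradient \<phi> x $ j) = - ?I (\<lambda>x. g x $ j * \<phi> x)"
    by (simp add: X_def)
qed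

lemma has_weak_gradient_unique:
  assumes \<Omega>: "open \<Omega>" "bounded \<Omega>" and "g \<in> L2 \<Omega>" "k \<in> L2 \<Omega>"
    and "has_weak_gradient \<Omega> u g" "has_weak_gradient \<Omega> u k"
  shows "AE x in lebesgue_on \<Omega>. g x = k x"
proof -
  have "AE x in lebesgue_on \<Omega>. g x $ j - k x $ j = 0" for j
  proof (rule fundamental_lemma[OF \<Omega>])
    show "integrable (lebesgue_on \<Omega>) (\<lambda>x. g x $ j - k x $ j)"
      by (intro L2_integrable[OF \<Omega>] L2_diff L2_component assms)
    show "(LINT x|lebesgue_on \<Omega>. (g x $ j - k x $ j) * \<phi> x) = 0" if "\<phi> \<in> test_functions \<Omega>" for \<phi>
      using assms(5,6) that unfolding has_weak_gradient_def
      by (simp add: left_diff_distrib L2_mult_integrable L2_component assms(3,4) test_functions_L2[OF \<Omega>])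
  qed
  then have "AE x in lebesgue_on \<Omega>. \<forall>j. g x $ j - k x $ j = 0"
    by (simp add: AE_all_countable)
  then show ?thesis by (auto simp: vec_eq_iff elim: eventually_mono)
qed

lemma has_weak_gradient_diff:
  assumes \<Omega>: "open \<Omega>" "bounded \<Omega>" and "u \<in> L2 \<Omega>" "v \<in> L2 \<Omega>" "g \<in> L2 \<Omega>" "k \<in> L2 \<Omega>"
    and "has_weak_gradient \<Omega> u g" "has_weak_gradient \<Omega> v k"
  shows "has_weak_gradient \<Omega> (\<lambda>x. u x - v x) (\<lambda>x. g x - k x)"
  using assms(7,8) unfolding has_weak_gradient_def
  by (simp add: left_diff_distrib L2_mult_integrable L2_component assms(3-6) test_functions_L2[OF \<Omega>] gradient_L2[OF \<Omega>])

lemma weak_gradient_eqI: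
  assumes \<Omega>: "open \<Omega>" "bounded \<Omega>" and "g \<in> L2 \<Omega>" "has_weak_gradient \<Omega> u g"
  shows "weak_gradient \<Omega> u \<in> L2 \<Omega>" "has_weak_gradient \<Omega> u (weak_gradient \<Omega> u)"
    "AE x in lebesgue_on \<Omega>. weak_gradient \<Omega> u x = g x"
proof -
  have "weak_gradient \<Omega> u \<in> L2 \<Omega> \<and> has_weak_gradient \<Omega> u (weak_gradient \<Omega> u)"
    unfolding weak_gradient_def using assms(3,4) by (intro someI_ex[where P="\<lambda>g. g \<in> L2 \<Omega> \<and> has_weak_gradient \<Omega> u g"]) auto
  then show "weak_gradient \<Omega> u \<in> L2 \<Omega>" "has_weak_gradient \<Omega> u (weak_gradient \<Omega> u)"
    "AE x in lebesgue_on \<Omega>. weak_gradient \<Omega> u x = g x"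
    using has_weak_gradient_unique[OF \<Omega> _ assms(3) _ assms(4)] by auto
qed

lemma H10_gradient_weak_gradient:
  assumes \<Omega>: "open \<Omega>" "bounded \<Omega>" and "H10_gradient \<Omega> u g"
  shows "weak_gradient \<Omega> u \<in> L2 \<Omega>" "AE x in lebesgue_on \<Omega>. weak_gradient \<Omega> u x = g x"
    "dirichlet_energy \<Omega> u = sq_integral \<Omega> g"
proof -
  note w = weak_gradient_eqI[OF \<Omega> H10_gradientD(2)[OF assms(3)] H10_gradient_has_weak_gradient[OF assms]]
  from w show "weak_gradient \<Omega> u \<in> L2 \<Omega>" "AE x in lebesgue_on \<Omega>. weak_gradient \<Omega> u x = g x" by auto
  show "dirichlet_energy \<Omega> u = sq_integral \<Omega> g"
    unfolding dirichlet_energy_def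
    using w H10_gradientD(2)[OF assms(3)] by (intro sq_integral_cong_AE) (auto intro: L2_measurable)
qed

lemma H10_gradient_unique:
  assumes \<Omega>: "open \<Omega>" "bounded \<Omega>" and "H10_gradient \<Omega> u g" "H10_gradient \<Omega> v k"
    and "AE x in lebesgue_on \<Omega>. u x = v x"
  shows "AE x in lebesgue_on \<Omega>. g x = k x"
proof -
  have "H10_gradient \<Omega> u k"
    using assms(5) by (intro H10_gradient_cong_AE[OF assms(4) _ _ _ _ \<Omega>])
      (auto intro: L2_measurable H10_gradientD[OF assms(3)] H10_gradientD[OF assms(4)])
  then show ?thesis
    using assms by (intro has_weak_gradient_unique[OF \<Omega>, of _ _ u] H10_gradient_has_weak_gradient[OF \<Omega>])
      (auto intro: H10_gradientD)
qed

text \<open>The norm in \<open>H10\<close> involves the weak gradient selected for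
  \<open>u - \<phi>\<close>. By linearity and uniqueness this is almost everywhere the weak gradient
  of \<open>u\<close> minus \<open>gradient \<phi>\<close>, so convergence in that norm is
  convergence of both entries of the pair.\<close>

lemma H10_iff:
  assumes \<Omega>: "open \<Omega>" "bounded \<Omega>"
  shows "u \<in> H10 \<Omega> \<longleftrightarrow> (\<exists>g. H10_gradient \<Omega> u g)"
proof -
  have norm_eq: "H1_norm \<Omega> (\<lambda>x. u x - \<phi> x) = sqrt (sq_integral \<Omega> (\<lambda>x. u x - \<phi> x) + sq_integral \<Omega> (\<lambda>x. g x - gradient \<phi> x))"
    if \<phi>: "\<phi> \<in> test_functions \<Omega>" and g: "u \<in> L2 \<Omega>" "g \<in> L2 \<Omega>" "has_weak_gradient \<Omega> u g" for \<phi> g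
  proof -
    note p = H10_gradient_test_function[OF \<Omega> \<phi>]
    have d: "(\<lambda>x. g x - gradient \<phi> x) \<in> L2 \<Omega>" using g p by (intro L2_diff H10_gradientD(2)[OF p])
    have h: "has_weak_gradient \<Omega> (\<lambda>x. u x - \<phi> x) (\<lambda>x. g x - gradient \<phi> x)"
      using has_weak_gradient_diff[OF \<Omega> g(1) H10_gradientD(1)[OF p] g(2) H10_gradientD(2)[OF p] g(3)
        H10_gradient_has_weak_gradient[OF \<Omega> p]] .
    have "sq_integral \<Omega> (weak_gradient \<Omega> (\<lambda>x. u x - \<phi> x)) = sq_integral \<Omega> (\<lambda>x. g x - gradient \<phi> x)"
      using weak_gradient_eqI[OF \<Omega> d h] d by (intro sq_integral_cong_AE) (auto intro: L2_measurable)
    then show ?thesis by (simp add: H1_norm_def)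
  qed
  show ?thesis
  proof
    assume u: "u \<in> H10 \<Omega>"
    then obtain g where g: "u \<in> L2 \<Omega>" "g \<in> L2 \<Omega>" "has_weak_gradient \<Omega> u g"
      by (auto simp: H10_def H1_def)
    have "\<exists>\<phi>\<in>test_functions \<Omega>. sq_integral \<Omega> (\<lambda>x. u x - \<phi> x) < e \<and> sq_integral \<Omega> (\<lambda>x. g x - gradient \<phi> x) < e"
      if "e > 0" for e
    proof -
      obtain \<phi> where \<phi>: "\<phi> \<in> test_functions \<Omega>" "H1_norm \<Omega> (\<lambda>x. u x - \<phi> x) < sqrt e"
        using u \<open>e > 0\<close> unfolding H10_def by (auto dest!: spec[where x="sqrt e"])
      then have "sq_integral \<Omega> (\<lambda>x. u x - \<phi> x) + sq_integral \<Omega> (\<lambda>x. g x - gradient \<phi> x) < e"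
        using norm_eq[OF \<phi>(1) g] by simp
      moreover have "0 \<le> sq_integral \<Omega> (\<lambda>x. u x - \<phi> x)" "0 \<le> sq_integral \<Omega> (\<lambda>x. g x - gradient \<phi> x)" by auto
      ultimately have "sq_integral \<Omega> (\<lambda>x. u x - \<phi> x) < e \<and> sq_integral \<Omega> (\<lambda>x. g x - gradient \<phi> x) < e"
        by linarith
      with \<phi>(1) show ?thesis by blast
    qed
    with g show "\<exists>g. H10_gradient \<Omega> u g" by (auto simp: H10_gradient_def)
  next
    assume "\<exists>g. H10_gradient \<Omega> u g"
    then obtain g where u: "H10_gradient \<Omega> u g" by blast
    note g = H10_gradientD[OF u] H10_gradient_has_weak_gradient[OF \<Omega> u]
    have "\<exists>\<phi>\<in>test_functions \<Omega>. H1_norm \<Omega> (\<lambda>x. u x - \<phi> x) < e" if "e > 0" for e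
    proof -
      obtain \<phi> where \<phi>: "\<phi> \<in> test_functions \<Omega>" "sq_integral \<Omega> (\<lambda>x. u x - \<phi> x) < e\<^sup>2 / 2"
        "sq_integral \<Omega> (\<lambda>x. g x - gradient \<phi> x) < e\<^sup>2 / 2"
        using H10_gradientE[OF u, of "e\<^sup>2 / 2"] \<open>e > 0\<close> by auto
      then have "H1_norm \<Omega> (\<lambda>x. u x - \<phi> x) < sqrt (e\<^sup>2)"
        unfolding norm_eq[OF \<phi>(1) g] by (intro real_sqrt_less_mono) linarith
      then show ?thesis using \<phi>(1) \<open>e > 0\<close> by auto
    qed
    with g show "u \<in> H10 \<Omega>" by (auto simp: H10_def H1_def)
  qed
qed

section \<open>Truncation, restriction and extension\<close>

lemma exp_cutoff_1_derivative:
  "(exp_cutoff 1 has_real_derivative exp_cutoff [:0, 0, 1:] t) (at t)"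
  using exp_cutoff_derivative[of 1 t] by (simp add: pderiv_1)

text \<open>For t > 0 the function is (1 + y) exp(-y) with y = 1/t, and 1 + y <= exp y. It is the
  derivative of the truncation below, which is therefore nondecreasing and 1-Lipschitz whatever the
  scale.\<close>

lemma exp_cutoff_derivative_bounds:
  "0 \<le> exp_cutoff [:1, 1:] t" "exp_cutoff [:1, 1:] t \<le> 1"
proof -
  have "(1 + 1 / t) * exp (- (1 / t)) \<le> 1" if "t > 0"
  proof -
    have "(1 + 1 / t) * exp (- (1 / t)) \<le> exp (1 / t) * exp (- (1 / t))"
      by (intro mult_right_mono) (auto simp: exp_ge_add_one_self)
    then show ?thesis by (simp add: exp_minus)
  qed
  then show "exp_cutoff [:1, 1:] t \<le> 1" by (simp add: exp_cutoff_def)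
qed (simp add: exp_cutoff_def)

text \<open>\<open>t * exp_cutoff 1 (c * t)\<close> increases to the positive part of \<open>t\<close> as \<open>c\<close> tends to infinity.\<close>

lemma truncation_derivative:
  assumes "c > 0"
  shows "((\<lambda>t. t * exp_cutoff 1 (c * t)) has_real_derivative exp_cutoff [:1, 1:] (c * t)) (at t)"
proof -
  have "((\<lambda>t. exp_cutoff 1 (c * t)) has_real_derivative exp_cutoff [:0, 0, 1:] (c * t) * c) (at t)"
    by (rule DERIV_chain2[OF exp_cutoff_1_derivative]) (auto intro!: derivative_eq_intros)
  then have "((\<lambda>t. t * exp_cutoff 1 (c * t)) has_real_derivative
      1 * exp_cutoff 1 (c * t) + exp_cutoff [:0, 0, 1:] (c * t) * c * t) (at t)"
    by (intro DERIV_mult' [THEN DERIV_cong] DERIV_ident) (auto simp: algebra_simps)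
  \<comment> \<open>With y = 1/(c t) the second summand is y^2 exp(-y)/y = y exp(-y), so the sum is
    (1 + y) exp(-y).\<close>
  moreover have "1 * exp_cutoff 1 (c * t) + exp_cutoff [:0, 0, 1:] (c * t) * c * t = exp_cutoff [:1, 1:] (c * t)"
    using assms by (auto simp: exp_cutoff_def mult_le_0_iff field_simps)
  ultimately show ?thesis by simp
qed

lemma truncation_Lipschitz:
  assumes "c > 0"
  shows "\<bar>s * exp_cutoff 1 (c * s) - t * exp_cutoff 1 (c * t)\<bar> \<le> \<bar>s - t\<bar>"
proof -
  have "norm (s * exp_cutoff 1 (c * s) - t * exp_cutoff 1 (c * t)) \<le> 1 * norm (s - t)"
    by (rule field_differentiable_bound[where S=UNIV and f'="\<lambda>t. exp_cutoff [:1, 1:] (c * t)"])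
       (use truncation_derivative[OF assms] exp_cutoff_derivative_bounds in auto)
  then show ?thesis by simp
qed

lemma truncation_test_function:
  assumes "c > 0" "\<phi> \<in> test_functions \<Omega>"
  shows "(\<lambda>x. \<phi> x * exp_cutoff 1 (c * \<phi> x)) \<in> test_functions \<Omega>"
    and "gradient (\<lambda>x. \<phi> x * exp_cutoff 1 (c * \<phi> x)) x = exp_cutoff [:1, 1:] (c * \<phi> x) *\<^sub>R gradient \<phi> x"
proof -
  have sm: "smooth \<phi>" by (rule test_functionsD[OF assms(2)])
  have "smooth (\<lambda>x. exp_cutoff 1 (c * \<phi> x))"
    by (intro smooth_compose[OF smooth_real_exp_cutoff] smooth_mult smooth_const sm)
  from test_functions_mult_smooth[OF this assms(2)]
  show "(\<lambda>x. \<phi> x * exp_cutoff 1 (c * \<phi> x)) \<in> test_functions \<Omega>" by (simp add: mult.commute)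
  show "gradient (\<lambda>x. \<phi> x * exp_cutoff 1 (c * \<phi> x)) x = exp_cutoff [:1, 1:] (c * \<phi> x) *\<^sub>R gradient \<phi> x"
    by (rule gradient_compose[OF truncation_derivative[OF assms(1)] sm])
qed

lemma isCont_exp_cutoff: "isCont (exp_cutoff p) t"
  using exp_cutoff_derivative DERIV_isCont by blast

lemma measurable_exp_cutoff [measurable]: "exp_cutoff p \<in> borel_measurable borel"
  by (intro borel_measurable_continuous_onI continuous_at_imp_continuous_on) (simp add: isCont_exp_cutoff)

text \<open>The classical chain rule holds for the approximating test functions and survives the
  limit. The Lipschitz bound handles the functions. The error of the gradients is split into (D(u) -
  D(\<open>\<phi>\<close> n)) g and D(\<open>\<phi>\<close> n) (g -
  \<open>gradient (\<phi> n)\<close>): the second part is small because D is at most 1, the first by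
  dominated convergence.\<close>

lemma H10_gradient_truncation:
  assumes \<Omega>: "open \<Omega>" "bounded \<Omega>" and u: "H10_gradient \<Omega> u g" and c: "c > 0"
  shows "H10_gradient \<Omega> (\<lambda>x. u x * exp_cutoff 1 (c * u x)) (\<lambda>x. exp_cutoff [:1, 1:] (c * u x) *\<^sub>R g x)"
proof -
  note L2u = H10_gradientD(1)[OF u] and L2g = H10_gradientD(2)[OF u]
  note [measurable] = L2_measurable[OF L2u] L2_measurable[OF L2g]
  let ?F = "\<lambda>t. t * exp_cutoff 1 (c * t)" and ?D = "\<lambda>t. exp_cutoff [:1, 1:] (c * t)"
  have D: "0 \<le> ?D t" "?D t \<le> 1" for t using exp_cutoff_derivative_bounds by auto
  have "\<exists>\<phi>. \<phi> \<in> test_functions \<Omega> \<and> sq_integral \<Omega> (\<lambda>x. u x - \<phi> x) < 1 / real (Suc n) \<and>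
      sq_integral \<Omega> (\<lambda>x. g x - gradient \<phi> x) < 1 / real (Suc n)" for n
    by (rule H10_gradientE[OF u, of "1 / real (Suc n)"]) auto
  from choice[OF allI[OF this]] obtain \<phi> where
    "\<forall>n. \<phi> n \<in> test_functions \<Omega> \<and> sq_integral \<Omega> (\<lambda>x. u x - \<phi> n x) < 1 / real (Suc n) \<and>
      sq_integral \<Omega> (\<lambda>x. g x - gradient (\<phi> n) x) < 1 / real (Suc n)" ..
  then have \<phi>: "\<And>n. \<phi> n \<in> test_functions \<Omega>"
      "\<And>n. sq_integral \<Omega> (\<lambda>x. u x - \<phi> n x) < 1 / real (Suc n)"
      "\<And>n. sq_integral \<Omega> (\<lambda>x. g x - gradient (\<phi> n) x) < 1 / real (Suc n)" by blast+
  note L2\<phi> = test_functions_L2[OF \<Omega> \<phi>(1)] and L2d = gradient_L2[OF \<Omega> \<phi>(1)]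
  note [measurable] = L2_measurable[OF L2\<phi>] L2_measurable[OF L2d]
  have to0: "a \<longlonglongrightarrow> 0" if "\<And>n. 0 \<le> a n" "\<And>n. a n < 1 / real (Suc n)" for a
    using that by (intro tendsto_sandwich[OF _ _ tendsto_const LIMSEQ_Suc[OF lim_1_over_n]])
      (auto intro!: always_eventually less_imp_le)
  have lim_u: "(\<lambda>n. sq_integral \<Omega> (\<lambda>x. u x - \<phi> n x)) \<longlonglongrightarrow> 0"
    by (rule to0[OF _ \<phi>(2)]) simp
  have lim_g: "(\<lambda>n. sq_integral \<Omega> (\<lambda>x. g x - gradient (\<phi> n) x)) \<longlonglongrightarrow> 0"
    by (rule to0[OF _ \<phi>(3)]) simp
  \<comment> \<open>Convergence in L2 gives pointwise convergence only along a subsequence, and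
    pointwise convergence is what dominated convergence needs.\<close>
  obtain r where r: "strict_mono r" "AE x in lebesgue_on \<Omega>. (\<lambda>n. (norm (u x - \<phi> (r n) x))\<^sup>2) \<longlonglongrightarrow> 0"
    using tendsto_L1_AE_subseq[of "lebesgue_on \<Omega>" "\<lambda>n x. (norm (u x - \<phi> n x))\<^sup>2"] lim_u
      L2_sq_integrable[OF L2_diff[OF L2u L2\<phi>]] by auto
  have conv: "AE x in lebesgue_on \<Omega>. (\<lambda>n. \<phi> (r n) x) \<longlonglongrightarrow> u x"
    using r(2)
  proof eventually_elim
    case (elim x)
    then have "(\<lambda>n. u x - \<phi> (r n) x) \<longlonglongrightarrow> 0"
      using tendsto_real_sqrt[OF elim] by (simp add: tendsto_rabs_zero_iff)
    from tendsto_diff[OF tendsto_const[of "u x"] this] show ?case by simp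
  qed
  have L2G: "(\<lambda>x. ?D (u x) *\<^sub>R g x) \<in> L2 \<Omega>"
    by (rule L2I_bound[OF _ L2g]) (use D in \<open>auto simp: mult_left_le_one_le\<close>)
  have L2F: "(\<lambda>x. ?F (u x)) \<in> L2 \<Omega>"
    by (rule L2I_bound[OF _ L2u]) (use truncation_Lipschitz[OF c, of _ 0] in auto)
  show ?thesis
  proof (rule H10_gradient_limit[OF \<Omega> L2F L2G])
    show "H10_gradient \<Omega> (\<lambda>x. ?F (\<phi> (r n) x)) (\<lambda>x. ?D (\<phi> (r n) x) *\<^sub>R gradient (\<phi> (r n)) x)" for n
    proof -
      have "gradient (\<lambda>x. ?F (\<phi> (r n) x)) = (\<lambda>x. ?D (\<phi> (r n) x) *\<^sub>R gradient (\<phi> (r n)) x)"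
        by (rule ext) (rule truncation_test_function(2)[OF c \<phi>(1)])
      with H10_gradient_test_function[OF \<Omega> truncation_test_function(1)[OF c \<phi>(1)[of "r n"]]] show ?thesis
        by simp
    qed
    have L2F\<phi>: "(\<lambda>x. ?F (\<phi> n x)) \<in> L2 \<Omega>" for n
      by (rule L2I_bound[OF _ L2\<phi>[of n]]) (use truncation_Lipschitz[OF c, of _ 0] in auto)
    show "(\<lambda>n. sq_integral \<Omega> (\<lambda>x. ?F (u x) - ?F (\<phi> (r n) x))) \<longlonglongrightarrow> 0"
    proof (rule tendsto_sandwich[OF _ _ tendsto_const LIMSEQ_subseq_LIMSEQ[OF lim_u r(1)]])
      show "\<forall>\<^sub>F n in sequentially. sq_integral \<Omega> (\<lambda>x. ?F (u x) - ?F (\<phi> (r n) x)) \<le> ((\<lambda>n. sq_integral \<Omega> (\<lambda>x. u x - \<phi> n x)) \<circ> r) n"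
        unfolding o_def
        by (intro always_eventually allI sq_integral_mono L2_diff L2F L2F\<phi> L2u L2\<phi>)
           (use truncation_Lipschitz[OF c] in auto)
    qed auto
    have L2a: "(\<lambda>x. ?D (u x) *\<^sub>R g x - ?D (\<phi> n x) *\<^sub>R g x) \<in> L2 \<Omega>" for n
      by (intro L2_diff L2G L2I_bound[OF _ L2g]) (use D in \<open>auto simp: mult_left_le_one_le\<close>)
    have L2b: "(\<lambda>x. ?D (\<phi> n x) *\<^sub>R (g x - gradient (\<phi> n) x)) \<in> L2 \<Omega>" for n
      by (rule L2I_bound[OF _ L2_diff[OF L2g L2d[of n]]]) (use D in \<open>auto simp: mult_left_le_one_le\<close>)
    have bound: "sq_integral \<Omega> (\<lambda>x. ?D (u x) *\<^sub>R g x - ?D (\<phi> n x) *\<^sub>R gradient (\<phi> n) x)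
      \<le> 2 * sq_integral \<Omega> (\<lambda>x. ?D (u x) *\<^sub>R g x - ?D (\<phi> n x) *\<^sub>R g x) + 2 * sq_integral \<Omega> (\<lambda>x. g x - gradient (\<phi> n) x)" for n
    proof -
      have "sq_integral \<Omega> (\<lambda>x. ?D (u x) *\<^sub>R g x - ?D (\<phi> n x) *\<^sub>R gradient (\<phi> n) x) =
        sq_integral \<Omega> (\<lambda>x. (?D (u x) *\<^sub>R g x - ?D (\<phi> n x) *\<^sub>R g x) + ?D (\<phi> n x) *\<^sub>R (g x - gradient (\<phi> n) x))"
        by (simp add: scaleR_diff_right)
      also have "\<dots> \<le> 2 * sq_integral \<Omega> (\<lambda>x. ?D (u x) *\<^sub>R g x - ?D (\<phi> n x) *\<^sub>R g x) +
          2 * sq_integral \<Omega> (\<lambda>x. ?D (\<phi> n x) *\<^sub>R (g x - gradient (\<phi> n) x))"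
        by (rule sq_integral_add_le[OF L2a L2b])
      also have "sq_integral \<Omega> (\<lambda>x. ?D (\<phi> n x) *\<^sub>R (g x - gradient (\<phi> n) x)) \<le> sq_integral \<Omega> (\<lambda>x. g x - gradient (\<phi> n) x)"
        by (rule sq_integral_mono[OF L2b L2_diff[OF L2g L2d]]) (use D in \<open>auto simp: mult_left_le_one_le\<close>)
      finally show ?thesis by simp
    qed
    have "(\<lambda>n. sq_integral \<Omega> (\<lambda>x. ?D (u x) *\<^sub>R g x - ?D (\<phi> (r n) x) *\<^sub>R g x)) \<longlonglongrightarrow> 0"
    proof (rule L2_dominated_convergence(2)[OF _ _ _ _ L2g])
      show "AE x in lebesgue_on \<Omega>. (\<lambda>n. ?D (\<phi> (r n) x) *\<^sub>R g x) \<longlonglongrightarrow> ?D (u x) *\<^sub>R g x"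
        using conv by eventually_elim (intro tendsto_intros isCont_tendsto_compose[OF isCont_exp_cutoff])
      show "AE x in lebesgue_on \<Omega>. norm (?D (\<phi> (r n) x) *\<^sub>R g x) \<le> norm (g x)" for n
        using D by (auto simp: mult_left_le_one_le)
    qed measurable
    then have "(\<lambda>n. 2 * sq_integral \<Omega> (\<lambda>x. ?D (u x) *\<^sub>R g x - ?D (\<phi> (r n) x) *\<^sub>R g x) + 2 * ((\<lambda>n. sq_integral \<Omega> (\<lambda>x. g x - gradient (\<phi> n) x)) \<circ> r) n) \<longlonglongrightarrow> 2 * 0 + 2 * 0"
      by (intro tendsto_intros LIMSEQ_subseq_LIMSEQ[OF lim_g r(1)])
    then have lim: "(\<lambda>n. 2 * sq_integral \<Omega> (\<lambda>x. ?D (u x) *\<^sub>R g x - ?D (\<phi> (r n) x) *\<^sub>R g x) + 2 * sq_integral \<Omega> (\<lambda>x. g x - gradient (\<phi> (r n)) x)) \<longlonglongrightarrow> 0"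
      by (simp add: o_def)
    show "(\<lambda>n. sq_integral \<Omega> (\<lambda>x. ?D (u x) *\<^sub>R g x - ?D (\<phi> (r n) x) *\<^sub>R gradient (\<phi> (r n)) x)) \<longlonglongrightarrow> 0"
      by (rule tendsto_sandwich[OF _ _ tendsto_const lim]) (simp, intro always_eventually allI bound)
  qed
qed

text \<open>For t > 0 the argument of the polynomial tends to 0. Both for the truncations (p = 1)
  and for their derivatives (p = 1 + y) the limit is the indicator of t > 0; in particular it is 0
  at t = 0, which fixes the gradient on the zero set.\<close>

lemma exp_cutoff_scaled_tendsto:
  "(\<lambda>n. exp_cutoff p (real (Suc n) * t)) \<longlonglongrightarrow> (if t > 0 then coeff p 0 else 0)"
proof (cases "t > 0")
  case True
  have "(\<lambda>n. inverse (real (Suc n) * t)) \<longlonglongrightarrow> 0"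
    using tendsto_mult[OF LIMSEQ_Suc[OF lim_1_over_n] tendsto_const[of "inverse t"]] by (simp add: field_simps)
  then have "(\<lambda>n. poly p (inverse (real (Suc n) * t)) * exp (- inverse (real (Suc n) * t))) \<longlonglongrightarrow> poly p 0 * exp (- 0)"
    by (intro tendsto_intros)
  moreover have "exp_cutoff p (real (Suc n) * t) =
      poly p (inverse (real (Suc n) * t)) * exp (- inverse (real (Suc n) * t))" for n
    using True by (simp add: exp_cutoff_def inverse_eq_divide mult_le_0_iff del: of_nat_Suc)
  ultimately show ?thesis
    using True by (simp add: poly_0_coeff_0)
next
  case False
  then have "exp_cutoff p (real (Suc n) * t) = 0" for n
    by (auto simp: exp_cutoff_def mult_le_0_iff)
  with False show ?thesis by simp
qed

text \<open>Let the scale of the truncations tend to infinity; |u| and |g| are majorants for the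
  functions and their gradients.\<close>

lemma H10_gradient_positive_part:
  assumes \<Omega>: "open \<Omega>" "bounded \<Omega>" and u: "H10_gradient \<Omega> u g"
  shows "H10_gradient \<Omega> (\<lambda>x. max 0 (u x)) (\<lambda>x. if u x > 0 then g x else 0)"
proof -
  note L2u = H10_gradientD(1)[OF u] and L2g = H10_gradientD(2)[OF u]
  note [measurable] = L2_measurable[OF L2u] L2_measurable[OF L2g]
  let ?F = "\<lambda>n t. t * exp_cutoff 1 (real (Suc n) * t)" and ?D = "\<lambda>n t. exp_cutoff [:1, 1:] (real (Suc n) * t)"
  have D: "0 \<le> ?D n t" "?D n t \<le> 1" for n t using exp_cutoff_derivative_bounds by auto
  have "(\<lambda>n. ?F n t) \<longlonglongrightarrow> max 0 t" for t
    using tendsto_mult[OF tendsto_const[of t] exp_cutoff_scaled_tendsto[of 1 t]] by (auto simp: max_def split: if_splits)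
  then have Flim: "AE x in lebesgue_on \<Omega>. (\<lambda>n. ?F n (u x)) \<longlonglongrightarrow> max 0 (u x)"
    by (intro AE_I2)
  have Fbound: "AE x in lebesgue_on \<Omega>. norm (?F n (u x)) \<le> norm (u x)" for n
    using truncation_Lipschitz[of "real (Suc n)" _ 0] by (intro AE_I2) simp
  have Fm: "(\<lambda>x. max 0 (u x)) \<in> borel_measurable (lebesgue_on \<Omega>)"
    "\<And>n. (\<lambda>x. ?F n (u x)) \<in> borel_measurable (lebesgue_on \<Omega>)" by measurable
  have "(\<lambda>n. ?D n t *\<^sub>R y) \<longlonglongrightarrow> (if t > 0 then y else 0)" for t and y :: "real^'n"
    using tendsto_scaleR[OF exp_cutoff_scaled_tendsto[of "[:1, 1:]" t] tendsto_const[of y]] by (auto split: if_splits)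
  then have Glim: "AE x in lebesgue_on \<Omega>. (\<lambda>n. ?D n (u x) *\<^sub>R g x) \<longlonglongrightarrow> (if u x > 0 then g x else 0)"
    by (intro AE_I2)
  have Gbound: "AE x in lebesgue_on \<Omega>. norm (?D n (u x) *\<^sub>R g x) \<le> norm (g x)" for n
    using D[of n] by (intro AE_I2) (simp del: of_nat_Suc add: mult_left_le_one_le)
  have Gm: "(\<lambda>x. if u x > 0 then g x else 0) \<in> borel_measurable (lebesgue_on \<Omega>)"
    "\<And>n. (\<lambda>x. ?D n (u x) *\<^sub>R g x) \<in> borel_measurable (lebesgue_on \<Omega>)" by measurable
  show ?thesis
    using L2_dominated_convergence[OF Fm Flim Fbound L2u] L2_dominated_convergence[OF Gm Glim Gbound L2g]
    by (intro H10_gradient_limit[OF \<Omega> _ _ H10_gradient_truncation[OF \<Omega> u]]) (simp_all del: of_nat_Suc)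
qed

lemma H10_gradient_abs:
  assumes \<Omega>: "open \<Omega>" "bounded \<Omega>" and u: "H10_gradient \<Omega> u g"
  shows "H10_gradient \<Omega> (\<lambda>x. \<bar>u x\<bar>) (\<lambda>x. sgn (u x) *\<^sub>R g x)"
proof -
  have "H10_gradient \<Omega> (\<lambda>x. max 0 (u x) + max 0 (- 1 * u x))
      (\<lambda>x. (if u x > 0 then g x else 0) + (if - 1 * u x > 0 then (- 1) *\<^sub>R g x else 0))"
    by (intro H10_gradient_add[OF \<Omega>] H10_gradient_positive_part[OF \<Omega>] H10_gradient_scale[OF \<Omega>] u)
  moreover have "(\<lambda>x. max 0 (u x) + max 0 (- 1 * u x)) = (\<lambda>x. \<bar>u x\<bar>)" by (auto simp: fun_eq_iff)
  moreover have "(\<lambda>x. (if u x > 0 then g x else 0) + (if - 1 * u x > 0 then (- 1) *\<^sub>R g x else 0)) = (\<lambda>x. sgn (u x) *\<^sub>R g x)"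
    by (auto simp: fun_eq_iff sgn_if)
  ultimately show ?thesis by simp
qed

text \<open>The function is the difference of its positive and negative parts. The gradient computed
  from these parts is 0 wherever \<open>u\<close> is, and gradients are unique almost
  everywhere.\<close>

lemma H10_gradient_eq_0_on_zero_set:
  assumes \<Omega>: "open \<Omega>" "bounded \<Omega>" and u: "H10_gradient \<Omega> u g"
  shows "AE x in lebesgue_on \<Omega>. u x = 0 \<longrightarrow> g x = 0"
proof -
  have "H10_gradient \<Omega> (\<lambda>x. max 0 (u x) - max 0 (- 1 * u x))
      (\<lambda>x. (if u x > 0 then g x else 0) - (if - 1 * u x > 0 then (- 1) *\<^sub>R g x else 0))"
    by (intro H10_gradient_diff[OF \<Omega>] H10_gradient_positive_part[OF \<Omega>] H10_gradient_scale[OF \<Omega>] u)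
  from H10_gradient_unique[OF \<Omega> u this] have
    "AE x in lebesgue_on \<Omega>. g x = (if u x > 0 then g x else 0) - (if - 1 * u x > 0 then (- 1) *\<^sub>R g x else 0)"
    by (auto simp: max_def)
  then show ?thesis by (rule eventually_mono) auto
qed

section \<open>Restriction to and extension from open subsets\<close>

lemma L2_restrict_iff:
  assumes "open \<omega>" "open \<Omega>" "\<omega> \<subseteq> \<Omega>"
  shows "(\<lambda>x. if x \<in> \<omega> then f x else 0) \<in> L2 \<Omega> \<longleftrightarrow> f \<in> L2 \<omega>"
proof -
  have s: "\<omega> \<in> sets lebesgue" "\<Omega> \<in> sets lebesgue" using assms by auto
  have "integrable (lebesgue_on \<Omega>) (\<lambda>x. (norm (if x \<in> \<omega> then f x else 0))\<^sup>2) \<longleftrightarrow>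
     integrable lebesgue (\<lambda>x. if x \<in> \<Omega> then (norm (if x \<in> \<omega> then f x else 0))\<^sup>2 else 0)"
    by (rule Lebesgue_Measure.integrable_restrict_UNIV[OF s(2), symmetric])
  also have "(\<lambda>x. if x \<in> \<Omega> then (norm (if x \<in> \<omega> then f x else 0))\<^sup>2 else 0) = (\<lambda>x. if x \<in> \<omega> then (norm (f x))\<^sup>2 else 0)"
    using assms(3) by (auto simp: fun_eq_iff)
  also have "integrable lebesgue \<dots> \<longleftrightarrow> integrable (lebesgue_on \<omega>) (\<lambda>x. (norm (f x))\<^sup>2)"
    by (rule Lebesgue_Measure.integrable_restrict_UNIV[OF s(1)])
  finally show ?thesis
    using borel_measurable_if_lebesgue_on[OF s assms(3), of f] by (simp add: L2_def)
qed

lemma integral_subset: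
  fixes f :: "real^'n \<Rightarrow> 'b::euclidean_space"
  assumes "open \<omega>" "open \<Omega>" "\<omega> \<subseteq> \<Omega>"
  shows "(LINT x|lebesgue_on \<omega>. f x) = (LINT x|lebesgue_on \<Omega>. (if x \<in> \<omega> then f x else 0))"
  using assms by (intro integral_restrict[symmetric]) auto

lemma sq_integral_subset:
  assumes "open \<omega>" "open \<Omega>" "\<omega> \<subseteq> \<Omega>"
  shows "sq_integral \<omega> f = sq_integral \<Omega> (\<lambda>x. if x \<in> \<omega> then f x else 0)"
  unfolding integral_subset[OF assms]
  by (rule Bochner_Integration.integral_cong) auto

lemma L2_subset:
  assumes "open \<omega>" "open \<Omega>" "\<omega> \<subseteq> \<Omega>" "f \<in> L2 \<Omega>"
  shows "f \<in> L2 \<omega>" "sq_integral \<omega> f \<le> sq_integral \<Omega> f"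
proof -
  have "\<omega> \<in> sets lebesgue" "{x \<in> space (lebesgue_on \<Omega>). x \<in> \<omega>} = \<omega>"
    using assms(1,3) by auto
  then have "{x \<in> space (lebesgue_on \<Omega>). x \<in> \<omega>} \<in> sets (lebesgue_on \<Omega>)"
    using assms(2,3) by (simp add: sets_restrict_space_iff)
  then have L2: "(\<lambda>x. if x \<in> \<omega> then f x else 0) \<in> L2 \<Omega>"
    by (intro L2_indicator_scaleR[OF assms(4)]) (simp add: pred_def)
  then show "f \<in> L2 \<omega>" by (simp only: L2_restrict_iff[OF assms(1-3)])
  show "sq_integral \<omega> f \<le> sq_integral \<Omega> f"
    unfolding sq_integral_subset[OF assms(1-3)] by (rule sq_integral_mono[OF L2 assms(4)]) simp
qed

lemma AE_lebesgue_on_subset: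
  assumes "open \<omega>" "open \<Omega>" "\<omega> \<subseteq> \<Omega>" "AE x in lebesgue_on \<Omega>. P x"
  shows "AE x in lebesgue_on \<omega>. P x"
  using assms by (auto simp: AE_restrict_space_iff elim: eventually_mono)

lemma H10_gradient_extend:
  assumes \<omega>: "open \<omega>" and \<Omega>: "open \<Omega>" "bounded \<Omega>" and "\<omega> \<subseteq> \<Omega>" and v: "H10_gradient \<omega> v g"
  shows "H10_gradient \<Omega> (\<lambda>x. if x \<in> \<omega> then v x else 0) (\<lambda>x. if x \<in> \<omega> then g x else 0)"
  unfolding H10_gradient_def L2_restrict_iff[OF \<omega> \<Omega>(1) assms(4)]
proof (intro conjI allI impI H10_gradientD[OF v])
  fix e :: real assume "e > 0"
  then obtain \<phi> where \<phi>: "\<phi> \<in> test_functions \<omega>" "sq_integral \<omega> (\<lambda>x. v x - \<phi> x) < e"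
    "sq_integral \<omega> (\<lambda>x. g x - gradient \<phi> x) < e"
    using H10_gradientE[OF v] by blast
  obtain K where K: "compact K" "K \<subseteq> \<omega>" "\<And>x. x \<notin> K \<Longrightarrow> \<phi> x = 0"
    by (rule test_functionsE[OF \<phi>(1)]) blast
  have "\<phi> x = 0 \<and> gradient \<phi> x = 0" if "x \<notin> \<omega>" for x
  proof -
    have "x \<notin> K" using K(2) that by blast
    then show ?thesis using K(3) gradient_outside[OF K(1,3)] by simp
  qed
  then have eq: "(\<lambda>x. (if x \<in> \<omega> then v x else 0) - \<phi> x) = (\<lambda>x. if x \<in> \<omega> then v x - \<phi> x else 0)"
    "(\<lambda>x. (if x \<in> \<omega> then g x else 0) - gradient \<phi> x) = (\<lambda>x. if x \<in> \<omega> then g x - gradient \<phi> x else 0)"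
    by auto
  have "sq_integral \<Omega> (\<lambda>x. (if x \<in> \<omega> then v x else 0) - \<phi> x) < e"
    using \<phi>(2) unfolding sq_integral_subset[OF \<omega> \<Omega>(1) assms(4)] fun_cong[OF eq(1)] .
  moreover have "sq_integral \<Omega> (\<lambda>x. (if x \<in> \<omega> then g x else 0) - gradient \<phi> x) < e"
    using \<phi>(3) unfolding sq_integral_subset[OF \<omega> \<Omega>(1) assms(4)] fun_cong[OF eq(2)] .
  ultimately show "\<exists>\<phi>\<in>test_functions \<Omega>. sq_integral \<Omega> (\<lambda>x. (if x \<in> \<omega> then v x else 0) - \<phi> x) < e \<and>
     sq_integral \<Omega> (\<lambda>x. (if x \<in> \<omega> then g x else 0) - gradient \<phi> x) < e"
    using test_functions_mono[OF assms(4) \<phi>(1)] by blast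
qed

lemma sq_integral_scaleR_bounded_le:
  fixes f :: "real^'n \<Rightarrow> 'b::euclidean_space"
  assumes "f \<in> L2 \<Omega>" "h \<in> borel_measurable (lebesgue_on \<Omega>)" "\<And>x. norm (h x :: 'c::euclidean_space) \<le> B * norm (f x)"
  shows "h \<in> L2 \<Omega>" "sq_integral \<Omega> h \<le> B\<^sup>2 * sq_integral \<Omega> f"
proof -
  have "norm (h x) \<le> norm (B *\<^sub>R f x)" for x
    using order_trans[OF assms(3)[of x] mult_right_mono[OF abs_ge_self[of B] norm_ge_zero]] by simp
  then show h: "h \<in> L2 \<Omega>"
    by (intro L2I_bound[OF assms(2) L2_scaleR[OF assms(1), of B]]) auto
  have "sq_integral \<Omega> h \<le> sq_integral \<Omega> (\<lambda>x. B *\<^sub>R f x)"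
    by (rule sq_integral_mono[OF h L2_scaleR[OF assms(1)]]) (use \<open>\<And>x. norm (h x) \<le> norm (B *\<^sub>R f x)\<close> in auto)
  then show "sq_integral \<Omega> h \<le> B\<^sup>2 * sq_integral \<Omega> f" by (simp add: power_mult_distrib)
qed

lemma sq_integral_mult_bounded_le:
  fixes f :: "real^'n \<Rightarrow> 'b::euclidean_space" and a :: "real^'n \<Rightarrow> real"
  assumes "f \<in> L2 \<Omega>" "a \<in> borel_measurable (lebesgue_on \<Omega>)" "\<And>x. \<bar>a x\<bar> \<le> B"
  shows "(\<lambda>x. a x *\<^sub>R f x) \<in> L2 \<Omega>" "sq_integral \<Omega> (\<lambda>x. a x *\<^sub>R f x) \<le> B\<^sup>2 * sq_integral \<Omega> f"
proof -
  have "(\<lambda>x. a x *\<^sub>R f x) \<in> borel_measurable (lebesgue_on \<Omega>)"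
    using assms(2) L2_measurable[OF assms(1)] by measurable
  moreover have "norm (a x *\<^sub>R f x) \<le> B * norm (f x)" for x
    using assms(3) by (simp add: mult_right_mono)
  ultimately show "(\<lambda>x. a x *\<^sub>R f x) \<in> L2 \<Omega>" "sq_integral \<Omega> (\<lambda>x. a x *\<^sub>R f x) \<le> B\<^sup>2 * sq_integral \<Omega> f"
    by (rule sq_integral_scaleR_bounded_le[OF assms(1)])+
qed

text \<open>If test functions \<open>\<psi>\<close> on \<open>\<Omega>\<close> approximate
  \<open>z\<close>, the products \<open>\<eta> x * \<psi> x\<close> are supported in
  \<open>\<omega>\<close> and approximate the product, since \<open>\<eta>\<close> and its gradient
  are bounded.\<close>

lemma H10_gradient_mult_test_function:
  assumes \<omega>: "open \<omega>" and \<Omega>: "open \<Omega>" "bounded \<Omega>" and sub: "\<omega> \<subseteq> \<Omega>"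
    and z: "H10_gradient \<Omega> z g" and \<eta>: "\<eta> \<in> test_functions \<omega>"
  shows "H10_gradient \<omega> (\<lambda>x. \<eta> x * z x) (\<lambda>x. \<eta> x *\<^sub>R g x + z x *\<^sub>R gradient \<eta> x)"
proof -
  have b: "bounded \<omega>" using \<Omega>(2) sub by (rule bounded_subset)
  note sub' = L2_subset[OF \<omega> \<Omega>(1) sub]
  have L2: "z \<in> L2 \<omega>" "g \<in> L2 \<omega>" using sub'(1) H10_gradientD[OF z] by auto
  obtain B where B: "\<And>x. \<bar>\<eta> x\<bar> \<le> B" using test_functions_bounded[OF \<eta>] by blast
  obtain C where C: "\<And>x. norm (gradient \<eta> x) \<le> C" using test_functions_gradient_bounded[OF \<eta>] by blast
  have sm: "smooth \<eta>" by (rule test_functionsD[OF \<eta>])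
  have \<eta>m [measurable]: "\<eta> \<in> borel_measurable (lebesgue_on \<omega>)" "gradient \<eta> \<in> borel_measurable (lebesgue_on \<omega>)"
    using L2_measurable[OF test_functions_L2[OF \<omega> b \<eta>]] L2_measurable[OF gradient_L2[OF \<omega> b \<eta>]] .
  note \<eta>f = sq_integral_mult_bounded_le[OF _ \<eta>m(1) B]
  have f\<eta>: "(\<lambda>x. f x *\<^sub>R gradient \<eta> x) \<in> L2 \<omega>" "sq_integral \<omega> (\<lambda>x. f x *\<^sub>R gradient \<eta> x) \<le> C\<^sup>2 * sq_integral \<omega> f" if f: "f \<in> L2 \<omega>" for f
  proof -
    have m: "(\<lambda>x. f x *\<^sub>R gradient \<eta> x) \<in> borel_measurable (lebesgue_on \<omega>)"
      using L2_measurable[OF f] by measurable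
    have "norm (f x *\<^sub>R gradient \<eta> x) \<le> C * norm (f x)" for x
      using mult_left_mono[OF C[of x], of "\<bar>f x\<bar>"] by (simp add: mult.commute)
    then show "(\<lambda>x. f x *\<^sub>R gradient \<eta> x) \<in> L2 \<omega>" "sq_integral \<omega> (\<lambda>x. f x *\<^sub>R gradient \<eta> x) \<le> C\<^sup>2 * sq_integral \<omega> f"
      by (rule sq_integral_scaleR_bounded_le[OF f m])+
  qed
  show ?thesis
    unfolding H10_gradient_def
  proof (intro conjI allI impI)
    show "(\<lambda>x. \<eta> x * z x) \<in> L2 \<omega>" using \<eta>f(1)[OF L2(1)] by simp
    show "(\<lambda>x. \<eta> x *\<^sub>R g x + z x *\<^sub>R gradient \<eta> x) \<in> L2 \<omega>" by (intro L2_add \<eta>f(1) f\<eta>(1) L2)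
    fix e :: real assume e: "e > 0"
    \<comment> \<open>Large enough to turn the factors \<open>B\<^sup>2\<close> and
      \<open>2 * B\<^sup>2 + 2 * C\<^sup>2\<close> of the two error bounds into a strict estimate by
      \<open>e\<close>; the summand 1 also covers B = C = 0.\<close>
    define N where "N = 2 * B\<^sup>2 + 2 * C\<^sup>2 + 1"
    have N: "N > 0" "B\<^sup>2 < N" "2 * B\<^sup>2 + 2 * C\<^sup>2 < N"
      using zero_le_power2[of B] zero_le_power2[of C] unfolding N_def by linarith+
    obtain \<psi> where \<psi>: "\<psi> \<in> test_functions \<Omega>" "sq_integral \<Omega> (\<lambda>x. z x - \<psi> x) < e / N"
      "sq_integral \<Omega> (\<lambda>x. g x - gradient \<psi> x) < e / N"
      using H10_gradientE[OF z, of "e / N"] e N by auto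
    have L2d: "(\<lambda>x. z x - \<psi> x) \<in> L2 \<Omega>" "(\<lambda>x. g x - gradient \<psi> x) \<in> L2 \<Omega>"
      by (intro L2_diff H10_gradientD[OF z] test_functions_L2[OF \<Omega> \<psi>(1)] gradient_L2[OF \<Omega> \<psi>(1)])+
    have d: "sq_integral \<omega> (\<lambda>x. z x - \<psi> x) \<le> e / N" "sq_integral \<omega> (\<lambda>x. g x - gradient \<psi> x) \<le> e / N"
      using sub'(2)[OF L2d(1)] sub'(2)[OF L2d(2)] \<psi>(2,3) by linarith+
    have \<eta>\<psi>: "(\<lambda>x. \<eta> x * \<psi> x) \<in> test_functions \<omega>"
      using test_functions_mult_smooth[OF test_functionsD(1)[OF \<psi>(1)] \<eta>] by (simp add: mult.commute)
    have "sq_integral \<omega> (\<lambda>x. \<eta> x * z x - \<eta> x * \<psi> x) \<le> B\<^sup>2 * sq_integral \<omega> (\<lambda>x. z x - \<psi> x)"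
      using \<eta>f(2)[OF sub'(1)[OF L2d(1)]] by (simp add: right_diff_distrib)
    also have "\<dots> \<le> B\<^sup>2 * (e / N)" by (intro mult_left_mono d) simp
    also have "\<dots> < N * (e / N)" using N e by (intro mult_strict_right_mono) auto
    finally have 1: "sq_integral \<omega> (\<lambda>x. \<eta> x * z x - \<eta> x * \<psi> x) < e" using N by simp
    have "sq_integral \<omega> (\<lambda>x. (\<eta> x *\<^sub>R g x + z x *\<^sub>R gradient \<eta> x) - gradient (\<lambda>x. \<eta> x * \<psi> x) x)
      = sq_integral \<omega> (\<lambda>x. \<eta> x *\<^sub>R (g x - gradient \<psi> x) + (z x - \<psi> x) *\<^sub>R gradient \<eta> x)"
      unfolding gradient_mult[OF sm test_functionsD(1)[OF \<psi>(1)]] by (simp add: algebra_simps)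
    also have "\<dots> \<le> 2 * (B\<^sup>2 * sq_integral \<omega> (\<lambda>x. g x - gradient \<psi> x)) + 2 * (C\<^sup>2 * sq_integral \<omega> (\<lambda>x. z x - \<psi> x))"
      using sq_integral_add_le[OF \<eta>f(1)[OF sub'(1)[OF L2d(2)]] f\<eta>(1)[OF sub'(1)[OF L2d(1)]]]
        \<eta>f(2)[OF sub'(1)[OF L2d(2)]] f\<eta>(2)[OF sub'(1)[OF L2d(1)]] by linarith
    also have "\<dots> \<le> 2 * (B\<^sup>2 * (e / N)) + 2 * (C\<^sup>2 * (e / N))"
      by (intro add_mono mult_left_mono d) auto
    also have "\<dots> = (2 * B\<^sup>2 + 2 * C\<^sup>2) * (e / N)" by (simp add: algebra_simps)
    also have "\<dots> < N * (e / N)" using N e by (intro mult_strict_right_mono) auto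
    finally have 2: "sq_integral \<omega> (\<lambda>x. (\<eta> x *\<^sub>R g x + z x *\<^sub>R gradient \<eta> x) - gradient (\<lambda>x. \<eta> x * \<psi> x) x) < e"
      using N by simp
    show "\<exists>\<phi>\<in>test_functions \<omega>. sq_integral \<omega> (\<lambda>x. \<eta> x * z x - \<phi> x) < e \<and>
         sq_integral \<omega> (\<lambda>x. \<eta> x *\<^sub>R g x + z x *\<^sub>R gradient \<eta> x - gradient \<phi> x) < e"
      by (rule bexI[OF _ \<eta>\<psi>], rule conjI[OF 1 2])
  qed
qed

text \<open>Multiplying by the cutoffs \<open>exp_cutoff 1 (n * b)\<close>, whose gradients tend to \<open>0\<close> uniformly where
  the bump \<open>b\<close> is bounded away from \<open>0\<close>, moves the approximating test functions into \<open>\<omega>\<close>.\<close>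

lemma H10_gradient_compact_support:
  assumes \<omega>: "open \<omega>" and \<Omega>: "open \<Omega>" "bounded \<Omega>" and sub: "\<omega> \<subseteq> \<Omega>"
    and K: "compact K" "K \<subseteq> \<omega>"
    and z: "H10_gradient \<Omega> z g" and zK: "AE x in lebesgue_on \<Omega>. x \<notin> K \<longrightarrow> z x = 0"
  shows "H10_gradient \<omega> z g"
proof -
  have b\<omega>: "bounded \<omega>" using \<Omega>(2) sub by (rule bounded_subset)
  have L2: "z \<in> L2 \<omega>" "g \<in> L2 \<omega>" using L2_subset(1)[OF \<omega> \<Omega>(1) sub] H10_gradientD[OF z] by auto
  note [measurable] = L2[THEN L2_measurable]
  \<comment> \<open>Only the vanishing of \<open>z\<close> off \<open>K\<close> is assumed; that of
    its gradient follows because gradients vanish on zero sets.\<close>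
  have zero: "AE x in lebesgue_on \<omega>. x \<notin> K \<longrightarrow> z x = 0 \<and> g x = 0"
    by (rule AE_lebesgue_on_subset[OF \<omega> \<Omega>(1) sub])
       (use zK H10_gradient_eq_0_on_zero_set[OF \<Omega> z] in eventually_elim, auto)
  obtain b where b: "b \<in> test_functions \<omega>" "\<And>x. 0 \<le> b x" "\<And>x. x \<in> K \<Longrightarrow> 0 < b x"
    using ex_positive_bump[OF K(1) \<omega> K(2)] by blast
  obtain m where m: "m > 0" "\<And>x. x \<in> K \<Longrightarrow> m \<le> b x"
  proof (cases "K = {}")
    case False
    then obtain y where "y \<in> K" "\<And>x. x \<in> K \<Longrightarrow> b y \<le> b x"
      using continuous_attains_inf[OF K(1) _ smooth_continuous[OF test_functionsD(1)[OF b(1)]]] by blast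
    with b(3) that show ?thesis by blast
  qed (use that[of 1] in auto)
  obtain C where C: "\<And>x. norm (gradient b x) \<le> C" using test_functions_gradient_bounded[OF b(1)] by blast
  have C0: "0 \<le> C" using C[of 0] norm_ge_zero order_trans by blast
  have smb: "smooth b" by (rule test_functionsD[OF b(1)])
  define \<eta> where "\<eta> n x = exp_cutoff 1 (real (Suc n) * b x)" for n x
  have \<eta>: "\<eta> n \<in> test_functions \<omega>" for n
    unfolding \<eta>_def by (intro test_functions_compose[OF smooth_real_exp_cutoff] test_functions_scale b(1)) (simp add: exp_cutoff_def)
  have grad: "gradient (\<eta> n) x = (exp_cutoff [:0,0,1:] (real (Suc n) * b x) * real (Suc n)) *\<^sub>R gradient b x" for n x
    unfolding \<eta>_def
    by (rule_tac gradient_compose[of "\<lambda>t. exp_cutoff 1 (real (Suc n) * t)", OF DERIV_chain2[OF exp_cutoff_1_derivative] smb])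
      (auto intro!: derivative_eq_intros)
  \<comment> \<open>The derivative of the rescaled cutoff at y is N y^-2 exp(-1/(N y))/N^2: one
    power of 1/N survives the factor N of the inner derivative, so on \<open>K\<close>, where
    \<open>b\<close> is at least \<open>m\<close>, the gradients are of order 1/N.\<close>
  have scaled: "exp_cutoff [:0, 0, 1:] (N * y) * N = 1 / N * (exp (- 1 / (N * y)) / y\<^sup>2)" if "N > 0" "y > 0" for N y
    using that by (simp add: exp_cutoff_def mult_le_0_iff power2_eq_square field_simps)
  have grad_eq: "gradient (\<eta> n) x = (1 / real (Suc n) * (exp (- 1 / (real (Suc n) * b x)) / (b x)\<^sup>2)) *\<^sub>R gradient b x"
    if "x \<in> K" for n x
    unfolding grad using scaled[of "real (Suc n)" "b x"] b(3)[OF that] by (simp only: of_nat_0_less_iff zero_less_Suc)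
  have small: "exp (- 1 / (real (Suc n) * b x)) / (b x)\<^sup>2 \<le> 1 / m\<^sup>2" "0 \<le> exp (- 1 / (real (Suc n) * b x)) / (b x)\<^sup>2" if "x \<in> K" for n x
    using m(1) m(2)[OF that] b(3)[OF that] by (auto intro!: frac_le power_mono divide_nonneg_nonneg)
  have norm_grad: "norm (gradient (\<eta> n) x) \<le> 1 / real (Suc n) * (1 / m\<^sup>2 * C)" if "x \<in> K" for n x
  proof -
    have "norm (gradient (\<eta> n) x) = 1 / real (Suc n) * ((exp (- 1 / (real (Suc n) * b x)) / (b x)\<^sup>2) * norm (gradient b x))"
      using small(2)[OF that, of n] unfolding grad_eq[OF that] norm_scaleR abs_mult by simp
    also have "\<dots> \<le> 1 / real (Suc n) * (1 / m\<^sup>2 * C)"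
      using small[OF that, of n] C[of x] by (intro mult_left_mono mult_mono) auto
    finally show ?thesis .
  qed
  define D where "D = 1 / m\<^sup>2 * C"
  have D: "0 \<le> D" using C0 by (simp add: D_def)
  \<comment> \<open>A common majorant: on \<open>K\<close> the cutoffs are at most 1 and their
    gradients at most \<open>D\<close>, and off \<open>K\<close> everything vanishes.\<close>
  define w where "w x = norm (g x) + D * norm (z x)" for x
  have w: "w \<in> L2 \<omega>"
    unfolding w_def
    by (intro L2_add L2_mult L2I_bound[OF _ L2(1)] L2I_bound[OF _ L2(2)]) auto
  have [measurable]: "\<eta> n \<in> borel_measurable (lebesgue_on \<omega>)" "gradient (\<eta> n) \<in> borel_measurable (lebesgue_on \<omega>)" for n
    using L2_measurable[OF test_functions_L2[OF \<omega> b\<omega> \<eta>]] L2_measurable[OF gradient_L2[OF \<omega> b\<omega> \<eta>]] by auto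
  have \<eta>01: "0 \<le> \<eta> n x" "\<eta> n x \<le> 1" for n x by (auto simp: \<eta>_def exp_cutoff_1)
  have \<eta>lim: "(\<lambda>n. \<eta> n x) \<longlonglongrightarrow> 1" if "x \<in> K" for x
    using exp_cutoff_scaled_tendsto[of 1 "b x"] b(3)[OF that] by (simp add: \<eta>_def)
  have Z: "(\<lambda>n. sq_integral \<omega> (\<lambda>x. z x - \<eta> n x * z x)) \<longlonglongrightarrow> 0"
  proof (rule L2_dominated_convergence(2)[OF _ _ _ _ L2(1)])
    show "AE x in lebesgue_on \<omega>. (\<lambda>n. \<eta> n x * z x) \<longlonglongrightarrow> z x"
      using zero
    proof eventually_elim
      case (elim x)
      show ?case
      proof (cases "x \<in> K")
        case True
        show ?thesis using tendsto_mult[OF \<eta>lim[OF True] tendsto_const[of "z x"]] by simp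
      qed (use elim in simp)
    qed
    show "AE x in lebesgue_on \<omega>. norm (\<eta> n x * z x) \<le> norm (z x)" for n
      using \<eta>01[of n] by (auto simp: abs_mult mult_left_le_one_le)
  qed measurable
  have G: "(\<lambda>n. sq_integral \<omega> (\<lambda>x. g x - (\<eta> n x *\<^sub>R g x + z x *\<^sub>R gradient (\<eta> n) x))) \<longlonglongrightarrow> 0"
  proof (rule L2_dominated_convergence(2)[OF _ _ _ _ w])
    show "AE x in lebesgue_on \<omega>. (\<lambda>n. \<eta> n x *\<^sub>R g x + z x *\<^sub>R gradient (\<eta> n) x) \<longlonglongrightarrow> g x"
      using zero
    proof eventually_elim
      case (elim x)
      show ?case
      proof (cases "x \<in> K")
        case True
        have "(\<lambda>n. 1 / real (Suc n) * (1 / m\<^sup>2 * C)) \<longlonglongrightarrow> 0"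
          using tendsto_mult[OF LIMSEQ_Suc[OF lim_1_over_n] tendsto_const[of "1 / m\<^sup>2 * C"]] by simp
        then have "(\<lambda>n. gradient (\<eta> n) x) \<longlonglongrightarrow> 0"
          using norm_grad[OF True] by (rule_tac Lim_null_comparison[OF _ ]) auto
        from tendsto_add[OF tendsto_scaleR[OF \<eta>lim[OF True] tendsto_const[of "g x"]] tendsto_scaleR[OF tendsto_const[of "z x"] this]]
        show ?thesis by simp
      qed (use elim in simp)
    qed
    show "AE x in lebesgue_on \<omega>. norm (\<eta> n x *\<^sub>R g x + z x *\<^sub>R gradient (\<eta> n) x) \<le> norm (w x)" for n
      using zero
    proof eventually_elim
      case (elim x)
      show ?case
      proof (cases "x \<in> K")
        case True
        have "norm (gradient (\<eta> n) x) \<le> D"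
        proof -
          have "1 / real (Suc n) * (1 / m\<^sup>2 * C) \<le> 1 * (1 / m\<^sup>2 * C)"
            using C0 by (intro mult_right_mono) auto
          with norm_grad[OF True, of n] show ?thesis by (simp add: D_def)
        qed
        then have "norm (z x *\<^sub>R gradient (\<eta> n) x) \<le> D * norm (z x)"
          using mult_left_mono[of "norm (gradient (\<eta> n) x)" D "\<bar>z x\<bar>"] by (simp add: mult.commute)
        moreover have "norm (\<eta> n x *\<^sub>R g x) \<le> norm (g x)"
          using \<eta>01[of n x] by (simp add: mult_left_le_one_le)
        ultimately have "norm (\<eta> n x *\<^sub>R g x + z x *\<^sub>R gradient (\<eta> n) x) \<le> w x"
          unfolding w_def by (rule_tac norm_triangle_le) linarith
        also have "w x \<le> norm (w x)" by simp
        finally show ?thesis .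
      qed (use elim in simp)
    qed
  qed (use w[THEN L2_measurable] in measurable)
  show ?thesis
    by (rule H10_gradient_limit[OF \<omega> b\<omega> L2 H10_gradient_mult_test_function[OF \<omega> \<Omega> sub z \<eta>] Z G])
qed

section \<open>The variational problem\<close>

text \<open>Normalizing \<open>v\<close> to mass one makes it a competitor, so the energy is
  compared with the squared mass. The nonemptiness is recorded as well because the infimum of the
  empty set is an arbitrary real, which would block lower bounds on \<open>lambda21\<close>.\<close>

lemma lambda21_le:
  assumes \<omega>: "open \<omega>" "bounded \<omega>" and v: "H10_gradient \<omega> v g" and s: "(LINT x|lebesgue_on \<omega>. \<bar>v x\<bar>) > 0"
  shows "lambda21 \<omega> * (LINT x|lebesgue_on \<omega>. \<bar>v x\<bar>)\<^sup>2 \<le> sq_integral \<omega> g"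
    and "{dirichlet_energy \<omega> u |u. u \<in> H10 \<omega> \<and> L1_norm \<omega> u = 1} \<noteq> {}"
proof -
  define s where "s = (LINT x|lebesgue_on \<omega>. \<bar>v x\<bar>)"
  have s: "s > 0" using s by (simp add: s_def)
  have v': "H10_gradient \<omega> (\<lambda>x. 1 / s * v x) (\<lambda>x. (1 / s) *\<^sub>R g x)"
    by (rule H10_gradient_scale[OF \<omega> v])
  have L1: "L1_norm \<omega> (\<lambda>x. 1 / s * v x) = 1"
    using s by (simp add: L1_norm_def abs_mult s_def[symmetric])
  have E: "dirichlet_energy \<omega> (\<lambda>x. 1 / s * v x) = sq_integral \<omega> g / s\<^sup>2"
    unfolding H10_gradient_weak_gradient(3)[OF \<omega> v'] using s by (simp add: power_mult_distrib power_divide)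
  have mem: "sq_integral \<omega> g / s\<^sup>2 \<in> {dirichlet_energy \<omega> u |u. u \<in> H10 \<omega> \<and> L1_norm \<omega> u = 1}"
    using v' L1 E H10_iff[OF \<omega>] by (auto intro!: exI[of _ "\<lambda>x. 1 / s * v x"])
  then show "{dirichlet_energy \<omega> u |u. u \<in> H10 \<omega> \<and> L1_norm \<omega> u = 1} \<noteq> {}" by blast
  have "lambda21 \<omega> \<le> sq_integral \<omega> g / s\<^sup>2"
    unfolding lambda21_def
    by (rule cInf_lower[OF mem]) (auto intro!: bdd_belowI[of _ 0] simp: dirichlet_energy_def)
  then show "lambda21 \<omega> * (LINT x|lebesgue_on \<omega>. \<bar>v x\<bar>)\<^sup>2 \<le> sq_integral \<omega> g"
    using s by (simp add: s_def[symmetric] pos_le_divide_eq)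
qed

lemma le_lambda21:
  assumes \<omega>: "open \<omega>" "bounded \<omega>"
    and "{dirichlet_energy \<omega> u |u. u \<in> H10 \<omega> \<and> L1_norm \<omega> u = 1} \<noteq> {}"
    and "\<And>v g. H10_gradient \<omega> v g \<Longrightarrow> (LINT x|lebesgue_on \<omega>. \<bar>v x\<bar>) = 1 \<Longrightarrow> c \<le> sq_integral \<omega> g"
  shows "c \<le> lambda21 \<omega>"
  unfolding lambda21_def
proof (rule cInf_greatest[OF assms(3)])
  fix y assume "y \<in> {dirichlet_energy \<omega> u |u. u \<in> H10 \<omega> \<and> L1_norm \<omega> u = 1}"
  then obtain v g where "y = dirichlet_energy \<omega> v" "H10_gradient \<omega> v g" "L1_norm \<omega> v = 1"
    using H10_iff[OF \<omega>] by auto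
  then show "c \<le> y"
    using assms(4)[of v g] H10_gradient_weak_gradient(3)[OF \<omega>, of v g] by (simp add: L1_norm_def)
qed

lemma DERIV_nonneg_if_min_right:
  fixes F :: "real \<Rightarrow> real"
  assumes "(F has_real_derivative D) (at 0)" "d > 0" "\<And>t. 0 < t \<Longrightarrow> t < d \<Longrightarrow> F 0 \<le> F t"
  shows "0 \<le> D"
proof (rule ccontr)
  assume "\<not> 0 \<le> D"
  then have "D < 0" by simp
  from has_real_derivative_neg_dec_right[OF assms(1) this]
  obtain d' where d': "d' > 0" "\<And>h. h > 0 \<Longrightarrow> h < d' \<Longrightarrow> F 0 > F h" by auto
  define t where "t = min d d' / 2"
  have "0 < t" "t < d" "t < d'" using assms(2) d'(1) by (auto simp: t_def)
  with assms(3)[of t] d'(2)[of t] show False by simp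
qed

lemma sum_single:
  fixes f :: "'a::finite \<Rightarrow> 'b::comm_monoid_add"
  assumes "\<And>l. l \<noteq> m \<Longrightarrow> f l = 0"
  shows "sum f UNIV = f m"
proof -
  have "sum f UNIV = f m + sum f (UNIV - {m})" by (rule sum.remove) auto
  also have "sum f (UNIV - {m}) = 0" using assms by (intro sum.neutral) auto
  finally show ?thesis by simp
qed

lemma sum_remove_single:
  fixes f :: "'a::finite \<Rightarrow> 'b::comm_monoid_add"
  assumes "\<And>l. l \<noteq> m \<Longrightarrow> f l = 0"
  shows "(\<Sum>l\<in>UNIV - {i}. f l) = (if m = i then 0 else f m)"
proof (cases "m = i")
  case True
  then show ?thesis using assms by (auto intro!: sum.neutral)
next
  case False
  then have "(\<Sum>l\<in>UNIV - {i}. f l) = f m + (\<Sum>l\<in>UNIV - {i} - {m}. f l)" by (intro sum.remove) auto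
  also have "(\<Sum>l\<in>UNIV - {i} - {m}. f l) = 0" using assms by (intro sum.neutral) auto
  finally show ?thesis using False by simp
qed

text \<open>The pointwise form of the competitors \<open>(u\<^sub>i - \<Sum>\<^sub>j u\<^sub>j + t \<phi>)\<^sup>+\<close> and \<open>(u\<^sub>j - t \<phi>)\<^sup>+\<close>, \<open>j \<noteq> i\<close>,
  where \<open>a\<close>, \<open>b\<close>, \<open>p\<close>, \<open>q\<close> are the values of \<open>u\<close>, its gradient, \<open>t \<phi>\<close> and its gradient.\<close>

lemma competitor_pointwise:
  fixes a :: "'k::finite \<Rightarrow> real" and b :: "'k \<Rightarrow> 'v::real_inner" and i :: 'k
  assumes nonneg: "\<And>l. 0 \<le> a l" and seg: "\<And>l m. l \<noteq> m \<Longrightarrow> a l * a m = 0"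
    and zero: "\<And>l. a l = 0 \<Longrightarrow> b l = 0" and p: "0 \<le> p"
  defines "A \<equiv> a i - (\<Sum>j\<in>UNIV - {i}. a j)" and "B \<equiv> b i - (\<Sum>j\<in>UNIV - {i}. b j)"
  shows "l \<noteq> m \<Longrightarrow> (if l = i then max 0 (A + p) else max 0 (a l - p)) * (if m = i then max 0 (A + p) else max 0 (a m - p)) = 0"
    and "(\<Sum>l\<in>UNIV. (norm (if l = i then if A + p > 0 then B + q else 0 else if a l - p > 0 then b l - q else 0))\<^sup>2) \<le> (norm (B + q))\<^sup>2"
    and "(norm B)\<^sup>2 = (\<Sum>l\<in>UNIV. (norm (b l))\<^sup>2)"
    and "a i + (if a i > 0 \<or> (\<forall>l. a l = 0) then p else 0) \<le> max 0 (A + p)"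
proof -
  \<comment> \<open>Segregation leaves at most one active index; if all values vanish, any index
    serves. All sums below then reduce to a single term.\<close>
  have "\<exists>m. \<forall>l. l \<noteq> m \<longrightarrow> a l = 0"
    using seg by (metis mult_eq_0_iff)
  then obtain m0 where m0: "\<And>l. l \<noteq> m0 \<Longrightarrow> a l = 0" by blast
  then have b0: "\<And>l. l \<noteq> m0 \<Longrightarrow> b l = 0" using zero by blast
  have A: "A = (if m0 = i then a i else - a m0)"
  proof -
    have "(\<Sum>j\<in>UNIV - {i}. a j) = (if m0 = i then 0 else a m0)" by (rule sum_remove_single) (rule m0)
    then show ?thesis using m0[of i] by (auto simp: A_def)
  qed
  have B: "B = (if m0 = i then b i else - b m0)"
  proof -
    have "(\<Sum>j\<in>UNIV - {i}. b j) = (if m0 = i then 0 else b m0)" by (rule sum_remove_single) (rule b0)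
    then show ?thesis using b0[of i] by (auto simp: B_def)
  qed
  let ?v = "\<lambda>l. if l = i then max 0 (A + p) else max 0 (a l - p)"
  let ?G = "\<lambda>l. if l = i then if A + p > 0 then B + q else 0 else if a l - p > 0 then b l - q else 0"
  have neg: "\<not> a l - p > 0" if "l \<noteq> m0" for l using m0[OF that] p by simp
  show "?v l * ?v m = 0" if "l \<noteq> m" for l m
  proof (rule ccontr)
    assume "?v l * ?v m \<noteq> 0"
    then have nz: "?v l \<noteq> 0" "?v m \<noteq> 0" by auto
    \<comment> \<open>Only \<open>i\<close> and \<open>m0\<close> can carry a nonzero competitor. If
      they differ and both do, then \<open>a m0 > p\<close> and \<open>A + p = p - a m0 > 0\<close>,
      which is contradictory.\<close>
    have "k = i \<or> k = m0 \<and> a m0 - p > 0" if "?v k \<noteq> 0" for k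
      using that neg[of k] by (cases "k = m0") (auto simp: max_def split: if_splits)
    from this[OF nz(1)] this[OF nz(2)] \<open>l \<noteq> m\<close> have "m0 \<noteq> i" "a m0 - p > 0" "?v i \<noteq> 0"
      using nz by (auto split: if_splits)
    with A show False by auto
  qed
  show "(\<Sum>l\<in>UNIV. (norm (?G l))\<^sup>2) \<le> (norm (B + q))\<^sup>2"
  \<comment> \<open>In the first case only the index \<open>i\<close> can contribute, with gradient
    \<open>B + q\<close>. In the second only \<open>m0\<close> can, with \<open>b m0 - q\<close>,
    which is \<open>B + q\<close> up to sign.\<close>
  proof (cases "A + p > 0 \<or> m0 = i")
    case True
    have "(\<Sum>l\<in>UNIV. (norm (?G l))\<^sup>2) = (norm (?G i))\<^sup>2"
    proof (rule sum_single)
      fix l assume "l \<noteq> i"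
      moreover have "\<not> a l - p > 0"
      proof (cases "l = m0")
        case l: True
        with True \<open>l \<noteq> i\<close> have "A + p > 0" by auto
        with A l \<open>l \<noteq> i\<close> show ?thesis by auto
      qed (rule neg)
      ultimately show "(norm (?G l))\<^sup>2 = 0" by simp
    qed
    then show ?thesis by simp
  next
    case False
    have "(\<Sum>l\<in>UNIV. (norm (?G l))\<^sup>2) = (norm (?G m0))\<^sup>2"
      by (rule sum_single) (use False neg in auto)
    moreover have "norm (b m0 - q) = norm (B + q)"
      using False B norm_minus_commute[of q "b m0"] by simp
    ultimately show ?thesis using False by simp
  qed
  have "(\<Sum>l\<in>UNIV. (norm (b l))\<^sup>2) = (norm (b m0))\<^sup>2"
    by (rule sum_single) (use b0 in auto)
  then show "(norm B)\<^sup>2 = (\<Sum>l\<in>UNIV. (norm (b l))\<^sup>2)" using B by simp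
  show "a i + (if a i > 0 \<or> (\<forall>l. a l = 0) then p else 0) \<le> max 0 (A + p)"
    using A nonneg[of i] nonneg[of m0] m0 p m0[of i] by (auto simp: max_def)
qed

text \<open>Obtained by expanding the nonnegative square integral of f - g/\<open>\<delta>\<close>.
  Unlike in \<open>sq_integral_add_le\<close>, the coefficient of the main term is arbitrarily close
  to 1.\<close>

lemma sq_integral_add_weighted:
  assumes "f \<in> L2 \<Omega>" "g \<in> L2 \<Omega>" "\<delta> > 0"
  shows "sq_integral \<Omega> (\<lambda>x. f x + g x) \<le> (1 + \<delta>) * sq_integral \<Omega> f + (1 + 1 / \<delta>) * sq_integral \<Omega> g"
proof -
  have "0 \<le> sq_integral \<Omega> (\<lambda>x. f x + (- 1 / \<delta>) *\<^sub>R g x)" by simp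
  then have "0 \<le> \<delta> * (sq_integral \<Omega> f + 2 * (- 1 / \<delta>) * (LINT x|lebesgue_on \<Omega>. f x \<bullet> g x) + (- 1 / \<delta>)\<^sup>2 * sq_integral \<Omega> g)"
    unfolding sq_integral_add_scaleR[OF assms(1,2)] using assms(3) by simp
  also have "\<dots> = \<delta> * sq_integral \<Omega> f - 2 * (LINT x|lebesgue_on \<Omega>. f x \<bullet> g x) + 1 / \<delta> * sq_integral \<Omega> g"
    using assms(3) by (simp add: field_simps power2_eq_square)
  finally show ?thesis
    using sq_integral_add_scaleR[OF assms(1,2), of 1] by (simp add: algebra_simps)
qed

section \<open>Minimality and the first variations\<close>

locale minimizer =
  fixes \<Omega> :: "(real^'n) set" and u :: "real^'n \<Rightarrow> real^'k"
  assumes open_\<Omega>: "open \<Omega>" and bounded_\<Omega>: "bounded \<Omega>" and minimizer: "minimizer_P \<Omega> u"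
begin

lemmas \<Omega> = open_\<Omega> bounded_\<Omega>

abbreviation g :: "'k \<Rightarrow> real^'n \<Rightarrow> real^'n" where
  "g j \<equiv> weak_gradient \<Omega> (\<lambda>x. u x $ j)"

text \<open>Takes the place of \<open>lambda21\<close> in the variational arguments; the two are
  identified in \<open>lambda21_eq_energy\<close>, once a continuous representative is
  available.\<close>

definition energy :: "'k \<Rightarrow> real" where
  "energy j = sq_integral \<Omega> (g j)"

lemma u_gradient: "H10_gradient \<Omega> (\<lambda>x. u x $ j) (g j)"
proof -
  have "(\<lambda>x. u x $ j) \<in> H10 \<Omega>"
    using minimizer by (auto simp: minimizer_P_def admissible_def H10_Sigma_def)
  then obtain k where k: "H10_gradient \<Omega> (\<lambda>x. u x $ j) k"
    using H10_iff[OF \<Omega>] by blast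
  note w = H10_gradient_weak_gradient[OF \<Omega> k]
  show ?thesis
    by (rule H10_gradient_cong_AE[OF k _ _ _ w(2) \<Omega>])
       (auto intro: L2_measurable w(1) H10_gradientD(1)[OF k])
qed

lemmas u_L2 = H10_gradientD(1)[OF u_gradient]
lemmas g_L2 = H10_gradientD(2)[OF u_gradient]

lemma u_nonneg: "AE x in lebesgue_on \<Omega>. \<forall>j. 0 \<le> u x $ j"
  using minimizer by (auto simp: minimizer_P_def admissible_def)

lemma Sigma_k_iff: "\<xi> \<in> Sigma_k \<longleftrightarrow> (\<forall>l m. l \<noteq> m \<longrightarrow> \<xi> $ l * \<xi> $ m = 0)"
  unfolding Sigma_k_def by (subst mem_Collect_eq, subst sum_nonneg_eq_0_iff) auto

lemma u_segregated: "AE x in lebesgue_on \<Omega>. \<forall>l m. l \<noteq> m \<longrightarrow> u x $ l * u x $ m = 0"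
  using minimizer by (auto simp: minimizer_P_def admissible_def H10_Sigma_def Sigma_k_iff)

lemma u_integral: "(LINT x|lebesgue_on \<Omega>. u x $ j) = 1"
proof -
  have "(LINT x|lebesgue_on \<Omega>. \<bar>u x $ j\<bar>) = 1"
    using minimizer by (auto simp: minimizer_P_def admissible_def L1_norm_def)
  moreover have "(LINT x|lebesgue_on \<Omega>. \<bar>u x $ j\<bar>) = (LINT x|lebesgue_on \<Omega>. u x $ j)"
    using L2_measurable[OF u_L2] u_nonneg by (intro integral_cong_AE) (auto elim!: eventually_mono)
  ultimately show ?thesis by simp
qed

lemma g_zero: "AE x in lebesgue_on \<Omega>. \<forall>j. u x $ j = 0 \<longrightarrow> g j x = 0"
  using H10_gradient_eq_0_on_zero_set[OF \<Omega> u_gradient] by (simp add: AE_all_countable)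

text \<open>Energy over squared mass does not change under scaling, so competitors of arbitrary
  positive mass are allowed; scaling each component separately preserves signs and
  segregation.\<close>

lemma minimality:
  fixes v :: "'k \<Rightarrow> real^'n \<Rightarrow> real" and G :: "'k \<Rightarrow> real^'n \<Rightarrow> real^'n"
  assumes v: "\<And>l. H10_gradient \<Omega> (v l) (G l)"
    and nonneg: "\<And>l. AE x in lebesgue_on \<Omega>. 0 \<le> v l x"
    and seg: "\<And>l m. l \<noteq> m \<Longrightarrow> AE x in lebesgue_on \<Omega>. v l x * v m x = 0"
    and pos: "\<And>l. 0 < (LINT x|lebesgue_on \<Omega>. v l x)"
  shows "(\<Sum>l\<in>UNIV. energy l) \<le> (\<Sum>l\<in>UNIV. sq_integral \<Omega> (G l) / (LINT x|lebesgue_on \<Omega>. v l x)\<^sup>2)"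
proof -
  define s where "s l = (LINT x|lebesgue_on \<Omega>. v l x)" for l
  have s: "s l > 0" for l using pos by (simp add: s_def)
  define V :: "real^'n \<Rightarrow> real^'k" where "V x = (\<chi> l. 1 / s l * v l x)" for x
  have Vl: "(\<lambda>x. V x $ l) = (\<lambda>x. 1 / s l * v l x)" for l by (simp add: V_def)
  have V: "H10_gradient \<Omega> (\<lambda>x. V x $ l) (\<lambda>x. (1 / s l) *\<^sub>R G l x)" for l
    unfolding Vl by (rule H10_gradient_scale[OF \<Omega> v])
  have "admissible \<Omega> V"
    unfolding admissible_def H10_Sigma_def mem_Collect_eq
  proof (intro conjI allI)
    show "(\<lambda>x. V x $ l) \<in> H10 \<Omega>" for l using V H10_iff[OF \<Omega>] by blast
    have "AE x in lebesgue_on \<Omega>. l \<noteq> m \<longrightarrow> v l x * v m x = 0" for l m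
      using seg[of l m] by (cases "l = m") auto
    then have "AE x in lebesgue_on \<Omega>. \<forall>l m. l \<noteq> m \<longrightarrow> v l x * v m x = 0"
      by (simp add: AE_all_countable)
    then show "AE x in lebesgue_on \<Omega>. V x \<in> Sigma_k"
      by (rule eventually_mono) (auto simp: Sigma_k_iff V_def)
    have "AE x in lebesgue_on \<Omega>. \<forall>l. 0 \<le> v l x" using nonneg by (simp add: AE_all_countable)
    then show "AE x in lebesgue_on \<Omega>. \<forall>l. 0 \<le> V x $ l"
      by (rule eventually_mono) (use s in \<open>auto simp: V_def less_imp_le\<close>)
    show "L1_norm \<Omega> (\<lambda>x. V x $ l) = 1" for l
    proof -
      have "(LINT x|lebesgue_on \<Omega>. \<bar>V x $ l\<bar>) = (LINT x|lebesgue_on \<Omega>. 1 / s l * v l x)"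
        using L2_measurable[OF H10_gradientD(1)[OF v[of l]]] nonneg[of l] s[of l]
        by (intro integral_cong_AE) (auto simp: Vl V_def abs_mult elim!: eventually_mono)
      also have "\<dots> = 1" using s[of l] by (simp add: s_def)
      finally show ?thesis by (simp add: L1_norm_def)
    qed
  qed
  then have le: "vector_energy \<Omega> u \<le> vector_energy \<Omega> V"
    using minimizer by (simp add: minimizer_P_def)
  have "vector_energy \<Omega> u = (\<Sum>l\<in>UNIV. energy l)"
    unfolding vector_energy_def energy_def
    by (rule Bochner_Integration.integral_sum) (rule L2_sq_integrable[OF g_L2])
  moreover have "vector_energy \<Omega> V = (\<Sum>l\<in>UNIV. dirichlet_energy \<Omega> (\<lambda>x. V x $ l))"
    unfolding vector_energy_def dirichlet_energy_def
    by (rule Bochner_Integration.integral_sum) (rule L2_sq_integrable[OF H10_gradient_weak_gradient(1)[OF \<Omega> V]])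
  moreover have "dirichlet_energy \<Omega> (\<lambda>x. V x $ l) = sq_integral \<Omega> (G l) / (s l)\<^sup>2" for l
    unfolding H10_gradient_weak_gradient(3)[OF \<Omega> V] using s[of l] by (simp add: power_mult_distrib power_divide)
  ultimately show ?thesis using le by (simp add: s_def)
qed

text \<open>Only the i-th component is exchanged, so the energies of the others cancel. With the
  mass multiplied out, the inequality also covers a competitor of mass zero.\<close>

lemma single_component_minimality:
  assumes v: "H10_gradient \<Omega> v G" and nonneg: "AE x in lebesgue_on \<Omega>. 0 \<le> v x"
    and seg: "\<And>j. j \<noteq> i \<Longrightarrow> AE x in lebesgue_on \<Omega>. v x * u x $ j = 0"
  shows "energy i * (LINT x|lebesgue_on \<Omega>. v x)\<^sup>2 \<le> sq_integral \<Omega> G"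
proof (cases "(LINT x|lebesgue_on \<Omega>. v x) > 0")
  case False
  moreover have "0 \<le> (LINT x|lebesgue_on \<Omega>. v x)" using nonneg by (rule integral_nonneg_AE)
  ultimately have "(LINT x|lebesgue_on \<Omega>. v x) = 0" by simp
  then show ?thesis by simp
next
  case True
  define s where "s = (LINT x|lebesgue_on \<Omega>. v x)"
  define V where "V l = (if l = i then v else (\<lambda>x. u x $ l))" for l
  define GG where "GG l = (if l = i then G else g l)" for l
  have "(\<Sum>l\<in>UNIV. energy l) \<le> (\<Sum>l\<in>UNIV. sq_integral \<Omega> (GG l) / (LINT x|lebesgue_on \<Omega>. V l x)\<^sup>2)"
  proof (rule minimality)
    show "H10_gradient \<Omega> (V l) (GG l)" for l using v u_gradient by (simp add: V_def GG_def)
    show "AE x in lebesgue_on \<Omega>. 0 \<le> V l x" for l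
      using nonneg u_nonneg by (auto simp: V_def elim: eventually_mono)
    show "0 < (LINT x|lebesgue_on \<Omega>. V l x)" for l using True u_integral[of l] by (simp add: V_def)
    show "AE x in lebesgue_on \<Omega>. V l x * V m x = 0" if "l \<noteq> m" for l m
      using that seg[of m] seg[of l] u_segregated
      by (auto simp: V_def mult.commute elim: eventually_mono)
  qed
  also have "\<dots> = sq_integral \<Omega> G / s\<^sup>2 + (\<Sum>l\<in>UNIV - {i}. energy l)"
  proof -
    have "(\<Sum>l\<in>UNIV - {i}. sq_integral \<Omega> (GG l) / (LINT x|lebesgue_on \<Omega>. V l x)\<^sup>2) = (\<Sum>l\<in>UNIV - {i}. energy l)"
      by (rule sum.cong) (auto simp: GG_def V_def u_integral energy_def)
    then show ?thesis
      by (subst sum.remove[of _ i]) (auto simp: GG_def V_def s_def)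
  qed
  finally have "energy i \<le> sq_integral \<Omega> G / s\<^sup>2"
    by (subst (asm) sum.remove[of _ i]) auto
  then show ?thesis using True by (simp add: s_def[symmetric] pos_le_divide_eq)
qed


lemma u_integrable: "integrable (lebesgue_on \<Omega>) (\<lambda>x. u x $ j)"
  by (rule L2_integrable[OF \<Omega> u_L2])

lemma u_measurable [measurable]: "(\<lambda>x. u x $ j) \<in> borel_measurable (lebesgue_on \<Omega>)"
  by (rule L2_measurable[OF u_L2])

lemma integrable_test_restrict:
  assumes "\<phi> \<in> test_functions \<Omega>" "Measurable.pred (lebesgue_on \<Omega>) P"
  shows "integrable (lebesgue_on \<Omega>) (\<lambda>x. if P x then \<phi> x else 0)"
  by (rule L2_integrable[OF \<Omega> L2_indicator_scaleR[OF test_functions_L2[OF \<Omega> assms(1)] assms(2)]])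

lemma pred_positive: "Measurable.pred (lebesgue_on \<Omega>) (\<lambda>x. u x $ j > 0)"
  by measurable

lemma pred_positive_or_zero: "Measurable.pred (lebesgue_on \<Omega>) (\<lambda>x. u x $ j > 0 \<or> (\<forall>l. u x $ l = 0))"
  by measurable

text \<open>Where \<open>u x $ j = 0\<close> the positive part loses nothing, so the loss of mass is
  at most the integral of \<open>t * \<phi> x\<close> over the positivity set. This is the origin of
  the indicator functions in the differential inequalities.\<close>

lemma integral_truncated_ge:
  assumes \<phi>: "\<phi> \<in> test_functions \<Omega>" "\<And>x. 0 \<le> \<phi> x" and t: "0 < t"
  shows "1 - t * (LINT x|lebesgue_on \<Omega>. (if u x $ j > 0 then \<phi> x else 0)) \<le> (LINT x|lebesgue_on \<Omega>. max 0 (u x $ j - t * \<phi> x))"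
proof -
  note i = integrable_test_restrict[OF \<phi>(1) pred_positive]
  have "1 - t * (LINT x|lebesgue_on \<Omega>. (if u x $ j > 0 then \<phi> x else 0))
      = (LINT x|lebesgue_on \<Omega>. u x $ j - t * (if u x $ j > 0 then \<phi> x else 0))"
    using i[of j] u_integrable[of j] by (simp add: u_integral)
  also have "\<dots> \<le> (LINT x|lebesgue_on \<Omega>. max 0 (u x $ j - t * \<phi> x))"
  proof (rule integral_mono_AE)
    show "integrable (lebesgue_on \<Omega>) (\<lambda>x. u x $ j - t * (if u x $ j > 0 then \<phi> x else 0))"
      using i[of j] u_integrable[of j] by simp
    have "H10_gradient \<Omega> (\<lambda>x. u x $ j - t * \<phi> x) (\<lambda>x. g j x - t *\<^sub>R gradient \<phi> x)"
      by (intro H10_gradient_diff[OF \<Omega>] H10_gradient_scale[OF \<Omega>] u_gradient H10_gradient_test_function[OF \<Omega> \<phi>(1)])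
    from H10_gradientD(1)[OF H10_gradient_positive_part[OF \<Omega> this]]
    show "integrable (lebesgue_on \<Omega>) (\<lambda>x. max 0 (u x $ j - t * \<phi> x))"
      by (rule L2_integrable[OF \<Omega>])
    show "AE x in lebesgue_on \<Omega>. u x $ j - t * (if u x $ j > 0 then \<phi> x else 0) \<le> max 0 (u x $ j - t * \<phi> x)"
      using u_nonneg by eventually_elim (auto simp: max_def)
  qed
  finally show ?thesis .
qed

lemma truncated_gradient:
  assumes "\<phi> \<in> test_functions \<Omega>"
  shows "H10_gradient \<Omega> (\<lambda>x. max 0 (u x $ j - t * \<phi> x)) (\<lambda>x. if u x $ j - t * \<phi> x > 0 then g j x - t *\<^sub>R gradient \<phi> x else 0)"
  by (intro H10_gradient_positive_part[OF \<Omega>] H10_gradient_diff[OF \<Omega>] H10_gradient_scale[OF \<Omega>]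
      u_gradient H10_gradient_test_function[OF \<Omega> assms])

text \<open>Dropping the truncation only increases the energy, and the untruncated energy is a
  quadratic polynomial in \<open>t\<close>.\<close>

lemma truncated_energy_le:
  assumes \<phi>: "\<phi> \<in> test_functions \<Omega>"
  shows "sq_integral \<Omega> (\<lambda>x. if u x $ j - t * \<phi> x > 0 then g j x - t *\<^sub>R gradient \<phi> x else 0)
     \<le> energy j - 2 * t * (LINT x|lebesgue_on \<Omega>. g j x \<bullet> gradient \<phi> x) + t\<^sup>2 * sq_integral \<Omega> (gradient \<phi>)"
proof -
  have L2: "(\<lambda>x. g j x - t *\<^sub>R gradient \<phi> x) \<in> L2 \<Omega>"
    by (intro L2_diff g_L2 L2_scaleR gradient_L2[OF \<Omega> \<phi>])
  have "sq_integral \<Omega> (\<lambda>x. if u x $ j - t * \<phi> x > 0 then g j x - t *\<^sub>R gradient \<phi> x else 0)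
      \<le> sq_integral \<Omega> (\<lambda>x. g j x - t *\<^sub>R gradient \<phi> x)"
    by (rule sq_integral_mono[OF H10_gradientD(2)[OF truncated_gradient[OF \<phi>]] L2]) simp
  also have "\<dots> = sq_integral \<Omega> (\<lambda>x. g j x + (- t) *\<^sub>R gradient \<phi> x)" by simp
  also have "\<dots> = energy j - 2 * t * (LINT x|lebesgue_on \<Omega>. g j x \<bullet> gradient \<phi> x) + t\<^sup>2 * sq_integral \<Omega> (gradient \<phi>)"
    unfolding sq_integral_add_scaleR[OF g_L2 gradient_L2[OF \<Omega> \<phi>]] by (simp add: energy_def)
  finally show ?thesis .
qed

lemma component_subsolution:
  assumes \<phi>: "\<phi> \<in> test_functions \<Omega>" "\<And>x. 0 \<le> \<phi> x"
  shows "(LINT x|lebesgue_on \<Omega>. g i x \<bullet> gradient \<phi> x) \<le> energy i * (LINT x|lebesgue_on \<Omega>. (if u x $ i > 0 then \<phi> x else 0))"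
proof -
  define c where "c = (LINT x|lebesgue_on \<Omega>. (if u x $ i > 0 then \<phi> x else 0))"
  define I where "I = (LINT x|lebesgue_on \<Omega>. g i x \<bullet> gradient \<phi> x)"
  define e where "e = sq_integral \<Omega> (gradient \<phi>)"
  have c0: "0 \<le> c" unfolding c_def using \<phi>(2) by (intro integral_nonneg_AE) auto
  \<comment> \<open>The bound on \<open>t\<close> keeps the lower mass bound
    \<open>1 - t * c\<close> nonnegative, so that it may be squared. Both sides agree at
    \<open>t = 0\<close>.\<close>
  have le: "energy i * (1 - t * c)\<^sup>2 \<le> energy i - 2 * t * I + t\<^sup>2 * e" if t: "0 < t" "t < 1 / (c + 1)" for t
  proof -
    have "t * (c + 1) < 1" using t(2) c0 by (simp add: pos_less_divide_eq)
    then have tc: "0 \<le> 1 - t * c" using t(1) by (simp add: algebra_simps)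
    have "energy i * (1 - t * c)\<^sup>2 \<le> energy i * (LINT x|lebesgue_on \<Omega>. max 0 (u x $ i - t * \<phi> x))\<^sup>2"
      using integral_truncated_ge[OF \<phi> t(1), of i] tc
      by (intro mult_left_mono power_mono) (auto simp: c_def energy_def)
    also have "\<dots> \<le> sq_integral \<Omega> (\<lambda>x. if u x $ i - t * \<phi> x > 0 then g i x - t *\<^sub>R gradient \<phi> x else 0)"
    proof (rule single_component_minimality[OF truncated_gradient[OF \<phi>(1)]])
      fix j assume "j \<noteq> i"
      show "AE x in lebesgue_on \<Omega>. max 0 (u x $ i - t * \<phi> x) * u x $ j = 0"
        using u_nonneg u_segregated
      proof eventually_elim
        case (elim x)
        then have "u x $ i = 0 \<or> u x $ j = 0" using \<open>j \<noteq> i\<close> by (metis mult_eq_0_iff)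
        moreover have "max 0 (u x $ i - t * \<phi> x) = 0" if "u x $ i = 0"
          using that \<phi>(2)[of x] t(1) by simp
        ultimately show ?case by auto
      qed
    qed simp
    also have "\<dots> \<le> energy i - 2 * t * I + t\<^sup>2 * e"
      using truncated_energy_le[OF \<phi>(1)] by (simp add: I_def e_def)
    finally show ?thesis .
  qed
  have "((\<lambda>t. energy i - 2 * t * I + t\<^sup>2 * e - energy i * (1 - t * c)\<^sup>2) has_real_derivative
      - 2 * I + 2 * energy i * c) (at 0)"
    by (auto intro!: derivative_eq_intros)
  then have "0 \<le> - 2 * I + 2 * energy i * c"
    by (rule DERIV_nonneg_if_min_right[where d="1 / (c + 1)"]) (use le c0 in auto)
  then show ?thesis by (simp add: c_def I_def)
qed

lemma difference_supersolution:
  assumes \<phi>: "\<phi> \<in> test_functions \<Omega>" "\<And>x. 0 \<le> \<phi> x"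
  shows "energy i * (LINT x|lebesgue_on \<Omega>. (if u x $ i > 0 \<or> (\<forall>l. u x $ l = 0) then \<phi> x else 0))
      - (\<Sum>j\<in>UNIV - {i}. energy j * (LINT x|lebesgue_on \<Omega>. (if u x $ j > 0 then \<phi> x else 0)))
    \<le> (LINT x|lebesgue_on \<Omega>. (g i x - (\<Sum>j\<in>UNIV - {i}. g j x)) \<bullet> gradient \<phi> x)"
proof -
  let ?J = "UNIV - {i}"
  define ci where "ci = (LINT x|lebesgue_on \<Omega>. (if u x $ i > 0 \<or> (\<forall>l. u x $ l = 0) then \<phi> x else 0))"
  define c where "c j = (LINT x|lebesgue_on \<Omega>. (if u x $ j > 0 then \<phi> x else 0))" for j
  define U where "U x = u x $ i - (\<Sum>j\<in>?J. u x $ j)" for x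
  define GU where "GU x = g i x - (\<Sum>j\<in>?J. g j x)" for x
  define I where "I = (LINT x|lebesgue_on \<Omega>. GU x \<bullet> gradient \<phi> x)"
  define J where "J j = (LINT x|lebesgue_on \<Omega>. g j x \<bullet> gradient \<phi> x)" for j
  define e where "e = sq_integral \<Omega> (gradient \<phi>)"
  define S where "S = (\<Sum>l\<in>UNIV. energy l)"
  have ci0: "0 \<le> ci" and c0: "0 \<le> c j" for j
    unfolding ci_def c_def using \<phi>(2) by (auto intro!: integral_nonneg_AE)
  have U: "H10_gradient \<Omega> U GU"
    unfolding U_def GU_def by (intro H10_gradient_diff[OF \<Omega>] H10_gradient_sum[OF \<Omega>] u_gradient)
  note L2d = gradient_L2[OF \<Omega> \<phi>(1)]
  have facts: "AE x in lebesgue_on \<Omega>. (\<forall>j. 0 \<le> u x $ j) \<and> (\<forall>l m. l \<noteq> m \<longrightarrow> u x $ l * u x $ m = 0) \<and> (\<forall>j. u x $ j = 0 \<longrightarrow> g j x = 0)"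
    using u_nonneg u_segregated g_zero by eventually_elim auto
  have pw: "AE x in lebesgue_on \<Omega>.
      (\<forall>l m. l \<noteq> m \<longrightarrow> (if l = i then max 0 (U x + t * \<phi> x) else max 0 (u x $ l - t * \<phi> x)) *
          (if m = i then max 0 (U x + t * \<phi> x) else max 0 (u x $ m - t * \<phi> x)) = 0) \<and>
      (\<Sum>l\<in>UNIV. (norm (if l = i then if U x + t * \<phi> x > 0 then GU x + t *\<^sub>R gradient \<phi> x else 0
          else if u x $ l - t * \<phi> x > 0 then g l x - t *\<^sub>R gradient \<phi> x else 0))\<^sup>2) \<le> (norm (GU x + t *\<^sub>R gradient \<phi> x))\<^sup>2 \<and>
      (norm (GU x))\<^sup>2 = (\<Sum>l\<in>UNIV. (norm (g l x))\<^sup>2) \<and>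
      u x $ i + t * (if u x $ i > 0 \<or> (\<forall>l. u x $ l = 0) then \<phi> x else 0) \<le> max 0 (U x + t * \<phi> x)" if "t > 0" for t
    using facts
  proof eventually_elim
    case (elim x)
    have p: "0 \<le> t * \<phi> x" using that \<phi>(2)[of x] by simp
    have q: "\<And>l. 0 \<le> u x $ l" "\<And>l m. l \<noteq> m \<Longrightarrow> u x $ l * u x $ m = 0" "\<And>l. u x $ l = 0 \<Longrightarrow> g l x = 0"
      using elim by blast+
    note * = competitor_pointwise[where a="\<lambda>l. u x $ l" and b="\<lambda>l. g l x" and p="t * \<phi> x" and i=i, OF q p, folded U_def GU_def]
    have eq: "t * (if u x $ i > 0 \<or> (\<forall>l. u x $ l = 0) then \<phi> x else 0) =
      (if u x $ i > 0 \<or> (\<forall>l. u x $ l = 0) then t * \<phi> x else 0)" by simp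
    show ?case unfolding eq
      by (intro conjI allI impI *)
  qed
  \<comment> \<open>Pointwise at most one of the gradients is nonzero, so there are no mixed terms
    and equality holds at \<open>t = 0\<close>.\<close>
  have GU_sq: "sq_integral \<Omega> GU = S"
  proof -
    have "sq_integral \<Omega> GU = (LINT x|lebesgue_on \<Omega>. (\<Sum>l\<in>UNIV. (norm (g l x))\<^sup>2))"
      using pw[of 1] L2_measurable[OF g_L2] L2_measurable[OF H10_gradientD(2)[OF U]]
      by (intro integral_cong_AE) (auto elim: eventually_mono)
    also have "\<dots> = S"
      unfolding S_def energy_def by (rule Bochner_Integration.integral_sum) (rule L2_sq_integrable[OF g_L2])
    finally show ?thesis .
  qed
  define b where "b j t = 1 / (1 - t * c j)\<^sup>2" for j t
  define a where "a t = 1 / (1 + t * ci)\<^sup>2" for t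
  define B where "B j t = energy j - 2 * t * J j + t\<^sup>2 * e" for j t
  \<comment> \<open>The weights \<open>a\<close> and \<open>b j\<close> are the inverse squares of
    the lower mass bounds. The factor of \<open>a t\<close> bounds the sum of all energies, and
    \<open>B j t\<close> bounds a single one with \<open>j\<close> different from
    \<open>i\<close>.\<close>
  define F where "F t = (S + 2 * t * I + t\<^sup>2 * e) * a t + (\<Sum>j\<in>?J. B j t * (b j t - a t))" for t
  \<comment> \<open>One bound for all \<open>c j\<close>, so that \<open>t < 1 / (C + 1)\<close>
    keeps every \<open>1 - t * c j\<close> positive at once.\<close>
  define C where "C = (\<Sum>j\<in>UNIV. c j)"
  have C0: "0 \<le> C" and cC: "c j \<le> C" for j
    unfolding C_def using c0 by (auto intro: sum_nonneg member_le_sum)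
  have le: "S \<le> F t" if t: "0 < t" "t < 1 / (C + 1)" for t
  proof -
    have "t * (C + 1) < 1" using t(2) C0 by (simp add: pos_less_divide_eq)
    then have "t * C < 1" using t(1) by (simp add: algebra_simps)
    then have tc: "0 < 1 - t * c j" for j
      using mult_left_mono[OF cC[of j], of t] t(1) by linarith
    define v where "v l x = (if l = i then max 0 (U x + t * \<phi> x) else max 0 (u x $ l - t * \<phi> x))" for l x
    define G where "G l x = (if l = i then if U x + t * \<phi> x > 0 then GU x + t *\<^sub>R gradient \<phi> x else 0
          else if u x $ l - t * \<phi> x > 0 then g l x - t *\<^sub>R gradient \<phi> x else 0)" for l x
    define s where "s l = (LINT x|lebesgue_on \<Omega>. v l x)" for l
    have v: "H10_gradient \<Omega> (v l) (G l)" for l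
    proof (cases "l = i")
      case True
      have "H10_gradient \<Omega> (\<lambda>x. max 0 (U x + t * \<phi> x)) (\<lambda>x. if U x + t * \<phi> x > 0 then GU x + t *\<^sub>R gradient \<phi> x else 0)"
        by (intro H10_gradient_positive_part[OF \<Omega>] H10_gradient_add[OF \<Omega>] H10_gradient_scale[OF \<Omega>] U
            H10_gradient_test_function[OF \<Omega> \<phi>(1)])
      then show ?thesis unfolding v_def[abs_def] G_def[abs_def] using True by simp
    next
      case False
      then show ?thesis unfolding v_def[abs_def] G_def[abs_def] using truncated_gradient[OF \<phi>(1), of l t] by simp
    qed
    note L2G = H10_gradientD(2)[OF v] and v_int = L2_integrable[OF \<Omega> H10_gradientD(1)[OF v]]
    have s_i: "1 + t * ci \<le> s i"
    proof -
      note int = integrable_test_restrict[OF \<phi>(1) pred_positive_or_zero[of i]]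
      have "1 + t * ci = (LINT x|lebesgue_on \<Omega>. u x $ i + t * (if u x $ i > 0 \<or> (\<forall>l. u x $ l = 0) then \<phi> x else 0))"
        using int u_integrable[of i] by (simp add: u_integral ci_def)
      also have "\<dots> \<le> s i"
        unfolding s_def
      proof (rule integral_mono_AE[OF _ v_int])
        show "integrable (lebesgue_on \<Omega>) (\<lambda>x. u x $ i + t * (if u x $ i > 0 \<or> (\<forall>l. u x $ l = 0) then \<phi> x else 0))"
          using int u_integrable[of i] by simp
        show "AE x in lebesgue_on \<Omega>. u x $ i + t * (if u x $ i > 0 \<or> (\<forall>l. u x $ l = 0) then \<phi> x else 0) \<le> v i x"
          using pw[OF t(1)] by (rule eventually_mono) (simp add: v_def)
      qed
      finally show ?thesis .
    qed
    have s_j: "1 - t * c j \<le> s j" if "j \<noteq> i" for j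
      using integral_truncated_ge[OF \<phi> t(1), of j] that by (simp add: c_def s_def v_def)
    have s_pos: "0 < s l" for l
    proof (cases "l = i")
      case True
      have "0 < 1 + t * ci" using t(1) ci0 by (simp add: add_pos_nonneg)
      with s_i True show ?thesis by simp
    qed (use s_j[of l] tc[of l] in linarith)
    have "S \<le> (\<Sum>l\<in>UNIV. sq_integral \<Omega> (G l) / (s l)\<^sup>2)"
      unfolding S_def s_def
    proof (rule minimality[OF v])
      show "AE x in lebesgue_on \<Omega>. 0 \<le> v l x" for l by (simp add: v_def)
      show "AE x in lebesgue_on \<Omega>. v l x * v m x = 0" if "l \<noteq> m" for l m
        using pw[OF t(1)] by (rule eventually_mono) (use that in \<open>auto simp only: v_def\<close>)
      show "0 < (LINT x|lebesgue_on \<Omega>. v l x)" for l using s_pos[of l] by (simp add: s_def)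
    qed
    also have "\<dots> = sq_integral \<Omega> (G i) / (s i)\<^sup>2 + (\<Sum>j\<in>?J. sq_integral \<Omega> (G j) / (s j)\<^sup>2)"
      by (rule sum.remove) auto
    also have "\<dots> \<le> sq_integral \<Omega> (G i) * a t + (\<Sum>j\<in>?J. sq_integral \<Omega> (G j) * b j t)"
    proof (intro add_mono sum_mono)
      have "sq_integral \<Omega> (G i) / (s i)\<^sup>2 \<le> sq_integral \<Omega> (G i) / (1 + t * ci)\<^sup>2"
        using s_i t(1) ci0 by (intro divide_left_mono power_mono mult_pos_pos zero_less_power s_pos) (auto simp: add_pos_nonneg)
      then show "sq_integral \<Omega> (G i) / (s i)\<^sup>2 \<le> sq_integral \<Omega> (G i) * a t" by (simp add: a_def)
      fix j assume "j \<in> ?J"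
      then have "sq_integral \<Omega> (G j) / (s j)\<^sup>2 \<le> sq_integral \<Omega> (G j) / (1 - t * c j)\<^sup>2"
        using s_j[of j] tc[of j] by (intro divide_left_mono power_mono mult_pos_pos zero_less_power s_pos) auto
      then show "sq_integral \<Omega> (G j) / (s j)\<^sup>2 \<le> sq_integral \<Omega> (G j) * b j t" by (simp add: b_def)
    qed
    \<comment> \<open>Collects the total energy under the single weight \<open>a t\<close>. The
      corrections carry the weights \<open>b j t - a t\<close>, which are nonnegative since
      \<open>a t\<close> is at most 1 and \<open>b j t\<close> at least 1, so upper bounds may be
      inserted in both parts.\<close>
    also have "\<dots> = (sq_integral \<Omega> (G i) + (\<Sum>j\<in>?J. sq_integral \<Omega> (G j))) * a t + (\<Sum>j\<in>?J. sq_integral \<Omega> (G j) * (b j t - a t))"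
      by (simp add: algebra_simps sum_distrib_left sum.distrib[symmetric])
    also have "sq_integral \<Omega> (G i) + (\<Sum>j\<in>?J. sq_integral \<Omega> (G j)) = (\<Sum>l\<in>UNIV. sq_integral \<Omega> (G l))"
      by (rule sum.remove[symmetric]) auto
    also have "(\<Sum>l\<in>UNIV. sq_integral \<Omega> (G l)) * a t + (\<Sum>j\<in>?J. sq_integral \<Omega> (G j) * (b j t - a t)) \<le> F t"
      unfolding F_def
    proof (intro add_mono mult_right_mono sum_mono)
      have L2s: "(\<lambda>x. GU x + t *\<^sub>R gradient \<phi> x) \<in> L2 \<Omega>"
        by (intro L2_add L2_scaleR L2d H10_gradientD(2)[OF U])
      have "(\<Sum>l\<in>UNIV. sq_integral \<Omega> (G l)) = (LINT x|lebesgue_on \<Omega>. (\<Sum>l\<in>UNIV. (norm (G l x))\<^sup>2))"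
        by (rule Bochner_Integration.integral_sum[symmetric]) (rule L2_sq_integrable[OF L2G])
      also have "\<dots> \<le> sq_integral \<Omega> (\<lambda>x. GU x + t *\<^sub>R gradient \<phi> x)"
      proof (rule integral_mono_AE)
        show "integrable (lebesgue_on \<Omega>) (\<lambda>x. \<Sum>l\<in>UNIV. (norm (G l x))\<^sup>2)"
          by (intro Bochner_Integration.integrable_sum L2_sq_integrable[OF L2G])
        show "integrable (lebesgue_on \<Omega>) (\<lambda>x. (norm (GU x + t *\<^sub>R gradient \<phi> x))\<^sup>2)"
          by (rule L2_sq_integrable[OF L2s])
        show "AE x in lebesgue_on \<Omega>. (\<Sum>l\<in>UNIV. (norm (G l x))\<^sup>2) \<le> (norm (GU x + t *\<^sub>R gradient \<phi> x))\<^sup>2"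
          using pw[OF t(1)] by (rule eventually_mono) (simp only: G_def)
      qed
      also have "\<dots> = S + 2 * t * I + t\<^sup>2 * e"
        unfolding sq_integral_add_scaleR[OF H10_gradientD(2)[OF U] L2d] GU_sq by (simp add: I_def e_def)
      finally show "(\<Sum>l\<in>UNIV. sq_integral \<Omega> (G l)) \<le> S + 2 * t * I + t\<^sup>2 * e" .
      show "0 \<le> a t" by (simp add: a_def)
      fix j assume j: "j \<in> ?J"
      then show "sq_integral \<Omega> (G j) \<le> B j t"
        using truncated_energy_le[OF \<phi>(1), of j t] by (simp add: B_def G_def J_def e_def)
      have "1 \<le> (1 + t * ci)\<^sup>2" using t(1) ci0 by (intro one_le_power) simp
      then have "a t \<le> 1" by (simp add: a_def divide_le_eq_1)
      moreover have "1 \<le> b j t"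
      proof -
        have "(1 - t * c j)\<^sup>2 \<le> 1" using tc[of j] t(1) c0[of j] by (intro power_le_one) auto
        then show ?thesis using tc[of j] by (simp add: b_def)
      qed
      ultimately show "0 \<le> b j t - a t" by simp
    qed
    finally show ?thesis .
  qed
  have da: "(a has_real_derivative (- 2 * ci)) (at 0)"
    unfolding a_def[abs_def] by (auto intro!: derivative_eq_intros)
  have db: "(b j has_real_derivative (2 * c j)) (at 0)" for j
    unfolding b_def[abs_def] by (auto intro!: derivative_eq_intros)
  have a0: "a 0 = 1" and b0: "b j 0 = 1" and B0: "B j 0 = energy j" for j
    by (simp_all add: a_def b_def B_def)
  have dB: "(B j has_real_derivative (- 2 * J j)) (at 0)" for j
    unfolding B_def[abs_def] by (auto intro!: derivative_eq_intros)
  have dA: "((\<lambda>t. S + 2 * t * I + t\<^sup>2 * e) has_real_derivative 2 * I) (at 0)"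
    by (auto intro!: derivative_eq_intros)
  have "(F has_real_derivative (2 * I * a 0 + - 2 * ci * (S + 2 * 0 * I + 0\<^sup>2 * e) +
      (\<Sum>j\<in>?J. (- 2 * J j) * (b j 0 - a 0) + (2 * c j - - 2 * ci) * B j 0))) (at 0)"
    unfolding F_def[abs_def]
    by (intro DERIV_add DERIV_mult DERIV_sum DERIV_diff dA da db dB)
  \<comment> \<open>As \<open>b j 0 = a 0\<close>, the terms with \<open>J j\<close> drop out and
    \<open>B j\<close> enters only through its value \<open>energy j\<close>.\<close>
  then have "(F has_real_derivative (2 * I - 2 * ci * S + (\<Sum>j\<in>?J. (2 * c j + 2 * ci) * energy j))) (at 0)"
    by (simp add: a0 b0 B0)
  then have "0 \<le> 2 * I - 2 * ci * S + (\<Sum>j\<in>?J. (2 * c j + 2 * ci) * energy j)"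
  proof (rule DERIV_nonneg_if_min_right[where d="1 / (C + 1)"])
    have "F 0 = S" by (simp add: F_def a0 b0)
    then show "F 0 \<le> F t" if "0 < t" "t < 1 / (C + 1)" for t using le[OF that] by simp
  qed (use C0 in auto)
  also have "(\<Sum>j\<in>?J. (2 * c j + 2 * ci) * energy j) = 2 * (\<Sum>j\<in>?J. energy j * c j) + 2 * ci * (\<Sum>j\<in>?J. energy j)"
    by (simp add: sum_distrib_left sum.distrib[symmetric] algebra_simps)
  \<comment> \<open>The terms \<open>2 * ci * energy j\<close> with \<open>j\<close> different from
    \<open>i\<close> cancel against \<open>2 * ci * S\<close>, leaving \<open>energy i\<close> as
    the only coefficient of \<open>ci\<close>.\<close>
  also have "S = energy i + (\<Sum>j\<in>?J. energy j)"
    unfolding S_def by (rule sum.remove) auto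
  finally have "energy i * ci - (\<Sum>j\<in>?J. energy j * c j) \<le> I"
    by (simp add: algebra_simps)
  then show ?thesis by (simp add: ci_def c_def I_def GU_def)
qed

end

section \<open>Continuous representatives\<close>

locale continuous_minimizer = minimizer \<Omega> u for \<Omega> :: "(real^'n) set" and u :: "real^'n \<Rightarrow> real^'k" +
  fixes w :: "real^'n \<Rightarrow> real^'k"
  assumes representative: "continuous_representative \<Omega> u w"
begin

abbreviation \<omega> :: "'k \<Rightarrow> (real^'n) set" where
  "\<omega> \<equiv> positivity_set \<Omega> w"

lemma w_continuous: "continuous_on \<Omega> (\<lambda>x. w x $ j)"
  using representative by (auto simp: continuous_representative_def intro!: continuous_intros)

lemma w_eq_u: "AE x in lebesgue_on \<Omega>. w x = u x"
  using representative by (simp add: continuous_representative_def)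

lemma \<omega>_subset: "\<omega> j \<subseteq> \<Omega>"
  by (auto simp: positivity_set_def)

lemma open_\<omega>: "open (\<omega> j)"
proof -
  have "open (\<Omega> \<inter> (\<lambda>x. w x $ j) -` {0<..})"
    by (rule continuous_open_preimage[OF w_continuous open_\<Omega>]) simp
  also have "\<Omega> \<inter> (\<lambda>x. w x $ j) -` {0<..} = \<omega> j"
    by (auto simp: positivity_set_def)
  finally show ?thesis .
qed

lemma bounded_\<omega>: "bounded (\<omega> j)"
  using bounded_\<Omega> \<omega>_subset by (rule bounded_subset)

lemma in_\<omega>_iff: "AE x in lebesgue_on \<Omega>. \<forall>j. x \<in> \<omega> j \<longleftrightarrow> u x $ j > 0"
proof -
  have "AE x in lebesgue_on \<Omega>. x \<in> \<Omega>" by (rule AE_I2) simp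
  with w_eq_u show ?thesis by eventually_elim (simp add: positivity_set_def)
qed

lemma in_zero_set_iff: "AE x in lebesgue_on \<Omega>. x \<in> zero_set \<Omega> w \<longleftrightarrow> (\<forall>l. u x $ l = 0)"
proof -
  have "AE x in lebesgue_on \<Omega>. x \<in> \<Omega>" by (rule AE_I2) simp
  with w_eq_u show ?thesis by eventually_elim (simp add: zero_set_def vec_eq_iff)
qed

text \<open>Extended by zero and replaced by its absolute value, \<open>v\<close> can take the place
  of the i-th component: on \<open>\<omega> i\<close> the other components vanish almost everywhere
  by segregation, and elsewhere the extension is zero.\<close>

lemma energy_le_of_H10_gradient:
  assumes v: "H10_gradient (\<omega> i) v k" and L1: "(LINT x|lebesgue_on (\<omega> i). \<bar>v x\<bar>) = 1"
  shows "energy i \<le> sq_integral (\<omega> i) k"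
proof -
  note sub = open_\<omega>[of i] open_\<Omega> \<omega>_subset[of i]
  define V where "V x = (if x \<in> \<omega> i then v x else 0)" for x
  define K where "K x = (if x \<in> \<omega> i then k x else 0)" for x
  have V: "H10_gradient \<Omega> V K"
    unfolding V_def K_def by (rule H10_gradient_extend[OF open_\<omega> \<Omega> \<omega>_subset v])
  note aV = H10_gradient_abs[OF \<Omega> V]
  have "energy i * (LINT x|lebesgue_on \<Omega>. \<bar>V x\<bar>)\<^sup>2 \<le> sq_integral \<Omega> (\<lambda>x. sgn (V x) *\<^sub>R K x)"
  proof (rule single_component_minimality[OF aV])
    fix j assume "j \<noteq> i"
    show "AE x in lebesgue_on \<Omega>. \<bar>V x\<bar> * u x $ j = 0"
      using in_\<omega>_iff u_segregated
    proof eventually_elim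
      case (elim x)
      show ?case
      proof (cases "x \<in> \<omega> i")
        case True
        then have "u x $ i > 0" using elim(1) by blast
        moreover have "u x $ i * u x $ j = 0" using elim(2) \<open>j \<noteq> i\<close> by metis
        ultimately show ?thesis by simp
      qed (simp add: V_def)
    qed
  qed simp
  also have "(LINT x|lebesgue_on \<Omega>. \<bar>V x\<bar>) = 1"
  proof -
    have "(\<lambda>x. \<bar>V x\<bar>) = (\<lambda>x. if x \<in> \<omega> i then \<bar>v x\<bar> else 0)" by (auto simp: V_def)
    then show ?thesis using L1 unfolding integral_subset[OF sub] by simp
  qed
  also have "sq_integral \<Omega> (\<lambda>x. sgn (V x) *\<^sub>R K x) \<le> sq_integral \<Omega> K"
    by (rule sq_integral_mono[OF H10_gradientD(2)[OF aV] H10_gradientD(2)[OF V]]) (auto simp: abs_sgn_eq)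
  also have "\<dots> = sq_integral (\<omega> i) k"
    unfolding sq_integral_subset[OF sub] K_def ..
  finally show ?thesis by simp
qed

text \<open>With \<open>\<phi>\<close> close to \<open>u\<^sub>i\<close>, \<open>\<theta>\<close> a cutoff of the support of \<open>\<phi>\<close> and \<open>\<epsilon>\<close> small, the function
  \<open>(min u\<^sub>i \<phi> - \<epsilon> \<theta>)\<^sup>+\<close> is close to \<open>u\<^sub>i\<close> and has compact support in \<open>\<omega> i\<close>.\<close>

lemma compactly_supported_approximation:
  assumes \<delta>: "0 < \<delta>"
  obtains z k where "H10_gradient (\<omega> i) z k" "1 - \<delta> \<le> (LINT x|lebesgue_on (\<omega> i). \<bar>z x\<bar>)"
    "sq_integral (\<omega> i) k \<le> (1 + \<delta>) * energy i + \<delta>"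
proof -
  note sub = open_\<omega>[of i] open_\<Omega> \<omega>_subset[of i]
  \<comment> \<open>The budget for the gradient error \<open>r\<close>, chosen so that
    \<open>(1 + 1 / \<delta>) * \<tau> = \<delta>\<close> in the weighted estimate at the
    end.\<close>
  define \<tau> where "\<tau> = \<delta>\<^sup>2 / (1 + \<delta>)"
  define M where "M = sq_integral \<Omega> (\<lambda>x. 1 :: real)"
  have one: "(\<lambda>x. 1 :: real) \<in> L2 \<Omega>" by (rule L2_bounded[OF \<Omega>, where B=1]) auto
  have \<tau>: "0 < \<tau>" and M: "0 \<le> M" using \<delta> by (auto simp: \<tau>_def M_def)
  \<comment> \<open>The first bound spends half of \<open>\<tau>\<close> on the gradient of
    \<open>h\<close>. The second makes the integral of \<open>h\<close> at most
    \<open>\<delta> / 2\<close>, by Cauchy-Schwarz against the constant 1; the summand 1 guards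
    against division by zero.\<close>
  define e where "e = min (\<tau> / 4) (\<delta>\<^sup>2 / (4 * (M + 1)))"
  have e: "0 < e" "e \<le> \<tau> / 4" "e \<le> \<delta>\<^sup>2 / (4 * (M + 1))"
  proof -
    show "0 < e" using \<tau> M \<delta> by (simp add: e_def)
    show "e \<le> \<tau> / 4" unfolding e_def by (rule min.cobounded1)
    show "e \<le> \<delta>\<^sup>2 / (4 * (M + 1))" unfolding e_def by (rule min.cobounded2)
  qed
  obtain \<phi> where \<phi>: "\<phi> \<in> test_functions \<Omega>" "sq_integral \<Omega> (\<lambda>x. u x $ i - \<phi> x) < e"
    "sq_integral \<Omega> (\<lambda>x. g i x - gradient \<phi> x) < e"
    using H10_gradientE[OF u_gradient e(1)] by blast
  obtain K where K: "compact K" "K \<subseteq> \<Omega>" "\<And>x. x \<notin> K \<Longrightarrow> \<phi> x = 0"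
    by (rule test_functionsE[OF \<phi>(1)]) blast
  obtain \<theta> where \<theta>: "\<theta> \<in> test_functions \<Omega>" "\<And>x. 0 \<le> \<theta> x" "\<And>x. \<theta> x \<le> 1" "\<And>x. x \<in> K \<Longrightarrow> 1 - 1 / 2 \<le> \<theta> x"
    using ex_cutoff[OF K(1) open_\<Omega> K(2), of "1 / 2"] by auto
  define T where "T = (LINT x|lebesgue_on \<Omega>. \<theta> x)"
  define E where "E = sq_integral \<Omega> (gradient \<theta>)"
  have T: "0 \<le> T" and E: "0 \<le> E" using \<theta>(2) by (auto simp: T_def E_def intro!: integral_nonneg_AE)
  \<comment> \<open>Lowering by \<open>\<epsilon> * \<theta> x\<close> may cost the other half of
    the mass budget, \<open>\<delta> / 2\<close>, and the other half of the gradient budget,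
    \<open>\<tau> / 2\<close>.\<close>
  define \<epsilon> where "\<epsilon> = min 1 (min (\<delta> / (2 * (T + 1))) (\<tau> / (4 * (E + 1))))"
  have \<epsilon>: "0 < \<epsilon>" "\<epsilon> \<le> 1" "\<epsilon> \<le> \<delta> / (2 * (T + 1))" "\<epsilon> \<le> \<tau> / (4 * (E + 1))"
  proof -
    show "0 < \<epsilon>" using \<delta> \<tau> T E by (simp add: \<epsilon>_def)
    show "\<epsilon> \<le> 1" unfolding \<epsilon>_def by (rule min.cobounded1)
    show "\<epsilon> \<le> \<delta> / (2 * (T + 1))" "\<epsilon> \<le> \<tau> / (4 * (E + 1))"
      unfolding \<epsilon>_def by (rule min.coboundedI2, rule min.cobounded1, rule min.coboundedI2, rule min.cobounded2)
  qed
  have \<epsilon>T: "\<epsilon> * T \<le> \<delta> / 2"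
  proof -
    have "\<epsilon> * (T + 1) \<le> \<delta> / 2" using \<epsilon>(3) T by (simp add: field_simps)
    then show ?thesis using \<epsilon>(1) by (simp add: algebra_simps)
  qed
  have \<epsilon>E: "2 * (\<epsilon>\<^sup>2 * E) \<le> \<tau> / 2"
  proof -
    have "\<epsilon>\<^sup>2 * E \<le> \<epsilon> * (E + 1)"
      using \<epsilon>(1,2) E by (intro mult_mono) (auto simp: power2_eq_square mult_left_le)
    also have "\<dots> \<le> \<tau> / 4" using \<epsilon>(4) E by (simp add: field_simps)
    finally show ?thesis by simp
  qed
  \<comment> \<open>Subtracting \<open>h\<close> from the i-th component gives its minimum with
    \<open>\<phi>\<close>, expressed through a positive part so that its gradient is known.\<close>
  define h where "h x = max 0 (u x $ i - \<phi> x)" for x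
  define kh where "kh x = (if u x $ i - \<phi> x > 0 then g i x - gradient \<phi> x else 0)" for x
  \<comment> \<open>\<open>g i x + r x\<close> is the gradient of the function whose positive part
    is \<open>z\<close>.\<close>
  define r where "r x = (- 1) *\<^sub>R kh x + (- \<epsilon>) *\<^sub>R gradient \<theta> x" for x
  define z where "z x = max 0 (u x $ i - h x - \<epsilon> * \<theta> x)" for x
  define k where "k x = (if u x $ i - h x - \<epsilon> * \<theta> x > 0 then g i x - kh x - \<epsilon> *\<^sub>R gradient \<theta> x else 0)" for x
  have d: "H10_gradient \<Omega> (\<lambda>x. u x $ i - \<phi> x) (\<lambda>x. g i x - gradient \<phi> x)"
    by (intro H10_gradient_diff[OF \<Omega>] u_gradient H10_gradient_test_function[OF \<Omega> \<phi>(1)])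
  have h: "H10_gradient \<Omega> h kh"
    unfolding h_def[abs_def] kh_def[abs_def] by (rule H10_gradient_positive_part[OF \<Omega> d])
  have z\<Omega>: "H10_gradient \<Omega> z k"
    unfolding z_def[abs_def] k_def[abs_def]
    by (intro H10_gradient_positive_part[OF \<Omega>] H10_gradient_diff[OF \<Omega>] H10_gradient_scale[OF \<Omega>] u_gradient h
        H10_gradient_test_function[OF \<Omega> \<theta>(1)])
  \<comment> \<open>Off \<open>K\<close> the minimum with \<open>\<phi>\<close> is not positive. On
    \<open>K\<close> at least \<open>\<epsilon> / 2\<close> is subtracted, so \<open>z\<close> can
    be positive only where the i-th component exceeds \<open>\<epsilon> / 2\<close>. Continuity of
    \<open>w\<close> makes this set closed, hence compact in \<open>\<omega> i\<close>.\<close>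
  define K' where "K' = K \<inter> (\<lambda>x. w x $ i) -` {\<epsilon> / 2..}"
  have "compact K'"
  proof -
    have "closed K'"
      unfolding K'_def
      by (rule continuous_closed_preimage[OF continuous_on_subset[OF w_continuous K(2)] compact_imp_closed[OF K(1)]]) simp
    then show ?thesis using compact_Int_closed[OF K(1), of K'] by (simp add: K'_def Int_absorb1 inf_assoc)
  qed
  have "K' \<subseteq> \<omega> i" using K(2) \<epsilon>(1) by (auto simp: K'_def positivity_set_def)
  have zK': "AE x in lebesgue_on \<Omega>. x \<notin> K' \<longrightarrow> z x = 0"
    using w_eq_u u_nonneg
  proof eventually_elim
    case (elim x)
    have \<theta>0: "0 \<le> \<epsilon> * \<theta> x" using \<epsilon>(1) \<theta>(2)[of x] by simp
    show ?case
    proof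
      assume "x \<notin> K'"
      then consider "x \<notin> K" | "x \<in> K" "\<not> \<epsilon> / 2 \<le> w x $ i" unfolding K'_def by blast
      then have "u x $ i - h x - \<epsilon> * \<theta> x \<le> 0"
      proof cases
        case 1
        then show ?thesis using K(3)[OF 1] elim(2) \<theta>0 by (simp add: h_def)
      next
        case 2
        have "\<epsilon> * (1 - 1 / 2) \<le> \<epsilon> * \<theta> x" using \<theta>(4)[OF 2(1)] \<epsilon>(1) by (intro mult_left_mono) auto
        moreover have "0 \<le> h x" by (simp add: h_def)
        ultimately show ?thesis using 2(2) elim(1) by simp
      qed
      then show "z x = 0" by (simp add: z_def)
    qed
  qed
  have z\<omega>: "H10_gradient (\<omega> i) z k"
    by (rule H10_gradient_compact_support[OF open_\<omega> \<Omega> \<omega>_subset \<open>compact K'\<close> \<open>K' \<subseteq> \<omega> i\<close> z\<Omega> zK'])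
  have "1 - \<delta> \<le> (LINT x|lebesgue_on \<Omega>. u x $ i - h x - \<epsilon> * \<theta> x)"
  proof -
    note int = u_integrable[of i] L2_integrable[OF \<Omega> H10_gradientD(1)[OF h]] L2_integrable[OF \<Omega> test_functions_L2[OF \<Omega> \<theta>(1)]]
    have "(LINT x|lebesgue_on \<Omega>. h x)\<^sup>2 \<le> (\<delta> / 2)\<^sup>2"
    proof -
      have "(LINT x|lebesgue_on \<Omega>. h x)\<^sup>2 \<le> sq_integral \<Omega> h * M"
        using L2_Cauchy_Schwarz[OF H10_gradientD(1)[OF h] one] by (simp add: M_def)
      also have "\<dots> \<le> e * (M + 1)"
      proof (intro mult_mono)
        have "sq_integral \<Omega> h \<le> sq_integral \<Omega> (\<lambda>x. u x $ i - \<phi> x)"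
          by (rule sq_integral_mono[OF H10_gradientD(1)[OF h] H10_gradientD(1)[OF d]]) (simp add: h_def)
        then show "sq_integral \<Omega> h \<le> e" using \<phi>(2) by linarith
      qed (use e M in auto)
      also have "\<dots> \<le> (\<delta> / 2)\<^sup>2" using e(3) M by (simp add: field_simps power2_eq_square)
      finally show ?thesis .
    qed
    then have "(LINT x|lebesgue_on \<Omega>. h x) \<le> \<delta> / 2"
      by (rule power2_le_imp_le) (use \<delta> in simp)
    then show ?thesis using int \<epsilon>T by (simp add: u_integral T_def[symmetric])
  qed
  also have "\<dots> \<le> (LINT x|lebesgue_on \<Omega>. \<bar>z x\<bar>)"
  proof (rule integral_mono)
    show "integrable (lebesgue_on \<Omega>) (\<lambda>x. u x $ i - h x - \<epsilon> * \<theta> x)"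
      using u_integrable[of i] L2_integrable[OF \<Omega> H10_gradientD(1)[OF h]] L2_integrable[OF \<Omega> test_functions_L2[OF \<Omega> \<theta>(1)]] by simp
    show "integrable (lebesgue_on \<Omega>) (\<lambda>x. \<bar>z x\<bar>)"
      using L2_integrable[OF \<Omega> H10_gradientD(1)[OF z\<Omega>]] by simp
  qed (simp add: z_def)
  also have "\<dots> = (LINT x|lebesgue_on (\<omega> i). \<bar>z x\<bar>)"
    unfolding integral_subset[OF sub]
  proof (rule integral_cong_AE)
    note m = L2_measurable[OF H10_gradientD(1)[OF z\<omega>]]
    show "(\<lambda>x. \<bar>z x\<bar>) \<in> borel_measurable (lebesgue_on \<Omega>)"
      using L2_measurable[OF H10_gradientD(1)[OF z\<Omega>]] by measurable
    have "(\<lambda>x. \<bar>z x\<bar>) \<in> borel_measurable (lebesgue_on (\<omega> i))" using m by measurable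
    then show "(\<lambda>x. if x \<in> \<omega> i then \<bar>z x\<bar> else 0) \<in> borel_measurable (lebesgue_on \<Omega>)"
      using sub by (subst borel_measurable_if_lebesgue_on) auto
    show "AE x in lebesgue_on \<Omega>. \<bar>z x\<bar> = (if x \<in> \<omega> i then \<bar>z x\<bar> else 0)"
      using zK' by (rule eventually_mono) (use \<open>K' \<subseteq> \<omega> i\<close> in auto)
  qed
  finally have L1: "1 - \<delta> \<le> (LINT x|lebesgue_on (\<omega> i). \<bar>z x\<bar>)" .
  have L2r: "r \<in> L2 \<Omega>"
    unfolding r_def[abs_def] by (intro L2_add L2_scaleR H10_gradientD(2)[OF h] gradient_L2[OF \<Omega> \<theta>(1)])
  have "sq_integral \<Omega> r \<le> 2 * sq_integral \<Omega> (\<lambda>x. (- 1) *\<^sub>R kh x) + 2 * sq_integral \<Omega> (\<lambda>x. (- \<epsilon>) *\<^sub>R gradient \<theta> x)"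
    unfolding r_def by (intro sq_integral_add_le L2_scaleR H10_gradientD(2)[OF h] gradient_L2[OF \<Omega> \<theta>(1)])
  also have "\<dots> = 2 * sq_integral \<Omega> kh + 2 * (\<epsilon>\<^sup>2 * E)"
    by (simp add: power_mult_distrib E_def)
  also have "sq_integral \<Omega> kh \<le> sq_integral \<Omega> (\<lambda>x. g i x - gradient \<phi> x)"
    by (rule sq_integral_mono[OF H10_gradientD(2)[OF h] H10_gradientD(2)[OF d]]) (simp add: kh_def)
  finally have r: "sq_integral \<Omega> r \<le> \<tau>" using \<phi>(3) e(2) \<epsilon>E by simp
  have "sq_integral (\<omega> i) k \<le> sq_integral \<Omega> k"
    by (rule L2_subset(2)[OF sub H10_gradientD(2)[OF z\<Omega>]])
  also have "\<dots> \<le> sq_integral \<Omega> (\<lambda>x. g i x + r x)"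
    by (rule sq_integral_mono[OF H10_gradientD(2)[OF z\<Omega>] L2_add[OF g_L2 L2r]]) (simp add: k_def r_def algebra_simps)
  also have "\<dots> \<le> (1 + \<delta>) * energy i + (1 + 1 / \<delta>) * sq_integral \<Omega> r"
    using sq_integral_add_weighted[OF g_L2 L2r \<delta>] by (simp add: energy_def)
  also have "(1 + 1 / \<delta>) * sq_integral \<Omega> r \<le> (1 + 1 / \<delta>) * \<tau>"
    using r \<delta> by (intro mult_left_mono) auto
  also have "(1 + 1 / \<delta>) * \<tau> = \<delta>"
  proof -
    have "1 + 1 / \<delta> = (1 + \<delta>) / \<delta>" "1 + \<delta> \<noteq> 0" using \<delta> by (simp_all add: field_simps)
    then show ?thesis using \<delta> by (simp add: \<tau>_def power2_eq_square)
  qed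
  finally have "sq_integral (\<omega> i) k \<le> (1 + \<delta>) * energy i + \<delta>" by simp
  with z\<omega> L1 show ?thesis by (rule that)
qed

text \<open>One inequality is \<open>lambda21_le\<close> for the compactly supported approximations
  as \<open>\<delta>\<close> tends to 0; the other holds for each competitor on
  \<open>\<omega> i\<close> by extension to \<open>\<Omega>\<close>.\<close>

lemma lambda21_eq_energy: "lambda21 (\<omega> i) = energy i"
proof (rule antisym)
  have le: "lambda21 (\<omega> i) * (1 - \<delta>)\<^sup>2 \<le> (1 + \<delta>) * energy i + \<delta>"
    and ne: "{dirichlet_energy (\<omega> i) u |u. u \<in> H10 (\<omega> i) \<and> L1_norm (\<omega> i) u = 1} \<noteq> {}"
    if \<delta>: "0 < \<delta>" "\<delta> < 1" for \<delta>
  proof -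
    obtain z k where z: "H10_gradient (\<omega> i) z k" "1 - \<delta> \<le> (LINT x|lebesgue_on (\<omega> i). \<bar>z x\<bar>)"
      "sq_integral (\<omega> i) k \<le> (1 + \<delta>) * energy i + \<delta>"
      using compactly_supported_approximation[OF \<delta>(1)] by blast
    have pos: "0 < (LINT x|lebesgue_on (\<omega> i). \<bar>z x\<bar>)" using z(2) \<delta>(2) by linarith
    note l = lambda21_le[OF open_\<omega> bounded_\<omega> z(1) pos]
    show ne: "{dirichlet_energy (\<omega> i) u |u. u \<in> H10 (\<omega> i) \<and> L1_norm (\<omega> i) u = 1} \<noteq> {}" by (rule l(2))
    have "0 \<le> lambda21 (\<omega> i)" by (rule le_lambda21[OF open_\<omega> bounded_\<omega> ne]) simp
    then have "lambda21 (\<omega> i) * (1 - \<delta>)\<^sup>2 \<le> lambda21 (\<omega> i) * (LINT x|lebesgue_on (\<omega> i). \<bar>z x\<bar>)\<^sup>2"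
      using z(2) \<delta>(2) by (intro mult_left_mono power_mono) auto
    with l(1) z(3) show "lambda21 (\<omega> i) * (1 - \<delta>)\<^sup>2 \<le> (1 + \<delta>) * energy i + \<delta>" by linarith
  qed
  \<comment> \<open>The shift by 2 keeps \<open>\<delta> = 1 / real (n + 2)\<close> strictly below
    1.\<close>
  have "(\<lambda>n. lambda21 (\<omega> i) * (1 - 1 / real (n + 2))\<^sup>2) \<longlonglongrightarrow> lambda21 (\<omega> i) * (1 - 0)\<^sup>2"
    and "(\<lambda>n. (1 + 1 / real (n + 2)) * energy i + 1 / real (n + 2)) \<longlonglongrightarrow> (1 + 0) * energy i + 0"
    by (intro tendsto_intros LIMSEQ_ignore_initial_segment[OF lim_1_over_n])+
  then have "lambda21 (\<omega> i) * (1 - 0)\<^sup>2 \<le> (1 + 0) * energy i + 0"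
    by (rule LIMSEQ_le) (use le in auto)
  then show "lambda21 (\<omega> i) \<le> energy i" by simp
  show "energy i \<le> lambda21 (\<omega> i)"
    by (rule le_lambda21[OF open_\<omega> bounded_\<omega> ne[of "1 / 2"] energy_le_of_H10_gradient]) auto
qed

section \<open>From the sets of \<open>u\<close> to those of its continuous representative\<close>

lemma integral_indicator_\<omega>:
  assumes "\<phi> \<in> test_functions \<Omega>"
  shows "integrable (lebesgue_on \<Omega>) (\<lambda>x. indicat_real (\<omega> j) x * \<phi> x)"
    and "(LINT x|lebesgue_on \<Omega>. indicat_real (\<omega> j) x * \<phi> x) = (LINT x|lebesgue_on \<Omega>. (if u x $ j > 0 then \<phi> x else 0))"
proof -
  have m: "(\<lambda>x. indicat_real (\<omega> j) x * \<phi> x) \<in> borel_measurable (lebesgue_on \<Omega>)"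
    using open_\<omega> by (intro borel_measurable_times L2_measurable[OF test_functions_L2[OF \<Omega> assms]] measurable_lebesgue_onI) auto
  have eq: "AE x in lebesgue_on \<Omega>. indicat_real (\<omega> j) x * \<phi> x = (if u x $ j > 0 then \<phi> x else 0)"
    using in_\<omega>_iff by (rule eventually_mono) auto
  note int = integrable_test_restrict[OF assms pred_positive[of j]]
  from integrable_cong_AE[OF m borel_measurable_integrable[OF int] eq] int
  show "integrable (lebesgue_on \<Omega>) (\<lambda>x. indicat_real (\<omega> j) x * \<phi> x)" by simp
  show "(LINT x|lebesgue_on \<Omega>. indicat_real (\<omega> j) x * \<phi> x) = (LINT x|lebesgue_on \<Omega>. (if u x $ j > 0 then \<phi> x else 0))"
    by (rule integral_cong_AE[OF m borel_measurable_integrable[OF int] eq])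
qed

lemma integral_indicator_\<omega>_zero_set:
  assumes "\<phi> \<in> test_functions \<Omega>"
  shows "integrable (lebesgue_on \<Omega>) (\<lambda>x. indicat_real (\<omega> j \<union> zero_set \<Omega> w) x * \<phi> x)"
    and "(LINT x|lebesgue_on \<Omega>. indicat_real (\<omega> j \<union> zero_set \<Omega> w) x * \<phi> x) =
      (LINT x|lebesgue_on \<Omega>. (if u x $ j > 0 \<or> (\<forall>l. u x $ l = 0) then \<phi> x else 0))"
proof -
  have "w \<in> borel_measurable (lebesgue_on \<Omega>)"
    using representative open_\<Omega>
    by (intro continuous_imp_measurable_on_sets_lebesgue) (auto simp: continuous_representative_def)
  then have "{x \<in> space (lebesgue_on \<Omega>). w x = 0} \<in> sets (lebesgue_on \<Omega>)" by measurable
  then have "zero_set \<Omega> w \<in> sets (lebesgue_on \<Omega>)" by (simp add: zero_set_def)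
  moreover have "\<omega> j \<in> sets (lebesgue_on \<Omega>)"
    using open_\<omega> \<omega>_subset open_\<Omega> by (simp add: sets_restrict_space_iff)
  ultimately have m: "(\<lambda>x. indicat_real (\<omega> j \<union> zero_set \<Omega> w) x * \<phi> x) \<in> borel_measurable (lebesgue_on \<Omega>)"
    by (intro borel_measurable_times L2_measurable[OF test_functions_L2[OF \<Omega> assms]] borel_measurable_indicator) auto
  have eq: "AE x in lebesgue_on \<Omega>. indicat_real (\<omega> j \<union> zero_set \<Omega> w) x * \<phi> x = (if u x $ j > 0 \<or> (\<forall>l. u x $ l = 0) then \<phi> x else 0)"
    using in_\<omega>_iff in_zero_set_iff by eventually_elim (auto simp: indicator_def)
  note int = integrable_test_restrict[OF assms pred_positive_or_zero[of j]]
  from integrable_cong_AE[OF m borel_measurable_integrable[OF int] eq] int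
  show "integrable (lebesgue_on \<Omega>) (\<lambda>x. indicat_real (\<omega> j \<union> zero_set \<Omega> w) x * \<phi> x)" by simp
  show "(LINT x|lebesgue_on \<Omega>. indicat_real (\<omega> j \<union> zero_set \<Omega> w) x * \<phi> x) =
      (LINT x|lebesgue_on \<Omega>. (if u x $ j > 0 \<or> (\<forall>l. u x $ l = 0) then \<phi> x else 0))"
    by (rule integral_cong_AE[OF m borel_measurable_integrable[OF int] eq])
qed

lemma H10_gradient_in_H1: "H10_gradient \<Omega> v k \<Longrightarrow> v \<in> H1 \<Omega>"
  using H10_iff[OF \<Omega>] by (auto simp: H10_def)

lemma component_inequality:
  "weak_neg_laplacian_le \<Omega> (\<lambda>x. u x $ i) (\<lambda>x. lambda21 (\<omega> i) * indicat_real (\<omega> i) x)"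
  unfolding weak_neg_laplacian_le_def
proof (intro conjI ballI impI)
  show "(\<lambda>x. u x $ i) \<in> H1 \<Omega>" by (rule H10_gradient_in_H1[OF u_gradient])
  fix \<phi> assume \<phi>: "\<phi> \<in> test_functions \<Omega>" "\<forall>x. 0 \<le> \<phi> x"
  have "(LINT x|lebesgue_on \<Omega>. lambda21 (\<omega> i) * indicat_real (\<omega> i) x * \<phi> x)
      = energy i * (LINT x|lebesgue_on \<Omega>. indicat_real (\<omega> i) x * \<phi> x)"
    by (simp add: lambda21_eq_energy mult.assoc)
  then show "(LINT x|lebesgue_on \<Omega>. g i x \<bullet> gradient \<phi> x) \<le> (LINT x|lebesgue_on \<Omega>. lambda21 (\<omega> i) * indicat_real (\<omega> i) x * \<phi> x)"
    using component_subsolution[of \<phi> i] \<phi> by (simp add: integral_indicator_\<omega>(2))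
qed

lemma difference_inequality:
  "weak_neg_laplacian_ge \<Omega> (\<lambda>x. u x $ i - (\<Sum>j\<in>UNIV - {i}. u x $ j))
     (\<lambda>x. lambda21 (\<omega> i) * indicat_real (\<omega> i \<union> zero_set \<Omega> w) x
        - (\<Sum>j\<in>UNIV - {i}. lambda21 (\<omega> j) * indicat_real (\<omega> j) x))"
  unfolding weak_neg_laplacian_ge_def
proof (intro conjI ballI impI)
  have U: "H10_gradient \<Omega> (\<lambda>x. u x $ i - (\<Sum>j\<in>UNIV - {i}. u x $ j)) (\<lambda>x. g i x - (\<Sum>j\<in>UNIV - {i}. g j x))"
    by (intro H10_gradient_diff[OF \<Omega>] H10_gradient_sum[OF \<Omega>] u_gradient)
  show "(\<lambda>x. u x $ i - (\<Sum>j\<in>UNIV - {i}. u x $ j)) \<in> H1 \<Omega>" by (rule H10_gradient_in_H1[OF U])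
  fix \<phi> assume \<phi>: "\<phi> \<in> test_functions \<Omega>" "\<forall>x. 0 \<le> \<phi> x"
  note i1 = integral_indicator_\<omega>_zero_set[OF \<phi>(1), of i] and i2 = integral_indicator_\<omega>[OF \<phi>(1)]
  note w = H10_gradient_weak_gradient[OF \<Omega> U]
  have "(LINT x|lebesgue_on \<Omega>. (lambda21 (\<omega> i) * indicat_real (\<omega> i \<union> zero_set \<Omega> w) x
        - (\<Sum>j\<in>UNIV - {i}. lambda21 (\<omega> j) * indicat_real (\<omega> j) x)) * \<phi> x)
     = (LINT x|lebesgue_on \<Omega>. energy i * (indicat_real (\<omega> i \<union> zero_set \<Omega> w) x * \<phi> x)
        - (\<Sum>j\<in>UNIV - {i}. energy j * (indicat_real (\<omega> j) x * \<phi> x)))"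
    by (simp only: lambda21_eq_energy left_diff_distrib sum_distrib_right mult.assoc)
  also have "\<dots> = energy i * (LINT x|lebesgue_on \<Omega>. indicat_real (\<omega> i \<union> zero_set \<Omega> w) x * \<phi> x)
        - (\<Sum>j\<in>UNIV - {i}. energy j * (LINT x|lebesgue_on \<Omega>. indicat_real (\<omega> j) x * \<phi> x))"
    using i1(1) i2(1) by (simp add: Bochner_Integration.integral_sum)
  also have "\<dots> \<le> (LINT x|lebesgue_on \<Omega>. (g i x - (\<Sum>j\<in>UNIV - {i}. g j x)) \<bullet> gradient \<phi> x)"
    unfolding i1(2) i2(2) using \<phi> by (intro difference_supersolution) auto
  \<comment> \<open>\<open>weak_gradient\<close> of the difference is a choice of its own, equal to
    the difference of the gradients only almost everywhere.\<close>
  also have "\<dots> = (LINT x|lebesgue_on \<Omega>. weak_gradient \<Omega> (\<lambda>x. u x $ i - (\<Sum>j\<in>UNIV - {i}. u x $ j)) x \<bullet> gradient \<phi> x)"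
    using w(2) L2_measurable[OF w(1)] L2_measurable[OF H10_gradientD(2)[OF U]] L2_measurable[OF gradient_L2[OF \<Omega> \<phi>(1)]]
    by (intro integral_cong_AE borel_measurable_inner) (auto elim!: eventually_mono)
  finally show "(LINT x|lebesgue_on \<Omega>. (lambda21 (\<omega> i) * indicat_real (\<omega> i \<union> zero_set \<Omega> w) x
        - (\<Sum>j\<in>UNIV - {i}. lambda21 (\<omega> j) * indicat_real (\<omega> j) x)) * \<phi> x)
      \<le> (LINT x|lebesgue_on \<Omega>. weak_gradient \<Omega> (\<lambda>x. u x $ i - (\<Sum>j\<in>UNIV - {i}. u x $ j)) x \<bullet> gradient \<phi> x)" .
qed

end

theorem proposition1p2:
  fixes \<Omega> :: "(real^'n) set"
    and u w :: "real^'n \<Rightarrow> real^'k"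
    and \<omega> :: "'k \<Rightarrow> (real^'n) set"
    and i :: 'k
  assumes "CARD('n) \<ge> 2"
    and "bounded_smooth_domain \<Omega>"
    and "minimizer_P \<Omega> u"
    and "continuous_representative \<Omega> u w"
    and "\<And>j. \<omega> j = positivity_set \<Omega> w j"
  shows "weak_neg_laplacian_le \<Omega> (\<lambda>x. u x $ i)
           (\<lambda>x. lambda21 (\<omega> i) * indicat_real (\<omega> i) x) \<and>
         weak_neg_laplacian_ge \<Omega> (\<lambda>x. u x $ i - (\<Sum>j\<in>UNIV - {i}. u x $ j))
           (\<lambda>x. lambda21 (\<omega> i) * indicat_real (\<omega> i \<union> zero_set \<Omega> w) x
                - (\<Sum>j\<in>UNIV - {i}. lambda21 (\<omega> j) * indicat_real (\<omega> j) x))"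
proof -
  interpret continuous_minimizer \<Omega> u w
    using assms by unfold_locales (auto simp: bounded_smooth_domain_def)
  show ?thesis
    unfolding assms(5) using component_inequality difference_inequality by blast
qed

end
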